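(* A totally nonnegative matrix $X\in GL_n(\mathbb{R}((t)))_{\ge0}$ is not totally positive if and only if it is a finite product of whirls with nonnegative parameters, curls with nonnegative parameters, upper or lower Chevalley generators with nonnegative parameters, shift matrices $S^{\pm1}$, and diagonal matrices in $T_{>0}$.
   Context: Fix $n\ge1$. $\mathbb{R}((t))$ is the field of formal Laurent series. $GL_n(\mathbb{R}((t)))$ is the group of $n\times n$ matrices $A(t)=(a_{ij}(t))$ over $\mathbb{R}((t))$ with non-zero determinant. $A(t)$ is identified with its unfolding: the doubly infinite real matrix $X=(x_{i,j})_{i,j\in\mathbb{Z}}$ with $x_{i+n,j+n}=x_{i,j}$ and $a_{ij}(t)=\sum_{k\in\mathbb{Z}}x_{i,j+kn}t^k$ for $1\le i,j\le n$; this is compatible with multiplication. $\Delta_{I,J}(X)$ denotes the minor of $X$ with row set $I$ and column set $J$ (finite subsets of $\mathbb{Z}$ of equal cardinality). $X$ is totally nonnegative if all its finite minors are nonnegative; the set of such $X$ is $GL_n(\mathbb{R}((t)))_{\geq 0}$. A totally nonnegative $X$ is totally positive if there exists an integer $k$ such that $\Delta_{I,J}(X)>0$ for all $I=\{i_1<\dots<i_r\}$, $J=\{j_1<\dots<j_r\}$ satisfying $i_t\le j_t+k$ for each $t\in\{1,\dots,r\}$. Upper Chevalley generators: $e_k(a)=(x_{i,j})$ with $x_{i,i}=1$, $x_{i,i+1}=a$ if $i\equiv k\pmod n$, and other entries $0$. Lower Chevalley generators: $f_k(a)$ is the transpose of $e_k(a)$. When $n=1$ there are no Chevalley generators. The shift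 matrix $S$ has entries $s_{ij}=1$ if $j=i+1$ and $0$ otherwise. $T_{>0}$ is the set of $n\times n$ diagonal matrices with positive real (constant) entries. The whirl $M(a_1,\dots,a_n)$ is the matrix with $m_{i,i}=1$, $m_{i,i+1}=a_i$ (index of $a$ modulo $n$), other entries $0$. The curl $N(a_1,\dots,a_n)$ is the upper triangular matrix with $1$'s on the diagonal and $(i,j)$ entry $a_ia_{i+1}\cdots a_{j-1}$ for $i<j$ (indices modulo $n$); equivalently it is the inverse of $M(-a_1,\dots,-a_n)$. *)

theory Defs
  imports
    "HOL-Computational_Algebra.Formal_Laurent_Series"
    "HOL-Number_Theory.Cong"
    "Jordan_Normal_Form.Matrix"
    "Jordan_Normal_Form.Determinant"
begin

section \<open>The formal loop group and unfoldings\<close>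

text \<open>
  Matrix entries are numbered from 0 in the matrix library but from 1 here: the entry
  $a_{ij}(t)$ with $1 \le i, j \le n$ is stored at position $(i - 1, j - 1)$, and every
  integer index $i$ has the residue $(i - 1) \bmod n + 1$ in $\{1, \dots, n\}$.
\<close>

type_synonym infmat = "int \<Rightarrow> int \<Rightarrow> real"

definition GL_loop :: "nat \<Rightarrow> real fls mat set" where
  "GL_loop n = {A \<in> carrier_mat n n. det A \<noteq> 0}"

text \<open>
  The unfolding is the $n$-periodic matrix with
  $a_{ij}(t) = \sum_k x_{i,j+kn} t^k$ for $1 \le i, j \le n$. For a general row index
  $i$, periodicity moves the entry to the row with index in $\{1, \dots, n\}$, which
  lowers the exponent by the quotient $(i - 1) \;\mathrm{div}\; n$.
\<close>

definition unfolding_mat :: "nat \<Rightarrow> real fls mat \<Rightarrow> infmat" where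
  "unfolding_mat n A i j =
     fls_nth (index_mat A (nat ((i - 1) mod int n), nat ((j - 1) mod int n)))
             ((j - 1) div int n - (i - 1) div int n)"

text \<open>
  The inverse operation. It is only meaningful for matrices that are $n$-periodic and
  vanish sufficiently far below the diagonal; see \<open>unfolding_folding\<close>.
\<close>

definition folding_mat :: "nat \<Rightarrow> infmat \<Rightarrow> real fls mat" where
  "folding_mat n x =
     mat n n (\<lambda>(i, j). Abs_fls (\<lambda>k. x (int i + 1) (int j + 1 + k * int n)))"

lemma unfolding_folding:
  assumes n: "n \<ge> 1"
    and per: "\<And>i j. x (i + int n) (j + int n) = x i j"
    and bdd: "\<And>i j. j < i - B \<Longrightarrow> x i j = 0"
  shows "unfolding_mat n (folding_mat n x) = x"
proof (intro ext)
  fix i j :: int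
  have per_nat: "x (i + int m * int n) (j + int m * int n) = x i j" for i j m
  proof (induction m)
    case (Suc m)
    have "x (i + int (Suc m) * int n) (j + int (Suc m) * int n)
        = x (i + int m * int n + int n) (j + int m * int n + int n)"
      by (simp add: algebra_simps)
    then show ?case using per Suc by simp
  qed simp
  have per_int: "x (i + q * int n) (j + q * int n) = x i j" for i j q
  proof (cases "q \<ge> 0")
    case True
    then show ?thesis using per_nat[of i "nat q" j] by simp
  next
    case False
    then show ?thesis using per_nat[of "i + q * int n" "nat (- q)" "j + q * int n"] by simp
  qed
  let ?a = "(i - 1) mod int n" and ?b = "(j - 1) mod int n"
  have a: "0 \<le> ?a" "?a < int n" and b: "0 \<le> ?b" "?b < int n" using n by simp_all
  then have nat_a: "nat ?a < n" and nat_b: "nat ?b < n" by (simp_all add: nat_less_iff)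
  have van: "x (?a + 1) (?b + 1 + k * int n) = 0" if "k < - \<bar>B\<bar> - 1" for k
  proof (rule bdd)
    have "k * int n \<le> (- \<bar>B\<bar> - 2) * int n" using that by (intro mult_right_mono) auto
    also have "\<dots> = - (\<bar>B\<bar> * int n) - 2 * int n" by (simp add: algebra_simps)
    finally have "k * int n \<le> - (\<bar>B\<bar> * int n) - 2 * int n" .
    moreover have "\<bar>B\<bar> * 1 \<le> \<bar>B\<bar> * int n" using n by (intro mult_left_mono) auto
    ultimately show "?b + 1 + k * int n < ?a + 1 - B" using a b n by linarith
  qed
  have "unfolding_mat n (folding_mat n x) i j =
      fls_nth (Abs_fls (\<lambda>k. x (?a + 1) (?b + 1 + k * int n)))
        ((j - 1) div int n - (i - 1) div int n)"
    using a b nat_a nat_b by (simp add: unfolding_mat_def folding_mat_def)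
  also have "\<dots> = x (?a + 1) (?b + 1 + ((j - 1) div int n - (i - 1) div int n) * int n)"
    by (rule nth_Abs_fls_ex_lower_bound) (use van in blast)
  also have "\<dots> = x (?a + 1 + ((i - 1) div int n) * int n)
      (?b + 1 + ((j - 1) div int n - (i - 1) div int n) * int n + ((i - 1) div int n) * int n)"
    by (simp only: per_int)
  also have "?a + 1 + ((i - 1) div int n) * int n = i"
    using div_mult_mod_eq[of "i - 1" "int n"] by linarith
  also have "?b + 1 + ((j - 1) div int n - (i - 1) div int n) * int n
      + ((i - 1) div int n) * int n = j"
    using div_mult_mod_eq[of "j - 1" "int n"] by (simp add: algebra_simps)
  finally show "unfolding_mat n (folding_mat n x) i j = x i j" .
qed

lemma folding_unfolding:
  assumes "A \<in> carrier_mat n n"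
  shows "folding_mat n (unfolding_mat n A) = A"
  using assms
  by (intro eq_matI) (auto simp: folding_mat_def unfolding_mat_def fls_nth_inverse)

section \<open>Total nonnegativity and total positivity\<close>

definition minor :: "int set \<Rightarrow> int set \<Rightarrow> infmat \<Rightarrow> real" where
  "minor I J x = det (mat (card I) (card J)
     (\<lambda>(s, t). x (sorted_list_of_set I ! s) (sorted_list_of_set J ! t)))"

definition GL_loop_nonneg :: "nat \<Rightarrow> real fls mat set" where
  "GL_loop_nonneg n = {A \<in> GL_loop n.
     \<forall>I J. finite I \<and> finite J \<and> card I = card J \<longrightarrow> 0 \<le> minor I J (unfolding_mat n A)}"

definition totally_positive :: "nat \<Rightarrow> real fls mat \<Rightarrow> bool" where
  "totally_positive n A \<longleftrightarrow> A \<in> GL_loop_nonneg n \<and>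
     (\<exists>k::int. \<forall>I J. finite I \<and> finite J \<and> card I = card J \<and>
        (\<forall>t < card I. sorted_list_of_set I ! t \<le> sorted_list_of_set J ! t + k)
        \<longrightarrow> 0 < minor I J (unfolding_mat n A))"

section \<open>Generators\<close>

definition chevalley_upper :: "nat \<Rightarrow> int \<Rightarrow> real \<Rightarrow> infmat" where
  "chevalley_upper n k a i j =
     (if j = i then 1 else if j = i + 1 \<and> [i = k] (mod int n) then a else 0)"

definition chevalley_lower :: "nat \<Rightarrow> int \<Rightarrow> real \<Rightarrow> infmat" where
  "chevalley_lower n k a i j = chevalley_upper n k a j i"

definition shift :: infmat where
  "shift i j = (if j = i + 1 then 1 else 0)"

text \<open>The parameters are $a_1, \dots, a_n$; this is $a_i$ with $i$ read modulo $n$.\<close>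

definition cyc :: "nat \<Rightarrow> (nat \<Rightarrow> real) \<Rightarrow> int \<Rightarrow> real" where
  "cyc n a i = a (nat ((i - 1) mod int n) + 1)"

definition whirl :: "nat \<Rightarrow> (nat \<Rightarrow> real) \<Rightarrow> infmat" where
  "whirl n a i j = (if j = i then 1 else if j = i + 1 then cyc n a i else 0)"

definition curl :: "nat \<Rightarrow> (nat \<Rightarrow> real) \<Rightarrow> infmat" where
  "curl n a i j = (if i \<le> j then \<Prod>k\<in>{i..<j}. cyc n a k else 0)"

lemma cyc_periodic: "cyc n a (i + int n) = cyc n a i"
proof -
  have "(i + int n - 1) mod int n = (i - 1) mod int n"
    using mod_add_self2[of "i - 1" "int n"] by (simp add: algebra_simps)
  then show ?thesis by (simp add: cyc_def)
qed

lemma unfolding_generators: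
  assumes "n \<ge> 1"
  shows "unfolding_mat n (folding_mat n (chevalley_upper n k c)) = chevalley_upper n k c"
    and "unfolding_mat n (folding_mat n (chevalley_lower n k c)) = chevalley_lower n k c"
    and "unfolding_mat n (folding_mat n shift) = shift"
    and "unfolding_mat n (folding_mat n (whirl n a)) = whirl n a"
    and "unfolding_mat n (folding_mat n (curl n a)) = curl n a"
proof -
  show "unfolding_mat n (folding_mat n (chevalley_upper n k c)) = chevalley_upper n k c"
    by (rule unfolding_folding[OF assms, where B = 1]) (auto simp: chevalley_upper_def cong_def)
  show "unfolding_mat n (folding_mat n (chevalley_lower n k c)) = chevalley_lower n k c"
    by (rule unfolding_folding[OF assms, where B = 1])
      (auto simp: chevalley_lower_def chevalley_upper_def cong_def)
  show "unfolding_mat n (folding_mat n shift) = shift"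
    by (rule unfolding_folding[OF assms, where B = 1]) (auto simp: shift_def)
  show "unfolding_mat n (folding_mat n (whirl n a)) = whirl n a"
    by (rule unfolding_folding[OF assms, where B = 1]) (auto simp: whirl_def cyc_periodic)
  show "unfolding_mat n (folding_mat n (curl n a)) = curl n a"
  proof (rule unfolding_folding[OF assms, where B = 1])
    fix i j :: int
    have "(\<Prod>k\<in>{i + int n..<j + int n}. cyc n a k) = (\<Prod>k\<in>{i..<j}. cyc n a k)"
      by (rule prod.reindex_bij_witness[of _ "\<lambda>k. k + int n" "\<lambda>k. k - int n"])
        (use cyc_periodic[of n a "k - int n" for k] in auto)
    then show "curl n a (i + int n) (j + int n) = curl n a i j"
      by (simp add: curl_def)
  qed (auto simp: curl_def)
qed

definition whirls :: "nat \<Rightarrow> real fls mat set" where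
  "whirls n = {folding_mat n (whirl n a) | a. \<forall>i\<in>{1..n}. 0 \<le> a i}"

definition curls :: "nat \<Rightarrow> real fls mat set" where
  "curls n = {folding_mat n (curl n a) | a. \<forall>i\<in>{1..n}. 0 \<le> a i}"

text \<open>
  For $n = 1$ there are no Chevalley generators, although the formula for the unfolding
  still makes sense.
\<close>

definition chevalleys :: "nat \<Rightarrow> real fls mat set" where
  "chevalleys n = (if n \<ge> 2
     then {folding_mat n (chevalley_upper n k a) | k a. 0 \<le> a} \<union>
          {folding_mat n (chevalley_lower n k a) | k a. 0 \<le> a}
     else {})"

definition shifts :: "nat \<Rightarrow> real fls mat set" where
  "shifts n = {folding_mat n shift} \<union>
     {B \<in> carrier_mat n n. inverts_mat (folding_mat n shift) B \<and> inverts_mat B (folding_mat n shift)}"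

definition torus_pos :: "nat \<Rightarrow> real fls mat set" where
  "torus_pos n = {mat_diag n (\<lambda>i. fls_const (d i)) | d. \<forall>i<n. 0 < d i}"

definition generators :: "nat \<Rightarrow> real fls mat set" where
  "generators n = whirls n \<union> curls n \<union> chevalleys n \<union> shifts n \<union> torus_pos n"

definition mat_product :: "nat \<Rightarrow> real fls mat list \<Rightarrow> real fls mat" where
  "mat_product n Ys = foldr (*) Ys (1\<^sub>m n)"

end

theory Submission
  imports Defs
begin

text \<open>
  Total positivity fails exactly when some north-east corner of the unfolding (rows \<open>\<le> r\<close>,
  columns \<open>> c\<close>) has finite rank. Both implications pass through this rank.

  From factors to a small corner: in a single generator the block of rows \<open>\<le> r\<close> and columns
  \<open>> r\<close> has rank at most 1, and these ranks add up under multiplication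
  (\<open>product_corner_rank\<close>). So in a product of \<open>p\<close> generators all minors of size \<open>p + 1\<close> in such a
  block vanish, however far to the right they lie, and no shift \<open>k\<close> can witness total positivity.

  From a vanishing minor to a small corner: take a vanishing minor of least size \<open>r + 1\<close> among
  those with columns far to the right of the rows. Three-term determinantal identities move its
  gaps away, so its rows and columns may be taken consecutive. Dodgson condensation then spreads
  the vanishing: the other way out would be a linear dependence, within a south-west part of the
  matrix, of columns far to the right or of rows far above, and invertibility over Laurent series
  forbids this. The outcome
  is that all rows from there upwards are combinations of \<open>r\<close> fixed rows on the columns of the
  corner (\<open>vanishing_corner\<close>).

  From a small corner to factors: if the rows are infinite to the right, the ratios
  \<open>x i l / x (i + 1) l\<close> decrease in \<open>l\<close>, and their limits are the parameters of a curl which splits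
  off on the left. The quotient stays totally nonnegative because it is a limit of Whitney
  eliminations of the column \<open>l\<close> (\<open>peeled_tnn\<close>), and its corner rank is smaller because the limit
  direction of the columns lies in the finite-dimensional column space of the corner and is
  annihilated (\<open>peeled_corner\<close>). After finitely many steps the matrix is a band. A band is treated
  by induction on the number of nonzero entries in \<open>n\<close> consecutive rows: if two neighbouring rows
  end or begin in the same column, one Whitney elimination splits off a Chevalley generator;
  otherwise both edges of the band are diagonals. Two different diagonals allow a whirl to be
  split off, found as a limit of eliminations that start further and further down
  (\<open>strict_band_unfolding\<close>); if the diagonals coincide, what is left is a shift times a diagonal
  matrix.
\<close>

section \<open>Minors indexed by lists\<close>

text \<open>
  Indexing by lists rather than by sets lets a row or column be appended, moved or repeated, so
  that the determinantal identities below can be stated by concatenation.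
\<close>

definition list_minor :: "('a \<Rightarrow> 'b \<Rightarrow> real) \<Rightarrow> 'a list \<Rightarrow> 'b list \<Rightarrow> real" where
  "list_minor x I J = det (mat (length I) (length J) (\<lambda>(s, t). x (I ! s) (J ! t)))"

definition delete_nth :: "nat \<Rightarrow> 'a list \<Rightarrow> 'a list" where
  "delete_nth k xs = take k xs @ drop (Suc k) xs"

lemma length_delete_nth [simp]: "k < length xs \<Longrightarrow> length (delete_nth k xs) = length xs - 1"
  by (simp add: delete_nth_def)

lemma nth_delete_nth:
  "k < length xs \<Longrightarrow> i < length xs - 1 \<Longrightarrow>
    delete_nth k xs ! i = xs ! (if i < k then i else Suc i)"
  by (auto simp: delete_nth_def nth_append min_def)

lemma delete_nth_append:
  "delete_nth k (xs @ ys) =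
    (if k < length xs then delete_nth k xs @ ys else xs @ delete_nth (k - length xs) ys)"
  by (auto simp: delete_nth_def Suc_diff_le)

lemma delete_nth_0 [simp]: "delete_nth 0 (y # ys) = ys"
  by (simp add: delete_nth_def)

lemma delete_nth_Suc [simp]: "delete_nth (Suc k) (y # ys) = y # delete_nth k ys"
  by (simp add: delete_nth_def)

lemma set_delete_nth: "set (delete_nth k xs) \<subseteq> set xs"
  by (auto simp: delete_nth_def dest: in_set_takeD in_set_dropD)

lemma list_minor_Nil [simp]: "list_minor x [] [] = 1"
  by (simp add: list_minor_def)

lemma list_minor_transpose:
  assumes "length I = length J"
  shows "list_minor x I J = list_minor (\<lambda>j i. x i j) J I"
proof -
  let ?A = "mat (length I) (length I) (\<lambda>(s, t). x (I ! s) (J ! t))"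
  have "det (transpose_mat ?A) = det ?A"
    by (rule det_transpose) auto
  moreover have "transpose_mat ?A = mat (length J) (length I) (\<lambda>(s, t). x (I ! t) (J ! s))"
    by (rule eq_matI) (use assms in auto)
  ultimately show ?thesis
    using assms by (simp add: list_minor_def)
qed

lemma list_minor_cong:
  assumes "length I = length J" "\<And>i j. i \<in> set I \<Longrightarrow> j \<in> set J \<Longrightarrow> x i j = y i j"
  shows "list_minor x I J = list_minor y I J"
  unfolding list_minor_def
  by (rule arg_cong[where f = det], rule eq_matI) (use assms in auto)

lemma list_minor_map:
  "list_minor x (map f I) (map g J) = list_minor (\<lambda>i j. x (f i) (g j)) I J"
  unfolding list_minor_def
  by (rule arg_cong[where f = det], rule eq_matI) auto

lemma list_minor_expand_row:
  assumes "length J = Suc (length A + length B)"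
  shows "list_minor x (A @ y # B) J =
    (\<Sum>t<length J. (-1) ^ (length A + t) * x y (J ! t) * list_minor x (A @ B) (delete_nth t J))"
proof -
  let ?N = "length J"
  let ?M = "mat ?N ?N (\<lambda>(s, t). x ((A @ y # B) ! s) (J ! t))"
  have "list_minor x (A @ y # B) J = det ?M"
    using assms by (simp add: list_minor_def)
  also have "\<dots> = (\<Sum>t<?N. ?M $$ (length A, t) * cofactor ?M (length A) t)"
    by (rule laplace_expansion_row) (use assms in auto)
  also have "\<dots> = (\<Sum>t<?N. (-1) ^ (length A + t) * x y (J ! t) * list_minor x (A @ B) (delete_nth t J))"
  proof (rule sum.cong[OF refl])
    fix t assume "t \<in> {..<?N}"
    then have t: "t < ?N" by simp
    have "mat_delete ?M (length A) t =
      mat (length (A @ B)) (length (delete_nth t J))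
        (\<lambda>(s, u). x ((A @ B) ! s) (delete_nth t J ! u))"
      by (rule eq_matI) (use assms t in \<open>auto simp: mat_delete_def nth_delete_nth nth_append\<close>)
    then show "?M $$ (length A, t) * cofactor ?M (length A) t =
      (-1) ^ (length A + t) * x y (J ! t) * list_minor x (A @ B) (delete_nth t J)"
      using t assms by (simp add: cofactor_def list_minor_def nth_append)
  qed
  finally show ?thesis .
qed

lemma list_minor_expand_column:
  assumes "length I = Suc (length A + length B)"
  shows "list_minor x I (A @ y # B) =
    (\<Sum>t<length I. (-1) ^ (length A + t) * x (I ! t) y * list_minor x (delete_nth t I) (A @ B))"
proof -
  have "list_minor x I (A @ y # B) = list_minor (\<lambda>j i. x i j) (A @ y # B) I"
    by (rule list_minor_transpose) (use assms in auto)
  also have "\<dots> = (\<Sum>t<length I. (-1) ^ (length A + t) * x (I ! t) y *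
      list_minor (\<lambda>j i. x i j) (A @ B) (delete_nth t I))"
    by (rule list_minor_expand_row) (use assms in auto)
  also have "\<dots> = (\<Sum>t<length I. (-1) ^ (length A + t) * x (I ! t) y *
      list_minor x (delete_nth t I) (A @ B))"
    by (rule sum.cong[OF refl], subst list_minor_transpose) (use assms in auto)
  finally show ?thesis .
qed

lemma list_minor_repeated_row:
  assumes "length I = length J" "\<not> distinct I"
  shows "list_minor x I J = 0"
proof -
  obtain s t where st: "s < length I" "t < length I" "s \<noteq> t" "I ! s = I ! t"
    using assms(2) by (auto simp: distinct_conv_nth)
  show ?thesis
    unfolding list_minor_def
    by (rule det_identical_rows[of _ "length I" s t])
      (use st assms in \<open>auto intro!: eq_vecI\<close>)
qed

lemma list_minor_repeated_column:
  assumes "length I = length J" "\<not> distinct J"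
  shows "list_minor x I J = 0"
  using list_minor_transpose[OF assms(1)] list_minor_repeated_row[of J I] assms by metis

lemma list_minor_rotate_row:
  assumes "length J = Suc (length P)"
  shows "list_minor x (a # P) J = (-1) ^ length P * list_minor x (P @ [a]) J"
proof -
  have sign: "(-1) ^ length P * ((-1) ^ (length P + t) * z) = (-1) ^ t * z" for t and z :: real
    by (simp add: power_add mult.assoc[symmetric] flip: power_mult_distrib)
  have "list_minor x (a # P) J =
      (\<Sum>t<length J. (-1) ^ t * x a (J ! t) * list_minor x P (delete_nth t J))"
    using list_minor_expand_row[of J "[]" P x a] assms by simp
  moreover have "list_minor x (P @ [a]) J =
      (\<Sum>t<length J. (-1) ^ (length P + t) * x a (J ! t) * list_minor x P (delete_nth t J))"
    using list_minor_expand_row[of J P "[]" x a] assms by simp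
  ultimately show ?thesis
    by (simp only: sum_distrib_left mult.assoc sign)
qed

lemma list_minor_rotate_column:
  assumes "length I = Suc (length Q)"
  shows "list_minor x I (c # Q) = (-1) ^ length Q * list_minor x I (Q @ [c])"
  using list_minor_rotate_row[of I Q "\<lambda>j i. x i j" c] assms
  by (simp add: list_minor_transpose[of I] )

lemma list_minor_rev:
  assumes "length I = length J"
  shows "list_minor x (rev I) (rev J) = list_minor x I J"
proof -
  let ?n = "length I"
  let ?p = "\<lambda>i. if i < ?n then ?n - Suc i else i"
  have p: "?p permutes {0..<?n}"
    by (rule bij_imp_permutes, rule bij_betwI[of _ _ _ ?p]) auto
  have perm: "list_minor z (rev K) L = signof ?p * list_minor z K L"
    if "length K = ?n" "length L = ?n" for K :: "'c list" and L :: "'d list" and z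
  proof -
    let ?A = "mat ?n ?n (\<lambda>(s, t). z (K ! s) (L ! t))"
    have "det (mat ?n ?n (\<lambda>(i, j). ?A $$ (?p i, j))) = signof ?p * det ?A"
      by (rule det_permute_rows[OF _ p]) auto
    moreover have "mat ?n ?n (\<lambda>(i, j). ?A $$ (?p i, j)) = 
        mat ?n ?n (\<lambda>(s, t). z (rev K ! s) (L ! t))"
      by (rule eq_matI) (use that in \<open>auto simp: rev_nth\<close>)
    ultimately show ?thesis
      using that by (simp add: list_minor_def)
  qed
  have "list_minor x (rev I) (rev J) = signof ?p * list_minor x I (rev J)"
    by (rule perm) (use assms in auto)
  also have "list_minor x I (rev J) = list_minor (\<lambda>j i. x i j) (rev J) I"
    by (rule list_minor_transpose) (use assms in auto)
  also have "\<dots> = signof ?p * list_minor (\<lambda>j i. x i j) J I"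
    by (rule perm) (use assms in auto)
  also have "list_minor (\<lambda>j i. x i j) J I = list_minor x I J"
    using list_minor_transpose[OF assms] by simp
  finally show ?thesis
    by (simp add: sign_def)
qed

lemma list_minor_row_linear:
  assumes "length J = Suc (length A + length B)" 
    and "\<And>j. j \<in> set J \<Longrightarrow> x i j = y i j - c * y k j"
    and "\<And>i' j. i' \<in> set A \<union> set B \<Longrightarrow> j \<in> set J \<Longrightarrow> x i' j = y i' j"
  shows "list_minor x (A @ i # B) J =
    list_minor y (A @ i # B) J - c * list_minor y (A @ k # B) J"
proof -
  have "list_minor x (A @ B) (delete_nth t J) = list_minor y (A @ B) (delete_nth t J)" 
    if "t < length J" for t
    by (rule list_minor_cong) (use assms that set_delete_nth[of t J] in auto)
  then show ?thesis
    unfolding list_minor_expand_row[OF assms(1)]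
    by (simp add: assms(2) sum_subtractf[symmetric] sum_distrib_left algebra_simps)
qed

text \<open>
  The common source of the determinantal identities used here: expand the minors of \<open>M\<close> along the
  inserted row, exchange the two sums, and recognise the inner sum as the expansion of a larger
  minor along its first column. Repeated rows or columns make almost all terms vanish in
  applications.
\<close>

lemma list_minor_exchange:
  assumes w: "length w = Suc (length L)" and M: "length M = Suc (length A + length B)"
  shows "(\<Sum>k<length w. (-1) ^ k * list_minor x (delete_nth k w) L * list_minor x (A @ w ! k # B) M)
    = (\<Sum>t<length M. (-1) ^ (length A + t) * list_minor x w (M ! t # L) *
        list_minor x (A @ B) (delete_nth t M))"
proof -
  have "(\<Sum>k<length w. (-1) ^ k * list_minor x (delete_nth k w) L * list_minor x (A @ w ! k # B) M)
    = (\<Sum>k<length w. \<Sum>t<length M. (-1) ^ k * (-1) ^ (length A + t) *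
        list_minor x (delete_nth k w) L * x (w ! k) (M ! t) * list_minor x (A @ B) (delete_nth t M))"
    by (simp add: list_minor_expand_row[OF M] sum_distrib_left mult_ac)
  also have "\<dots> = (\<Sum>t<length M. \<Sum>k<length w. (-1) ^ k * (-1) ^ (length A + t) *
        list_minor x (delete_nth k w) L * x (w ! k) (M ! t) * list_minor x (A @ B) (delete_nth t M))"
    by (rule sum.swap)
  also have "\<dots> = (\<Sum>t<length M. (-1) ^ (length A + t) * list_minor x w (M ! t # L) *
        list_minor x (A @ B) (delete_nth t M))"
  proof (rule sum.cong[OF refl])
    fix t
    have "list_minor x w (M ! t # L) =
        (\<Sum>k<length w. (-1) ^ k * x (w ! k) (M ! t) * list_minor x (delete_nth k w) L)"
      using list_minor_expand_column[of w "[]" L x "M ! t"] w by simp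
    then show "(\<Sum>k<length w. (-1) ^ k * (-1) ^ (length A + t) *
        list_minor x (delete_nth k w) L * x (w ! k) (M ! t) * list_minor x (A @ B) (delete_nth t M))
      = (-1) ^ (length A + t) * list_minor x w (M ! t # L) * list_minor x (A @ B) (delete_nth t M)"
      by (simp add: sum_distrib_left sum_distrib_right mult_ac)
  qed
  finally show ?thesis .
qed

text \<open>
  Since every column of \<open>M\<close> occurs in \<open>L\<close>, each minor on the right of the exchange relation
  repeats a column; on the left only the rows \<open>a\<close>, \<open>b\<close>, \<open>c\<close> survive.
\<close>

lemma three_term_rows:
  assumes L: "length L = Suc (Suc (length A + length B))"
    and M: "length M = Suc (length A + length B)" and sub: "set M \<subseteq> set L"
  shows "list_minor x (A @ a # c # B) L * list_minor x (A @ b # B) M =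
    list_minor x (A @ a # b # B) L * list_minor x (A @ c # B) M +
    list_minor x (A @ b # c # B) L * list_minor x (A @ a # B) M"
proof -
  let ?w = "A @ a # b # c # B"
  let ?p = "length A"
  let ?f = "\<lambda>k. (-1) ^ k * list_minor x (delete_nth k ?w) L * list_minor x (A @ ?w ! k # B) M"
  have "(\<Sum>k<length ?w. ?f k) = (\<Sum>t<length M. (-1) ^ (length A + t) * 
      list_minor x ?w (M ! t # L) * list_minor x (A @ B) (delete_nth t M))"
    by (rule list_minor_exchange) (use L M in auto)
  also have "\<dots> = 0"
  proof (rule sum.neutral, rule ballI)
    fix t assume "t \<in> {..<length M}"
    then have "M ! t \<in> set L"
      using sub by (meson lessThan_iff nth_mem subsetD)
    then have "\<not> distinct (M ! t # L)"
      by simp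
    then have "list_minor x ?w (M ! t # L) = 0"
      by (intro list_minor_repeated_column) (use L in auto)
    then show "(-1) ^ (length A + t) * list_minor x ?w (M ! t # L) * 
        list_minor x (A @ B) (delete_nth t M) = 0" by simp
  qed
  finally have zero: "(\<Sum>k<length ?w. ?f k) = 0" .
  have "(\<Sum>k<length ?w. ?f k) = (\<Sum>k\<in>{?p, Suc ?p, Suc (Suc ?p)}. ?f k)"
  proof (rule sum.mono_neutral_right)
    show "\<forall>k\<in>{..<length ?w} - {?p, Suc ?p, Suc (Suc ?p)}. ?f k = 0"
    proof
      fix k assume k: "k \<in> {..<length ?w} - {?p, Suc ?p, Suc (Suc ?p)}"
      have "?w ! k \<in> set A \<union> set B"
      proof (cases "k < ?p")
        case False
        define m where "m = k - Suc (Suc (Suc ?p))"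
        have "k = Suc (Suc (Suc ?p)) + m" "m < length B"
          using k False by (auto simp: m_def)
        then show ?thesis by (simp add: nth_append)
      qed (auto simp: nth_append)
      then have "list_minor x (A @ ?w ! k # B) M = 0"
        by (intro list_minor_repeated_row) (use M in auto)
      then show "?f k = 0" by simp
    qed
  qed auto
  also have "\<dots> = (-1) ^ ?p * (list_minor x (A @ b # c # B) L * list_minor x (A @ a # B) M
     - list_minor x (A @ a # c # B) L * list_minor x (A @ b # B) M
     + list_minor x (A @ a # b # B) L * list_minor x (A @ c # B) M)"
    by (simp add: delete_nth_append nth_append algebra_simps numeral_2_eq_2)
  finally show ?thesis
    using zero by simp
qed

lemma three_term_columns:
  assumes L: "length L = Suc (Suc (length A + length B))"
    and M: "length M = Suc (length A + length B)" and sub: "set M \<subseteq> set L"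
  shows "list_minor x L (A @ a # c # B) * list_minor x M (A @ b # B) =
    list_minor x L (A @ a # b # B) * list_minor x M (A @ c # B) +
    list_minor x L (A @ b # c # B) * list_minor x M (A @ a # B)"
  using three_term_rows[OF assms, of "\<lambda>j i. x i j" a c b] L M
  by (simp add: list_minor_transpose[of L] list_minor_transpose[of M])

text \<open>
  Dodgson condensation. With \<open>w = a # P @ [b]\<close>, \<open>L = c # Q\<close>, \<open>M = Q @ [d]\<close> and the new row inserted in
  front of \<open>P\<close>, the exchange relation keeps only the rows \<open>a\<close>, \<open>b\<close> on the left and the column \<open>d\<close> on
  the right.
\<close>

lemma desnanot_jacobi:
  assumes PQ: "length P = length Q"
  shows "list_minor x (a # P) (c # Q) * list_minor x (P @ [b]) (Q @ [d])
    - list_minor x (P @ [b]) (c # Q) * list_minor x (a # P) (Q @ [d])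
    = list_minor x P Q * list_minor x (a # P @ [b]) (c # Q @ [d])"
proof -
  let ?w = "a # P @ [b]" and ?L = "c # Q" and ?M = "Q @ [d]"
  let ?f = "\<lambda>k. (-1) ^ k * list_minor x (delete_nth k ?w) ?L * list_minor x ([] @ ?w ! k # P) ?M"
  let ?g = "\<lambda>t. (-1) ^ (length ([] :: 'a list) + t) * list_minor x ?w (?M ! t # ?L) *
      list_minor x ([] @ P) (delete_nth t ?M)"
  have eq: "(\<Sum>k<length ?w. ?f k) = (\<Sum>t<length ?M. ?g t)"
    by (rule list_minor_exchange) (use PQ in auto)
  have "(\<Sum>k<length ?w. ?f k) = (\<Sum>k\<in>{0, Suc (length P)}. ?f k)"
  proof (rule sum.mono_neutral_right)
    show "\<forall>k\<in>{..<length ?w} - {0, Suc (length P)}. ?f k = 0"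
    proof
      fix k assume k: "k \<in> {..<length ?w} - {0, Suc (length P)}"
      then obtain m where m: "k = Suc m" "m < length P"
        by (cases k) auto
      then have "list_minor x (?w ! k # P) ?M = 0"
        by (intro list_minor_repeated_row) (use PQ in \<open>auto simp: nth_append\<close>)
      then show "?f k = 0" by simp
    qed
  qed auto
  also have "\<dots> = list_minor x (P @ [b]) ?L * list_minor x (a # P) ?M
      - (-1) ^ length P * list_minor x (a # P) ?L * list_minor x (b # P) ?M"
    by (simp add: delete_nth_append nth_append)
  also have "list_minor x (b # P) ?M = (-1) ^ length P * list_minor x (P @ [b]) ?M"
    by (rule list_minor_rotate_row) (use PQ in auto)
  also have "(-1) ^ length P * list_minor x (a # P) ?L * ((-1) ^ length P * list_minor x (P @ [b]) ?M)
      = list_minor x (a # P) ?L * list_minor x (P @ [b]) ?M"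
    by (cases "even (length P)") simp_all
  finally have lhs: "(\<Sum>k<length ?w. ?f k) = list_minor x (P @ [b]) ?L * list_minor x (a # P) ?M
      - list_minor x (a # P) ?L * list_minor x (P @ [b]) ?M" .
  have "(\<Sum>t<length ?M. ?g t) = (\<Sum>t\<in>{length Q}. ?g t)"
  proof (rule sum.mono_neutral_right)
    show "\<forall>t\<in>{..<length ?M} - {length Q}. ?g t = 0"
    proof
      fix t assume "t \<in> {..<length ?M} - {length Q}"
      then have "t < length Q" by auto
      then have "list_minor x ?w (?M ! t # ?L) = 0"
        by (intro list_minor_repeated_column) (use PQ in \<open>auto simp: nth_append\<close>)
      then show "?g t = 0" by simp
    qed
  qed auto
  also have "\<dots> = (-1) ^ length Q * list_minor x ?w (d # ?L) * list_minor x P Q"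
    by (simp add: delete_nth_append nth_append)
  also have "list_minor x ?w (d # ?L) = (-1) ^ Suc (length Q) * list_minor x ?w (?L @ [d])"
    using list_minor_rotate_column[of ?w ?L x d] PQ by simp
  also have "(-1) ^ length Q * ((-1) ^ Suc (length Q) * list_minor x ?w (?L @ [d])) * list_minor x P Q
     = - (list_minor x P Q * list_minor x ?w (c # Q @ [d]))"
    by (cases "even (length Q)") simp_all
  finally show ?thesis
    using eq lhs by simp
qed

text \<open>
  The submatrix is a product of two square matrices, the left one having a zero column because
  fewer than \<open>length I\<close> terms occur.
\<close>

lemma list_minor_low_rank:
  assumes S: "finite S" "card S < length I" and IJ: "length I = length J"
    and x: "\<And>i j. i \<in> set I \<Longrightarrow> j \<in> set J \<Longrightarrow> x i j = (\<Sum>s\<in>S. u s i * w s j)"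
  shows "list_minor x I J = 0"
proof -
  let ?N = "length I"
  obtain e where e: "bij_betw e {0..<card S} S"
    using ex_bij_betw_nat_finite[OF S(1)] by blast
  define U where "U = mat ?N ?N (\<lambda>(s, t). if t < card S then u (e t) (I ! s) else 0)"
  define W where "W = mat ?N ?N (\<lambda>(s, t). w (e s) (J ! t))"
  have carr: "U \<in> carrier_mat ?N ?N" "W \<in> carrier_mat ?N ?N"
    by (auto simp: U_def W_def)
  have "mat ?N ?N (\<lambda>(s, t). x (I ! s) (J ! t)) = U * W"
  proof (rule eq_matI)
    fix s t assume "s < dim_row (U * W)" "t < dim_col (U * W)"
    then have st: "s < ?N" "t < ?N" by (auto simp: U_def W_def)
    have "(U * W) $$ (s, t) = (\<Sum>k<?N. U $$ (s, k) * W $$ (k, t))"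
      using st carr by (auto simp: scalar_prod_def atLeast0LessThan)
    also have "\<dots> = (\<Sum>k<?N. if k < card S then u (e k) (I ! s) * w (e k) (J ! t) else 0)"
      using st by (intro sum.cong) (auto simp: U_def W_def)
    also have "\<dots> = (\<Sum>k\<in>{0..<card S}. u (e k) (I ! s) * w (e k) (J ! t))"
      using S by (intro sum.mono_neutral_cong_right) auto
    also have "\<dots> = (\<Sum>k\<in>S. u k (I ! s) * w k (J ! t))"
      by (rule sum.reindex_bij_betw[OF e])
    also have "\<dots> = x (I ! s) (J ! t)"
      using x st IJ by simp
    finally show "mat ?N ?N (\<lambda>(s, t). x (I ! s) (J ! t)) $$ (s, t) = (U * W) $$ (s, t)"
      using st by simp
  qed (auto simp: U_def W_def)
  then have "list_minor x I J = det U * det W"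
    using det_mult[OF carr] IJ by (simp add: list_minor_def)
  moreover have "det U = 0"
  proof -
    have "det U = (\<Sum>i<?N. U $$ (i, card S) * cofactor U i (card S))"
      by (rule laplace_expansion_column[OF carr(1) S(2)])
    also have "\<dots> = 0"
      using S(2) by (intro sum.neutral) (auto simp: U_def)
    finally show ?thesis .
  qed
  ultimately show ?thesis by simp
qed

section \<open>Total nonnegativity and Whitney elimination\<close>

definition totally_nonneg :: "infmat \<Rightarrow> bool" where
  "totally_nonneg x \<longleftrightarrow> (\<forall>I J. length I = length J \<longrightarrow> sorted_wrt (<) I \<longrightarrow> sorted_wrt (<) J \<longrightarrow>
    0 \<le> list_minor x I J)"

lemma totally_nonnegD:
  "totally_nonneg x \<Longrightarrow> length I = length J \<Longrightarrow> sorted_wrt (<) I \<Longrightarrow> sorted_wrt (<) J \<Longrightarrow>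
    0 \<le> list_minor x I J"
  by (simp add: totally_nonneg_def)

lemma list_minor_1: "list_minor x [i] [j] = x i j"
  using list_minor_expand_row[of "[j]" "[]" "[]" x i] by simp

lemma list_minor_2: "list_minor x [i, i'] [j, j'] = x i j * x i' j' - x i j' * x i' j"
  using list_minor_expand_row[of "[j, j']" "[]" "[i']" x i] by (simp add: list_minor_1)

lemma totally_nonneg_entry: "totally_nonneg x \<Longrightarrow> 0 \<le> x i j"
  using totally_nonnegD[of x "[i]" "[j]"] by (simp add: list_minor_1)

lemma totally_nonneg_minor2:
  "totally_nonneg x \<Longrightarrow> i < i' \<Longrightarrow> j < j' \<Longrightarrow> x i j' * x i' j \<le> x i j * x i' j'"
  using totally_nonnegD[of x "[i, i']" "[j, j']"] by (simp add: list_minor_2)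

lemma sorted_wrt_less_rev_uminus:
  "sorted_wrt (<) (I :: int list) \<Longrightarrow> sorted_wrt (<) (map uminus (rev I))"
  by (induction I) (auto simp: sorted_wrt_append)

text \<open>
  Reversing the order of rows and of columns exchanges the two edges of a band. It turns every
  statement about upper Chevalley generators into one about lower ones.
\<close>

lemma totally_nonneg_reverse:
  assumes "totally_nonneg x"
  shows "totally_nonneg (\<lambda>i j. x (- i) (- j))"
  unfolding totally_nonneg_def
proof (intro allI impI)
  fix I J :: "int list"
  assume IJ: "length I = length J" "sorted_wrt (<) I" "sorted_wrt (<) J"
  have "list_minor (\<lambda>i j. x (- i) (- j)) I J = list_minor x (map uminus I) (map uminus J)"
    by (simp add: list_minor_map)
  also have "\<dots> = list_minor x (map uminus (rev I)) (map uminus (rev J))"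
    using list_minor_rev[of "map uminus I" "map uminus J" x] IJ by (simp add: rev_map)
  also have "\<dots> \<ge> 0"
    by (rule totally_nonnegD[OF assms]) (use IJ sorted_wrt_less_rev_uminus in auto)
  finally show "0 \<le> list_minor (\<lambda>i j. x (- i) (- j)) I J" .
qed

lemma totally_nonneg_restrict:
  assumes "totally_nonneg x"
  shows "totally_nonneg (\<lambda>i j. if i \<in> R \<and> j \<in> C then x i j else 0)"
  unfolding totally_nonneg_def
proof (intro allI impI)
  fix I J :: "int list"
  assume IJ: "length I = length J" "sorted_wrt (<) I" "sorted_wrt (<) J"
  let ?y = "\<lambda>i j. if i \<in> R \<and> j \<in> C then x i j else 0"
  show "0 \<le> list_minor ?y I J"
  proof (cases "set I \<subseteq> R \<and> set J \<subseteq> C")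
    case True
    then have "list_minor ?y I J = list_minor x I J"
      by (intro list_minor_cong) (use IJ in auto)
    then show ?thesis using totally_nonnegD[OF assms IJ] by simp
  next
    case False
    then consider i where "i \<in> set I" "i \<notin> R" | j where "j \<in> set J" "j \<notin> C"
      by blast
    then have "list_minor ?y I J = 0"
    proof cases
      case 1
      then obtain A B where "I = A @ i # B" by (meson split_list)
      then show ?thesis
        using list_minor_expand_row[of J A B ?y i] IJ 1 by simp
    next
      case 2
      then obtain A B where "J = A @ j # B" by (meson split_list)
      then show ?thesis
        using list_minor_expand_column[of I A B ?y j] IJ 2 by simp
    qed
    then show ?thesis by simp
  qed
qed

lemma tendsto_list_minor:
  assumes "\<And>i j. ((\<lambda>k. y k i j) \<longlongrightarrow> x i j) F" "length I = length J"
  shows "((\<lambda>k. list_minor (y k) I J) \<longlongrightarrow> list_minor x I J) F"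
proof -
  have "list_minor z I J = (\<Sum>p | p permutes {0..<length I}.
      signof p * (\<Prod>s = 0..<length I. z (I ! s) (J ! p s)))" for z
  proof -
    have "(\<Prod>s = 0..<length I. mat (length I) (length J) (\<lambda>(s, t). z (I ! s) (J ! t)) $$ (s, p s))
      = (\<Prod>s = 0..<length I. z (I ! s) (J ! p s))" if "p permutes {0..<length I}" for p
      by (rule prod.cong) (use that assms(2) permutes_in_image[OF that] in \<open>auto\<close>)
    then show ?thesis
      unfolding list_minor_def using assms(2) by (subst det_def') auto
  qed
  then show ?thesis
    by (simp only:) (intro tendsto_intros assms(1))
qed

text \<open>
  Each minor has to be nonnegative only eventually, from an index on that may depend on the minor: the
  approximating matrices of the applications are controlled only in finite windows.
\<close>

lemma totally_nonneg_limit: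
  assumes "\<And>i j. ((\<lambda>k. y k i j) \<longlongrightarrow> x i j) F" "F \<noteq> bot"
    and "\<And>I J. length I = length J \<Longrightarrow> sorted_wrt (<) I \<Longrightarrow> sorted_wrt (<) J \<Longrightarrow>
      eventually (\<lambda>k. 0 \<le> list_minor (y k) I J) F"
  shows "totally_nonneg x"
  unfolding totally_nonneg_def
proof (intro allI impI)
  fix I J :: "int list"
  assume IJ: "length I = length J" "sorted_wrt (<) I" "sorted_wrt (<) J"
  show "0 \<le> list_minor x I J"
    by (rule tendsto_lowerbound[OF tendsto_list_minor[OF assms(1) IJ(1)] assms(3)[OF IJ] assms(2)])
qed

lemma list_minor_last_column_1:
  assumes "length J = length A" "\<And>k. k \<in> set A \<Longrightarrow> x k m = 0"
  shows "list_minor x (A @ [a]) (J @ [m]) = x a m * list_minor x A J"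
proof -
  have "list_minor x (A @ [a]) (J @ [m]) = (\<Sum>t<Suc (length A). (-1) ^ (length J + t) *
      x ((A @ [a]) ! t) m * list_minor x (delete_nth t (A @ [a])) J)"
    using list_minor_expand_column[of "A @ [a]" J "[]" x m] assms(1) by simp
  also have "\<dots> = x a m * list_minor x A J"
    using assms by (simp add: nth_append delete_nth_append)
  finally show ?thesis .
qed

lemma list_minor_last_column_2:
  assumes "length J = Suc (length A)" "\<And>k. k \<in> set A \<Longrightarrow> x k m = 0"
  shows "list_minor x (A @ [a, b]) (J @ [m]) =
    x b m * list_minor x (A @ [a]) J - x a m * list_minor x (A @ [b]) J"
proof -
  have "list_minor x (A @ [a, b]) (J @ [m]) = (\<Sum>t<Suc (Suc (length A)). (-1) ^ (length J + t) *
      x ((A @ [a, b]) ! t) m * list_minor x (delete_nth t (A @ [a, b])) J)"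
    using list_minor_expand_column[of "A @ [a, b]" J "[]" x m] assms(1) by simp
  also have "\<dots> = x b m * list_minor x (A @ [a]) J - x a m * list_minor x (A @ [b]) J"
    using assms by (simp add: nth_append delete_nth_append)
  finally show ?thesis .
qed

lemma sorted_wrt_delete_nth: "sorted_wrt P xs \<Longrightarrow> sorted_wrt P (delete_nth k xs)"
proof (induction xs arbitrary: k)
  case (Cons a xs)
  then show ?case
    using set_delete_nth[of _ xs] by (cases k) auto
qed (simp add: delete_nth_def)

text \<open>
  Induction on the rows \<open>B\<close> below the pair \<open>i\<close>, \<open>i + 1\<close>. For empty \<open>B\<close> and columns \<open>< m\<close>, bordering the
  minor with row \<open>i + 1\<close> and column \<open>m\<close> gives the claim, since at most two entries of that column are
  nonzero; if a column \<open>\<ge> m\<close> occurs, both sides agree by expansion along the last column. A further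
  row \<open>b\<close> is removed by the three-term relation, whose other terms are nonnegative; this requires
  a nonzero minor to divide by, and if there is none then the subtracted minor is zero.
\<close>

lemma whitney_inequality:
  assumes tnn: "totally_nonneg x"
    and right: "\<And>k j. k \<le> i + 1 \<Longrightarrow> m < j \<Longrightarrow> x k j = 0"
    and above: "\<And>k. k < i \<Longrightarrow> x k m = 0"
    and pivot: "0 < x (i + 1) m"
  shows "sorted_wrt (<) (A @ [i, i + 1] @ B) \<Longrightarrow> sorted_wrt (<) J \<Longrightarrow>
    length J = Suc (length A + length B) \<Longrightarrow>
    x i m / x (i + 1) m * list_minor x (A @ (i + 1) # B) J \<le> list_minor x (A @ i # B) J"
proof (induction B arbitrary: J)
  case Nil
  have A: "sorted_wrt (<) A" "\<And>k. k \<in> set A \<Longrightarrow> k < i"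
    using Nil by (auto simp: sorted_wrt_append)
  show ?case
  proof (cases "\<forall>j\<in>set J. j < m")
    case True
    have "0 \<le> list_minor x (A @ [i, i + 1]) (J @ [m])"
      by (rule totally_nonnegD[OF tnn]) (use Nil True in \<open>auto simp: sorted_wrt_append\<close>)
    also have "\<dots> = x (i + 1) m * list_minor x (A @ [i]) J - x i m * list_minor x (A @ [i + 1]) J"
      by (rule list_minor_last_column_2) (use Nil A above in auto)
    finally show ?thesis
      using pivot by (simp add: field_simps)
  next
    case False
    obtain J' l where J: "J = J' @ [l]"
      using Nil by (cases J rule: rev_cases) auto
    have l: "m \<le> l"
      using False Nil(2) unfolding J by (fastforce simp: sorted_wrt_append)
    have "list_minor x (A @ [k]) J = x k l * list_minor x A J'" for k
      unfolding J by (rule list_minor_last_column_1)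
        (use Nil J A above right l in \<open>force simp: order.order_iff_strict\<close>)+
    then show ?thesis
      using l pivot right by (cases "l = m") auto
  qed
next
  case (Cons b B)
  let ?c = "x i m / x (i + 1) m"
  have len: "length J = Suc (Suc (length A + length B))"
    using Cons.prems by simp
  have c: "0 \<le> ?c"
    using totally_nonneg_entry[OF tnn] pivot by simp
  have nonneg: "0 \<le> list_minor x I K" if "I \<in> {A @ i # B, A @ (i + 1) # B, A @ b # B}"
    "sorted_wrt (<) K" "length K = Suc (length A + length B)" for I K
    by (rule totally_nonnegD[OF tnn]) (use that Cons.prems in \<open>auto simp: sorted_wrt_append\<close>)
  have nonneg2: "0 \<le> list_minor x I J"
    if "I \<in> {A @ i # b # B, A @ (i + 1) # b # B, A @ i # (i + 1) # B}" for I
    by (rule totally_nonnegD[OF tnn]) (use that Cons.prems in \<open>auto simp: sorted_wrt_append\<close>)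
  show ?case
  proof (cases "\<exists>t<length J. list_minor x (A @ (i + 1) # B) (delete_nth t J) \<noteq> 0")
    case True
    then obtain t where t: "t < length J" 
      and nz: "list_minor x (A @ (i + 1) # B) (delete_nth t J) \<noteq> 0" by blast
    define K where "K = delete_nth t J"
    have K: "sorted_wrt (<) K" "length K = Suc (length A + length B)" "set K \<subseteq> set J"
      unfolding K_def using t len Cons.prems set_delete_nth[of t J] sorted_wrt_delete_nth by auto
    have pos: "0 < list_minor x (A @ (i + 1) # B) K"
      using nonneg[of _ K] K nz by (force simp: K_def order.order_iff_strict)
    have "?c * list_minor x (A @ (i + 1) # b # B) J * list_minor x (A @ (i + 1) # B) K \<le>
      list_minor x (A @ (i + 1) # b # B) J * list_minor x (A @ i # B) K"
    proof -
      have "?c * list_minor x (A @ (i + 1) # B) K \<le> list_minor x (A @ i # B) K"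
        by (rule Cons.IH) (use Cons.prems K in \<open>auto simp: sorted_wrt_append\<close>)
      then show ?thesis
        using nonneg2[of "A @ (i + 1) # b # B"]
          mult_left_mono[of "?c * list_minor x (A @ (i + 1) # B) K" _ "list_minor x (A @ (i + 1) # b # B) J"]
        by (simp add: mult_ac)
    qed
    also have "\<dots> \<le> list_minor x (A @ i # (i + 1) # B) J * list_minor x (A @ b # B) K +
        list_minor x (A @ (i + 1) # b # B) J * list_minor x (A @ i # B) K"
      using nonneg2[of "A @ i # (i + 1) # B"] nonneg[of "A @ b # B" K] K by simp
    also have "\<dots> = list_minor x (A @ i # b # B) J * list_minor x (A @ (i + 1) # B) K"
      by (rule three_term_rows[symmetric]) (use len K in auto)
    finally show ?thesis
      using pos by (meson mult_right_le_imp_le)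
  next
    case False
    have "list_minor x (A @ (i + 1) # b # B) J = 0"
      using list_minor_expand_row[of J "A @ [i + 1]" B x b] len False by simp
    then show ?thesis
      using nonneg2[of "A @ i # b # B"] by simp
  qed
qed

definition subtract_row :: "int \<Rightarrow> real \<Rightarrow> infmat \<Rightarrow> infmat" where
  "subtract_row i c x = (\<lambda>k j. if k = i then x i j - c * x (i + 1) j else x k j)"

lemma list_minor_subtract_row:
  assumes "length I = length J" "distinct I" "i \<in> set I \<Longrightarrow> i + 1 \<in> set I"
  shows "list_minor (subtract_row i c x) I J = list_minor x I J"
proof (cases "i \<in> set I")
  case False
  then show ?thesis
    by (intro list_minor_cong) (use assms in \<open>auto simp: subtract_row_def\<close>)
next
  case True
  then obtain A B where I: "I = A @ i # B"
    by (meson split_list)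
  have "list_minor (subtract_row i c x) I J = list_minor x I J - c * list_minor x (A @ (i + 1) # B) J"
    unfolding I by (rule list_minor_row_linear) (use assms I in \<open>auto simp: subtract_row_def\<close>)
  moreover have "list_minor x (A @ (i + 1) # B) J = 0"
    by (rule list_minor_repeated_row) (use assms True I in auto)
  ultimately show ?thesis by simp
qed

text \<open>
  Clearing the topmost nonzero entry of a last column by the row below it preserves total
  nonnegativity: the new minors are the differences bounded by the previous inequality.
\<close>

lemma whitney_reduction:
  assumes tnn: "totally_nonneg x"
    and right: "\<And>k j. k \<le> i + 1 \<Longrightarrow> m < j \<Longrightarrow> x k j = 0"
    and above: "\<And>k. k < i \<Longrightarrow> x k m = 0"
    and pivot: "0 < x (i + 1) m"
  shows "totally_nonneg (subtract_row i (x i m / x (i + 1) m) x)"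
  unfolding totally_nonneg_def
proof (intro allI impI)
  fix I J :: "int list"
  assume IJ: "length I = length J" "sorted_wrt (<) I" "sorted_wrt (<) J"
  let ?c = "x i m / x (i + 1) m"
  show "0 \<le> list_minor (subtract_row i ?c x) I J"
  proof (cases "i \<in> set I \<longrightarrow> i + 1 \<in> set I")
    case True
    then show ?thesis
      using list_minor_subtract_row[of I J i ?c x] totally_nonnegD[OF tnn IJ] IJ
        strict_sorted_iff[of I] by simp
  next
    case False
    then obtain A B where I: "I = A @ i # B"
      by (meson split_list)
    have "i + 1 < b" if "b \<in> set B" for b
    proof -
      have "i < b" "b \<noteq> i + 1"
        using that IJ(2) False by (auto simp: I sorted_wrt_append)
      then show ?thesis by simp
    qed
    then have "?c * list_minor x (A @ (i + 1) # B) J \<le> list_minor x (A @ i # B) J"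
      by (intro whitney_inequality[OF tnn right above pivot])
        (use IJ I in \<open>fastforce simp: sorted_wrt_append\<close>)+
    moreover have "list_minor (subtract_row i ?c x) I J =
        list_minor x I J - ?c * list_minor x (A @ (i + 1) # B) J"
      unfolding I by (rule list_minor_row_linear)
        (use IJ strict_sorted_iff[of I] I in \<open>auto simp: subtract_row_def\<close>)
    ultimately show ?thesis
      by (simp add: I)
  qed
qed

section \<open>Unfoldings of matrices over Laurent series\<close>

lemma unfolding_periodic:
  assumes "n \<ge> 1"
  shows "unfolding_mat n A (i + int n) (j + int n) = unfolding_mat n A i j"
proof -
  have "i + int n - 1 = (i - 1) + int n" for i :: int by simp
  then have "(i + int n - 1) mod int n = (i - 1) mod int n"
    "(i + int n - 1) div int n = (i - 1) div int n + 1" for i :: int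
    using assms by (simp_all only: div_add_self2 mod_add_self2 of_nat_eq_0_iff)
  then show ?thesis by (simp add: unfolding_mat_def)
qed

lemma fls_uniform_lower_bound:
  fixes A :: "real fls mat"
  obtains N :: int where "N \<ge> 0" "\<And>a b k. a < n \<Longrightarrow> b < n \<Longrightarrow> k < - N \<Longrightarrow> fls_nth (A $$ (a, b)) k = 0"
proof
  let ?N = "\<Sum>p\<in>{..<n}\<times>{..<n}. \<bar>fls_subdegree (A $$ p)\<bar>"
  show "?N \<ge> 0" by (simp add: sum_nonneg)
  fix a b k assume "a < n" "b < n" "k < - ?N"
  moreover from this have "\<bar>fls_subdegree (A $$ (a, b))\<bar> \<le> ?N"
    by (intro member_le_sum) auto
  ultimately show "fls_nth (A $$ (a, b)) k = 0"
    by (intro fls_eq0_below_subdegree) linarith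
qed

lemma unfolding_lower_bound:
  assumes n: "n \<ge> 1"
  obtains B :: int where "B \<ge> 0" "\<And>i j. j < i - B \<Longrightarrow> unfolding_mat n A i j = 0"
proof -
  obtain N where N: "N \<ge> 0"
    "\<And>a b k. a < n \<Longrightarrow> b < n \<Longrightarrow> k < - N \<Longrightarrow> fls_nth (A $$ (a, b)) k = 0"
    using fls_uniform_lower_bound[of n A] by blast
  show ?thesis
  proof (rule that[of "(N + 2) * int n"])
    fix i j :: int assume ij: "j < i - (N + 2) * int n"
    have "(j - 1) div int n \<le> (i - 1 + (- (N + 2)) * int n) div int n"
      by (rule zdiv_mono1) (use ij n in \<open>auto simp: algebra_simps\<close>)
    also have "\<dots> = (i - 1) div int n - (N + 2)"
      using n by (subst div_mult_self1) auto
    finally have "(j - 1) div int n - (i - 1) div int n < - N" by simp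
    moreover have "nat ((i - 1) mod int n) < n" "nat ((j - 1) mod int n) < n"
      using n by (simp_all add: nat_less_iff)
    ultimately show "unfolding_mat n A i j = 0"
      unfolding unfolding_mat_def by (intro N(2)) auto
  qed (use N in simp)
qed

lemma fls_times_nth_bounded:
  fixes f g :: "real fls"
  assumes "\<And>k. k < - N \<Longrightarrow> fls_nth f k = 0" "\<And>k. k < - N \<Longrightarrow> fls_nth g k = 0"
  shows "fls_nth (f * g) d = (\<Sum>m\<in>{-N..d+N}. fls_nth f m * fls_nth g (d - m))"
proof -
  have "fls_nth (f * g) d =
      (\<Sum>m\<in>{fls_subdegree f..d - fls_subdegree g}. fls_nth f m * fls_nth g (d - m))"
    by (rule fls_times_nth(2))
  also have "\<dots> = (\<Sum>m\<in>{-N..d+N}. fls_nth f m * fls_nth g (d - m))"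
  proof (rule sum.mono_neutral_cong)
    fix m assume "m \<in> {-N..d+N} - {fls_subdegree f..d - fls_subdegree g}"
    then have "m < fls_subdegree f \<or> d - m < fls_subdegree g" by auto
    then show "fls_nth f m * fls_nth g (d - m) = 0" by auto
  next
    fix m assume "m \<in> {fls_subdegree f..d - fls_subdegree g} - {-N..d+N}"
    then have "m < - N \<or> d - m < - N" by auto
    then show "fls_nth f m * fls_nth g (d - m) = 0" using assms by auto
  qed auto
  finally show ?thesis .
qed

text \<open>
  Compatibility of unfolding with multiplication. The index set \<open>K\<close> is left free because the
  finitely many relevant indices are described differently in each application.
\<close>

lemma unfolding_mult:
  assumes n: "n \<ge> 1" and A: "A \<in> carrier_mat n n" and B: "B \<in> carrier_mat n n"
    and K: "finite K" "\<And>k. unfolding_mat n A i k \<noteq> 0 \<Longrightarrow> unfolding_mat n B k j \<noteq> 0 \<Longrightarrow> k \<in> K"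
  shows "unfolding_mat n (A * B) i j = (\<Sum>k\<in>K. unfolding_mat n A i k * unfolding_mat n B k j)"
proof -
  obtain N1 where N1: "N1 \<ge> 0"
    "\<And>a b k. a < n \<Longrightarrow> b < n \<Longrightarrow> k < - N1 \<Longrightarrow> fls_nth (A $$ (a, b)) k = 0"
    using fls_uniform_lower_bound[of n A] by blast
  obtain N2 where N2: "N2 \<ge> 0"
    "\<And>a b k. a < n \<Longrightarrow> b < n \<Longrightarrow> k < - N2 \<Longrightarrow> fls_nth (B $$ (a, b)) k = 0"
    using fls_uniform_lower_bound[of n B] by blast
  define N where "N = max N1 N2"
  have NA: "\<And>a b k. a < n \<Longrightarrow> b < n \<Longrightarrow> k < - N \<Longrightarrow> fls_nth (A $$ (a, b)) k = 0"
    and NB: "\<And>a b k. a < n \<Longrightarrow> b < n \<Longrightarrow> k < - N \<Longrightarrow> fls_nth (B $$ (a, b)) k = 0"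
    using N1(2) N2(2) by (auto simp: N_def)
  define a b where "a = nat ((i - 1) mod int n)" and "b = nat ((j - 1) mod int n)"
  define p d where "p = (i - 1) div int n" and "d = (j - 1) div int n - p"
  have ab: "a < n" "b < n"
    using n by (simp_all add: a_def b_def nat_less_iff)
  let ?g = "\<lambda>k. unfolding_mat n A i k * unfolding_mat n B k j"
  \<comment> \<open>the index of the unfolding that belongs to residue \<open>c\<close> and exponent \<open>m\<close> of the left factor\<close>
  define h where "h = (\<lambda>(c::nat, m::int). int c + 1 + (m + p) * int n)"
  let ?D = "{..<n} \<times> {-N..d+N}"
  have hmod: "(h (c, m) - 1) mod int n = int c" and hdiv: "(h (c, m) - 1) div int n = m + p"
    if "c < n" for c m
    using that n by (simp_all add: h_def)
  have inj: "inj_on h ?D"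
  proof (rule inj_onI)
    fix x y assume xy: "x \<in> ?D" "y \<in> ?D" "h x = h y"
    obtain c m c' m' where eqs: "x = (c, m)" "y = (c', m')" by (cases x, cases y) auto
    have "int c = int c'" using hmod[of c m] hmod[of c' m'] xy eqs by simp
    moreover have "m + p = m' + p" using xy eqs hdiv[of c m] hdiv[of c' m'] by simp
    ultimately show "x = y" using eqs by simp
  qed
  have "unfolding_mat n (A * B) i j = fls_nth (\<Sum>c<n. A $$ (a, c) * B $$ (c, b)) d"
    using ab A B unfolding unfolding_mat_def a_def b_def d_def p_def
    by (simp add: scalar_prod_def atLeast0LessThan)
  also have "\<dots> = (\<Sum>c<n. \<Sum>m\<in>{-N..d+N}. fls_nth (A $$ (a, c)) m * fls_nth (B $$ (c, b)) (d - m))"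
    by (simp add: fls_nth_sum fls_times_nth_bounded[where N = N] NA NB ab)
  also have "\<dots> = (\<Sum>x\<in>?D. ?g (h x))"
    unfolding sum.cartesian_product
  proof (rule sum.cong[OF refl])
    fix y assume "y \<in> ?D"
    then obtain c m where y: "y = (c, m)" "c < n" by auto
    then show "(case y of (c, m) \<Rightarrow> fls_nth (A $$ (a, c)) m * fls_nth (B $$ (c, b)) (d - m)) = ?g (h y)"
      by (simp add: unfolding_mat_def hmod hdiv a_def b_def d_def p_def diff_diff_eq add.commute)
  qed
  also have "\<dots> = sum ?g (h ` ?D)"
    by (simp add: sum.reindex[OF inj])
  also have "\<dots> = sum ?g K"
  proof (rule sum.mono_neutral_cong)
    fix k assume "k \<in> h ` ?D - K"
    then show "?g k = 0" using K(2)[of k] by auto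
  next
    fix k assume k: "k \<in> K - h ` ?D"
    define c m where "c = nat ((k - 1) mod int n)" and "m = (k - 1) div int n - p"
    have c: "c < n" using n by (simp add: c_def nat_less_iff)
    have "k = h (c, m)"
      using n div_mult_mod_eq[of "k - 1" "int n"] by (simp add: h_def c_def m_def)
    then have "m \<notin> {-N..d+N}" using k c by auto
    then have "m < - N \<or> d - m < - N" by auto
    then have "fls_nth (A $$ (a, c)) m = 0 \<or> fls_nth (B $$ (c, b)) (d - m) = 0"
      using NA NB ab c by blast
    then show "?g k = 0"
      by (auto simp: unfolding_mat_def a_def b_def c_def m_def d_def p_def)
  qed (use K in auto)
  finally show ?thesis .
qed

lemma unfolding_inject:
  assumes "A \<in> carrier_mat n n" "B \<in> carrier_mat n n" "unfolding_mat n A = unfolding_mat n B"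
  shows "A = B"
  by (metis assms folding_unfolding)

lemma folding_carrier [simp]: "folding_mat n x \<in> carrier_mat n n"
  by (simp add: folding_mat_def)

lemma unfolding_mult_two_terms:
  assumes "n \<ge> 1" "G \<in> carrier_mat n n" "X \<in> carrier_mat n n" "i \<noteq> i'"
    and "\<And>k. k \<noteq> i \<Longrightarrow> k \<noteq> i' \<Longrightarrow> unfolding_mat n G i k = 0"
  shows "unfolding_mat n (G * X) i j =
    unfolding_mat n G i i * unfolding_mat n X i j + unfolding_mat n G i i' * unfolding_mat n X i' j"
proof -
  have "unfolding_mat n (G * X) i j = (\<Sum>k\<in>{i, i'}. unfolding_mat n G i k * unfolding_mat n X k j)"
    by (rule unfolding_mult[OF assms(1-3)]) (use assms(5) in blast)+
  then show ?thesis using assms(4) by simp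
qed

lemma int_index_eq_iff:
  assumes "n \<ge> 1"
  shows "(i :: int) = j \<longleftrightarrow> (i - 1) mod int n = (j - 1) mod int n \<and> (j - 1) div int n - (i - 1) div int n = 0"
proof
  assume "(i - 1) mod int n = (j - 1) mod int n \<and> (j - 1) div int n - (i - 1) div int n = 0"
  then have "(i - 1) div int n * int n + (i - 1) mod int n = (j - 1) div int n * int n + (j - 1) mod int n"
    by simp
  then show "i = j"
    by (simp only: div_mult_mod_eq)
qed simp

lemma unfolding_mat_diag:
  assumes "n \<ge> 1"
  shows "unfolding_mat n (mat_diag n (\<lambda>i. fls_const (d i))) i j =
    (if i = j then d (nat ((i - 1) mod int n)) else 0)"
proof -
  have "nat ((i - 1) mod int n) < n" "nat ((j - 1) mod int n) < n"
    using assms by (simp_all add: nat_less_iff)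
  moreover have "nat ((i - 1) mod int n) = nat ((j - 1) mod int n) \<longleftrightarrow>
     (i - 1) mod int n = (j - 1) mod int n"
    using assms by (subst eq_nat_nat_iff) auto
  ultimately show ?thesis
    using int_index_eq_iff[OF assms, of i j]
    by (simp add: unfolding_mat_def mat_diag_def)
qed

lemma unfolding_one:
  assumes "n \<ge> 1"
  shows "unfolding_mat n (1\<^sub>m n) i j = (if i = j then 1 else 0)"
proof -
  have "1\<^sub>m n = mat_diag n (\<lambda>i. fls_const (1 :: real))"
    by (rule eq_matI) (auto simp: mat_diag_def)
  then show ?thesis
    using unfolding_mat_diag[OF assms, of "\<lambda>_. 1"] by simp
qed

lemma GL_loop_inverse:
  assumes "X \<in> GL_loop n"
  obtains Y where "Y \<in> carrier_mat n n" "X * Y = 1\<^sub>m n" "Y * X = 1\<^sub>m n"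
proof -
  have X: "X \<in> carrier_mat n n" "det X \<noteq> 0"
    using assms by (auto simp: GL_loop_def)
  have "X \<in> Units (ring_mat TYPE(real fls) n ())"
    by (rule det_non_zero_imp_unit[OF X])
  then show ?thesis
    using that by (auto simp: Units_def ring_mat_def)
qed

lemma GL_loop_right_factor:
  assumes "G * X \<in> GL_loop n" "G \<in> carrier_mat n n" "X \<in> carrier_mat n n"
  shows "X \<in> GL_loop n"
  using assms det_mult[of G n X] by (auto simp: GL_loop_def)

lemma minor_eq_list_minor:
  "minor I J x = list_minor x (sorted_list_of_set I) (sorted_list_of_set J)"
  by (simp add: minor_def list_minor_def)

lemma list_minor_eq_minor:
  assumes "sorted_wrt (<) I" "sorted_wrt (<) J"
  shows "list_minor x I J = minor (set I) (set J) x"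
  unfolding minor_eq_list_minor
  using assms sorted_list_of_set.idem_if_sorted_distinct strict_sorted_iff by metis

lemma GL_loop_nonneg_iff:
  "X \<in> GL_loop_nonneg n \<longleftrightarrow> X \<in> GL_loop n \<and> totally_nonneg (unfolding_mat n X)"
proof -
  have "(\<forall>I J. finite I \<and> finite J \<and> card I = card J \<longrightarrow> 0 \<le> minor I J x) \<longleftrightarrow> totally_nonneg x" for x
  proof (intro iffI allI impI)
    fix I J :: "int set" assume "totally_nonneg x" "finite I \<and> finite J \<and> card I = card J"
    then show "0 \<le> minor I J x"
      unfolding minor_eq_list_minor by (intro totally_nonnegD) auto
  next
    assume *: "\<forall>I J. finite I \<and> finite J \<and> card I = card J \<longrightarrow> 0 \<le> minor I J x"
    show "totally_nonneg x"
      unfolding totally_nonneg_def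
    proof (intro allI impI)
      fix I J :: "int list"
      assume "length I = length J" and s: "sorted_wrt (<) I" "sorted_wrt (<) J"
      then have "card (set I) = card (set J)"
        using strict_sorted_iff distinct_card by metis
      then show "0 \<le> list_minor x I J"
        unfolding list_minor_eq_minor[OF s] using * by blast
    qed
  qed
  then show ?thesis by (auto simp: GL_loop_nonneg_def)
qed

text \<open>
  Let \<open>Y\<close> be the inverse of \<open>X\<close>, with no entries further than \<open>K\<close> below the diagonal. If a
  combination \<open>c\<close> of columns \<open>\<ge> i + K\<close> vanishes in all rows \<open>\<ge> i\<close>, then the rows of \<open>Y\<close> that read
  off the coefficients of \<open>c\<close> only see these rows, so \<open>c = 0\<close>. The statement for rows is dual.
\<close>

lemma shifted_columns_rows_independent:
  assumes n: "n \<ge> 1" and X: "X \<in> GL_loop n"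
  obtains K :: int where
    "\<And>i j (r :: nat) c t. j \<ge> i + K \<Longrightarrow>
      (\<And>k. k \<ge> i \<Longrightarrow> (\<Sum>t<r. unfolding_mat n X k (j + int t) * c t) = 0) \<Longrightarrow> t < r \<Longrightarrow> c t = (0 :: real)"
    "\<And>i m (r :: nat) c t. i + int r + K \<le> m \<Longrightarrow>
      (\<And>l. l \<le> m \<Longrightarrow> (\<Sum>t<r. c t * unfolding_mat n X (i + int t) l) = 0) \<Longrightarrow> t < r \<Longrightarrow> c t = (0 :: real)"
proof -
  obtain Y where Y: "Y \<in> carrier_mat n n" "X * Y = 1\<^sub>m n" "Y * X = 1\<^sub>m n"
    using GL_loop_inverse[OF X] .
  have Xc: "X \<in> carrier_mat n n" using X by (simp add: GL_loop_def)
  let ?x = "unfolding_mat n X" and ?y = "unfolding_mat n Y"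
  obtain B1 where B1: "B1 \<ge> 0" "\<And>i j. j < i - B1 \<Longrightarrow> ?x i j = 0"
    using unfolding_lower_bound[OF n, of X] by blast
  obtain B2 where B2: "B2 \<ge> 0" "\<And>i j. j < i - B2 \<Longrightarrow> ?y i j = 0"
    using unfolding_lower_bound[OF n, of Y] by blast
  show ?thesis
  proof (rule that[of B2])
    fix i j :: int and r :: nat and c :: "nat \<Rightarrow> real" and t
    assume j: "j \<ge> i + B2" and t: "t < r"
      and zero: "\<And>k. k \<ge> i \<Longrightarrow> (\<Sum>t<r. ?x k (j + int t) * c t) = 0"
    define S where "S = {j + int t - B2..j + int r + B1}"
    have yx: "(if t = u then 1 else 0) = (\<Sum>k\<in>S. ?y (j + int t) k * ?x k (j + int u))" if "u < r" for u
    proof -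
      have "unfolding_mat n (Y * X) (j + int t) (j + int u) = (\<Sum>k\<in>S. ?y (j + int t) k * ?x k (j + int u))"
      proof (rule unfolding_mult[OF n Y(1) Xc])
        fix k assume "?y (j + int t) k \<noteq> 0" "?x k (j + int u) \<noteq> 0"
        then have "\<not> k < j + int t - B2" "\<not> j + int u < k - B1" using B1 B2 by blast+
        then show "k \<in> S" using that by (auto simp: S_def)
      qed (simp add: S_def)
      then show ?thesis using unfolding_one[OF n] Y by simp
    qed
    have "c t = (\<Sum>u<r. (if t = u then 1 else 0) * c u)"
      using t by (simp add: sum.delta if_distrib[of "\<lambda>z. z * _"] cong: if_cong)
    also have "\<dots> = (\<Sum>u<r. \<Sum>k\<in>S. ?y (j + int t) k * (?x k (j + int u) * c u))"
      by (intro sum.cong) (simp_all add: yx sum_distrib_right mult.assoc)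
    also have "\<dots> = (\<Sum>k\<in>S. ?y (j + int t) k * (\<Sum>u<r. ?x k (j + int u) * c u))"
      by (subst sum.swap) (simp add: sum_distrib_left)
    also have "\<dots> = 0"
      using zero j by (intro sum.neutral) (auto simp: S_def)
    finally show "c t = 0" .
  next
    fix i m :: int and r :: nat and c :: "nat \<Rightarrow> real" and t
    assume m: "i + int r + B2 \<le> m" and t: "t < r"
      and zero: "\<And>l. l \<le> m \<Longrightarrow> (\<Sum>t<r. c t * ?x (i + int t) l) = 0"
    define S where "S = {i - B1..i + int t + B2}"
    have xy: "(if u = t then 1 else 0) = (\<Sum>k\<in>S. ?x (i + int u) k * ?y k (i + int t))" if "u < r" for u
    proof -
      have "unfolding_mat n (X * Y) (i + int u) (i + int t) = (\<Sum>k\<in>S. ?x (i + int u) k * ?y k (i + int t))"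
      proof (rule unfolding_mult[OF n Xc Y(1)])
        fix k assume "?x (i + int u) k \<noteq> 0" "?y k (i + int t) \<noteq> 0"
        then have "\<not> k < i + int u - B1" "\<not> i + int t < k - B2" using B1 B2 by blast+
        then show "k \<in> S" using that by (auto simp: S_def)
      qed (simp add: S_def)
      then show ?thesis using unfolding_one[OF n] Y by simp
    qed
    have "c t = (\<Sum>u<r. c u * (if u = t then 1 else 0))"
      using t by (simp add: sum.delta if_distrib[of "\<lambda>z. _ * z"] cong: if_cong)
    also have "\<dots> = (\<Sum>u<r. \<Sum>k\<in>S. (c u * ?x (i + int u) k) * ?y k (i + int t))"
      by (intro sum.cong) (simp_all add: xy sum_distrib_left mult.assoc)
    also have "\<dots> = (\<Sum>k\<in>S. (\<Sum>u<r. c u * ?x (i + int u) k) * ?y k (i + int t))"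
      by (subst sum.swap) (simp add: sum_distrib_right)
    also have "\<dots> = 0"
      using zero m t by (intro sum.neutral) (auto simp: S_def)
    finally show "c t = 0" .
  qed
qed

section \<open>Products of generators have corners of finite rank\<close>

definition corner_minors_vanish :: "infmat \<Rightarrow> nat \<Rightarrow> int \<Rightarrow> int \<Rightarrow> bool" where
  "corner_minors_vanish x h r c \<longleftrightarrow> (\<forall>I J. length I = Suc h \<longrightarrow> length J = Suc h \<longrightarrow>
    (\<forall>i\<in>set I. i \<le> r) \<longrightarrow> (\<forall>j\<in>set J. c < j) \<longrightarrow> list_minor x I J = 0)"

lemma corner_minors_vanishI:
  assumes "finite S" "card S \<le> h" "\<And>i j. i \<le> r \<Longrightarrow> c < j \<Longrightarrow> x i j = (\<Sum>s\<in>S. u s i * w s j)"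
  shows "corner_minors_vanish x h r c"
  unfolding corner_minors_vanish_def
  by (intro allI impI list_minor_low_rank[of S _ _ _ u w]) (use assms in auto)

lemma unfolding_shift_inverse:
  assumes n: "n \<ge> 1" and B: "B \<in> carrier_mat n n" "folding_mat n shift * B = 1\<^sub>m n"
  shows "unfolding_mat n B i j = (if j = i - 1 then 1 else 0)"
proof -
  have "unfolding_mat n (folding_mat n shift * B) (i - 1) j = unfolding_mat n B i j"
    by (subst unfolding_mult_two_terms[OF n _ B(1), of _ "i - 1" i])
      (simp_all add: unfolding_generators[OF n] shift_def)
  then show ?thesis
    using B unfolding_one[OF n] by auto
qed

lemma generators_carrier: "Y \<in> generators n \<Longrightarrow> Y \<in> carrier_mat n n"
  by (auto simp: generators_def whirls_def curls_def chevalleys_def shifts_def torus_pos_def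
      split: if_splits)

text \<open>
  A curl entry \<open>a\<^sub>i \<dots> a\<^sub>j\<^sub>-\<^sub>1\<close> splits at \<open>r\<close> into a factor depending on \<open>i\<close> and one depending on \<open>j\<close>; all
  other generators have at most one nonzero entry in the block, at position \<open>(r, r + 1)\<close>.
\<close>

lemma generator_corner_rank:
  assumes n: "n \<ge> 1" and Y: "Y \<in> generators n"
  obtains u w where "\<And>i j. i \<le> r \<Longrightarrow> r < j \<Longrightarrow> unfolding_mat n Y i j = u i * w j"
proof (cases "Y \<in> curls n")
  case True
  then obtain a where a: "unfolding_mat n Y = curl n a"
    using unfolding_generators[OF n] by (auto simp: curls_def)
  show ?thesis
  proof (rule that[of "\<lambda>i. \<Prod>k\<in>{i..<r}. cyc n a k" "\<lambda>j. \<Prod>k\<in>{r..<j}. cyc n a k"])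
    fix i j assume ij: "i \<le> r" "r < j"
    have "{i..<j} = {i..<r} \<union> {r..<j}" using ij by auto
    then show "unfolding_mat n Y i j = (\<Prod>k\<in>{i..<r}. cyc n a k) * (\<Prod>k\<in>{r..<j}. cyc n a k)"
      using ij by (simp add: a curl_def prod.union_disjoint[symmetric] ivl_disj_int)
  qed
next
  case False
  have "unfolding_mat n Y i j = 0" if "j > i + 1" for i j
  proof -
    consider "Y \<in> whirls n" | "Y \<in> chevalleys n" | "Y \<in> shifts n" | "Y \<in> torus_pos n"
      using Y False by (auto simp: generators_def)
    then show ?thesis
    proof cases
      case 1
      then obtain a where "Y = folding_mat n (whirl n a)" by (auto simp: whirls_def)
      then show ?thesis using that by (simp add: unfolding_generators[OF n] whirl_def)
    next
      case 2
      then obtain k a where "Y = folding_mat n (chevalley_upper n k a) \<or>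
          Y = folding_mat n (chevalley_lower n k a)"
        by (auto simp: chevalleys_def split: if_splits)
      then show ?thesis
        using that by (elim disjE)
          (simp_all add: unfolding_generators[OF n] chevalley_upper_def chevalley_lower_def)
    next
      case 3
      show ?thesis
      proof (cases "Y = folding_mat n shift")
        case True
        then show ?thesis using that by (simp add: unfolding_generators[OF n] shift_def)
      next
        case False
        then have "Y \<in> carrier_mat n n" "folding_mat n shift * Y = 1\<^sub>m n"
          using 3 carrier_matD(1)[OF folding_carrier[of n shift]]
          by (simp_all add: shifts_def inverts_mat_def)
        from unfolding_shift_inverse[OF n this] show ?thesis using that by simp
      qed
    next
      case 4
      then obtain d where "Y = mat_diag n (\<lambda>i. fls_const (d i))" by (auto simp: torus_pos_def)
      then show ?thesis using that by (simp add: unfolding_mat_diag[OF n])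
    qed
  qed
  then have "unfolding_mat n Y i j = (if i = r then 1 else 0) * unfolding_mat n Y r j"
    if "i \<le> r" "r < j" for i j
    using that by (cases "i = r") auto
  then show ?thesis by (rule that)
qed

lemma mat_product_Nil [simp]: "mat_product n [] = 1\<^sub>m n"
  and mat_product_Cons [simp]: "mat_product n (Y # Ys) = Y * mat_product n Ys"
  by (simp_all add: mat_product_def)

lemma mat_product_carrier: "set Ys \<subseteq> generators n \<Longrightarrow> mat_product n Ys \<in> carrier_mat n n"
  by (induction Ys) (auto intro: mult_carrier_mat dest: generators_carrier)

text \<open>
  Split the matrix product at the middle index \<open>r\<close>: the terms up to \<open>r\<close> use the corner of the right
  factor, the terms beyond \<open>r\<close> the corner of the left factor, so the ranks add.
\<close>

lemma product_corner_rank: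
  assumes n: "n \<ge> 1" and "set Ys \<subseteq> generators n"
  obtains u w where "\<And>i j. i \<le> r \<Longrightarrow> r < j \<Longrightarrow>
    unfolding_mat n (mat_product n Ys) i j = (\<Sum>s<length Ys. u s i * w s j)"
  using assms(2)
proof (induction Ys arbitrary: thesis)
  case Nil
  show ?case
    by (rule Nil(1)) (simp add: unfolding_one[OF n])
next
  case (Cons Y Ys)
  let ?P = "mat_product n Ys"
  let ?y = "unfolding_mat n Y" and ?p = "unfolding_mat n ?P"
  have carr: "Y \<in> carrier_mat n n" "?P \<in> carrier_mat n n"
    using Cons.prems generators_carrier mat_product_carrier by auto
  obtain u w where uw: "\<And>i j. i \<le> r \<Longrightarrow> r < j \<Longrightarrow> ?p i j = (\<Sum>s<length Ys. u s i * w s j)"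
    using Cons.IH Cons.prems(2) by auto
  obtain v z where vz: "\<And>i j. i \<le> r \<Longrightarrow> r < j \<Longrightarrow> ?y i j = v i * z j"
    using generator_corner_rank[OF n, of Y r] Cons.prems(2) by auto
  obtain B1 where B1: "B1 \<ge> 0" "\<And>i j. j < i - B1 \<Longrightarrow> ?y i j = 0"
    using unfolding_lower_bound[OF n, of Y] by blast
  obtain B2 where B2: "B2 \<ge> 0" "\<And>i j. j < i - B2 \<Longrightarrow> ?p i j = 0"
    using unfolding_lower_bound[OF n, of ?P] by blast
  define u' where "u' = (\<lambda>s i. case s of 0 \<Rightarrow> v i | Suc s \<Rightarrow> \<Sum>k\<in>{i - B1..r}. ?y i k * u s k)"
  define w' where "w' = (\<lambda>s j. case s of 0 \<Rightarrow> \<Sum>k\<in>{r<..j + B2}. z k * ?p k j | Suc s \<Rightarrow> w s j)"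
  show ?case
  proof (rule Cons.prems(1)[of u' w'])
    fix i j assume ij: "i \<le> r" "r < j"
    have "unfolding_mat n (Y * ?P) i j = (\<Sum>k\<in>{i - B1..r} \<union> {r<..j + B2}. ?y i k * ?p k j)"
    proof (rule unfolding_mult[OF n carr])
      fix k assume "?y i k \<noteq> 0" "?p k j \<noteq> 0"
      then have "\<not> k < i - B1" "\<not> j < k - B2" using B1 B2 by blast+
      then show "k \<in> {i - B1..r} \<union> {r<..j + B2}" by auto
    qed simp
    also have "\<dots> = (\<Sum>k\<in>{i - B1..r}. ?y i k * ?p k j) + (\<Sum>k\<in>{r<..j + B2}. ?y i k * ?p k j)"
      by (rule sum.union_disjoint) auto
    also have "(\<Sum>k\<in>{i - B1..r}. ?y i k * ?p k j) =
        (\<Sum>k\<in>{i - B1..r}. \<Sum>s<length Ys. ?y i k * u s k * w s j)"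
      using ij by (intro sum.cong) (simp_all add: uw sum_distrib_left mult_ac)
    also have "\<dots> = (\<Sum>s<length Ys. (\<Sum>k\<in>{i - B1..r}. ?y i k * u s k) * w s j)"
      by (subst sum.swap) (simp add: sum_distrib_right)
    also have "(\<Sum>k\<in>{r<..j + B2}. ?y i k * ?p k j) = v i * (\<Sum>k\<in>{r<..j + B2}. z k * ?p k j)"
      using ij by (simp add: vz sum_distrib_left mult_ac)
    finally show "unfolding_mat n (mat_product n (Y # Ys)) i j =
        (\<Sum>s<length (Y # Ys). u' s i * w' s j)"
      by (simp add: u'_def w'_def sum.lessThan_Suc_shift del: sum.lessThan_Suc)
  qed
qed

lemma product_not_totally_positive:
  assumes n: "n \<ge> 1" and Ys: "set Ys \<subseteq> generators n"
  shows "\<not> totally_positive n (mat_product n Ys)"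
proof
  assume "totally_positive n (mat_product n Ys)"
  then obtain k :: int where k: "\<forall>I J. finite I \<and> finite J \<and> card I = card J \<and>
      (\<forall>t<card I. sorted_list_of_set I ! t \<le> sorted_list_of_set J ! t + k) \<longrightarrow>
      0 < minor I J (unfolding_mat n (mat_product n Ys))"
    unfolding totally_positive_def by (elim conjE exE) (rule that)
  define h where "h = length Ys"
  define r where "r = int h + 1"
  define R where "R = r + \<bar>k\<bar>"
  define I J where "I = {1..r}" and "J = {R + 1..R + r}"
  have IJ: "finite I" "finite J" "card I = Suc h" "card J = Suc h"
    by (auto simp: I_def J_def r_def)
  obtain u w where uw: "\<And>i j. i \<le> r \<Longrightarrow> r < j \<Longrightarrow>
      unfolding_mat n (mat_product n Ys) i j = (\<Sum>s<h. u s i * w s j)"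
    using product_corner_rank[OF n Ys, of r] unfolding h_def by blast
  have "list_minor (unfolding_mat n (mat_product n Ys)) (sorted_list_of_set I) (sorted_list_of_set J) = 0"
    by (rule list_minor_low_rank[where S = "{..<h}" and u = u and w = w])
      (use IJ in \<open>auto simp: I_def J_def R_def intro!: uw\<close>)
  moreover have "0 < minor I J (unfolding_mat n (mat_product n Ys))"
  proof (rule k[rule_format], intro conjI)
    show "\<forall>t<card I. sorted_list_of_set I ! t \<le> sorted_list_of_set J ! t + k"
    proof (intro allI impI)
      fix t assume t: "t < card I"
      have "sorted_list_of_set I ! t \<in> I" "sorted_list_of_set J ! t \<in> J"
        using t IJ nth_mem[of t "sorted_list_of_set I"] nth_mem[of t "sorted_list_of_set J"] by auto
      then show "sorted_list_of_set I ! t \<le> sorted_list_of_set J ! t + k"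
        by (auto simp: I_def J_def R_def)
    qed
  qed (use IJ in auto)
  ultimately show False by (simp add: minor_eq_list_minor)
qed

section \<open>A vanishing minor far to the right forces a corner of finite rank\<close>

lemma upto_snoc: "i \<le> j + 1 \<Longrightarrow> [i..j + 1] = [i..j] @ [j + 1]"
  using upto_rec2[of i "j + 1"] by simp

lemma sorted_upto: "sorted_wrt (<) [i..j]"
  by (simp add: strict_sorted_iff)

text \<open>
  By independence of the columns \<open>j # Q\<close> on the rows \<open>\<ge> i\<close>, some row \<open>b\<close> below the block extends
  \<open>P\<close> to a positive minor on these columns. Condensation with the rows \<open>i\<close>, \<open>P\<close>, \<open>b\<close> then yields a
  product of two nonnegative minors that is \<open>\<le> 0\<close>, and this kills the minor of the block with its
  first column replaced by any \<open>y\<close> further right. Expanding along \<open>y\<close> gives the linear relation.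
\<close>

lemma vanishing_block_row_dependence:
  assumes tnn: "totally_nonneg x"
    and P: "P = [i + 1..i + int r]" and Q: "Q = [j + 1..j + int r]"
    and pos: "0 < list_minor x P Q" and zero: "list_minor x (i # P) (j # Q) = 0"
    and indep: "\<And>c. (\<And>k. k \<ge> i \<Longrightarrow> (\<Sum>t<Suc r. x k (j + int t) * c t) = 0) \<Longrightarrow> c 0 = 0"
  obtains \<beta> where "\<And>y. y \<ge> j \<Longrightarrow> x i y = (\<Sum>t<r. \<beta> t * x (i + 1 + int t) y)"
proof -
  have len: "length P = r" "length Q = r" by (simp_all add: P Q)
  have J: "(j # Q) ! t = j + int t" if "t < Suc r" for t
    using that by (cases t) (simp_all add: Q nth_upto)
  have nonneg: "0 \<le> list_minor x I L" if "length I = length L" "sorted_wrt (<) I" "sorted_wrt (<) L" for I L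
    by (rule totally_nonnegD[OF tnn that])
  have "\<exists>k>i + int r. list_minor x (P @ [k]) (j # Q) \<noteq> 0"
  proof (rule ccontr)
    assume none: "\<not> ?thesis"
    define c where "c = (\<lambda>t. (-1) ^ (r + t) * list_minor x P (delete_nth t (j # Q)))"
    have "c 0 = 0"
    proof (rule indep)
      fix k assume k: "k \<ge> i"
      have "list_minor x (P @ [k]) (j # Q) = 0"
      proof -
        consider "k = i" | "k \<in> set P" | "k > i + int r" using k by (fastforce simp: P)
        then show ?thesis
        proof cases
          case 1
          then show ?thesis
            using zero list_minor_rotate_row[of "j # Q" P x i] len by simp
        next
          case 2
          then show ?thesis by (intro list_minor_repeated_row) (use len in auto)
        qed (use none in auto)
      qed
      moreover have "list_minor x (P @ [k]) (j # Q) = (\<Sum>t<Suc r. x k (j + int t) * c t)"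
        using list_minor_expand_row[of "j # Q" P "[]" x k] len
        by (simp add: c_def J mult_ac del: sum.lessThan_Suc nth_Cons_Suc) 
      ultimately show "(\<Sum>t<Suc r. x k (j + int t) * c t) = 0" by simp
    qed
    then show False using pos by (simp add: c_def)
  qed
  then obtain b where b: "b > i + int r" and nz: "list_minor x (P @ [b]) (j # Q) \<noteq> 0" by blast
  have "0 \<le> list_minor x (P @ [b]) (j # Q)"
    by (rule nonneg) (use b len in \<open>auto simp: P Q sorted_wrt_append sorted_upto\<close>)
  with nz have b_pos: "0 < list_minor x (P @ [b]) (j # Q)" by simp
  have all0: "list_minor x (i # P) (y # Q) = 0" if "y \<ge> j" for y
  proof -
    consider "y = j" | "y \<in> set Q" | "y > j + int r" using \<open>y \<ge> j\<close> by (fastforce simp: Q)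
    then show ?thesis
    proof cases
      case 2
      then show ?thesis by (intro list_minor_repeated_column) (use len in auto)
    next
      case 3
      have "0 \<le> list_minor x (i # P) (Q @ [y])"
        by (rule nonneg) (use 3 len in \<open>auto simp: P Q sorted_wrt_append sorted_upto\<close>)
      moreover have "0 \<le> list_minor x (i # P @ [b]) (j # Q @ [y])"
        by (rule nonneg) (use 3 b len in \<open>auto simp: P Q sorted_wrt_append sorted_upto\<close>)
      then have "list_minor x (P @ [b]) (j # Q) * list_minor x (i # P) (Q @ [y]) \<le> 0"
        using desnanot_jacobi[of P Q x i j b y] zero len
          mult_nonneg_nonneg[OF less_imp_le[OF pos]] by fastforce
      ultimately have "list_minor x (i # P) (Q @ [y]) = 0"
        using b_pos by (simp add: mult_le_0_iff)
      then show ?thesis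
        using list_minor_rotate_column[of "i # P" Q x y] len by simp
    qed (use zero in auto)
  qed
  define \<beta> where "\<beta> = (\<lambda>t. (-1) ^ t * list_minor x (i # delete_nth t P) Q / list_minor x P Q)"
  show ?thesis
  proof (rule that[of \<beta>])
    fix y assume "y \<ge> j"
    then have "0 = list_minor x (i # P) (y # Q)" using all0 by simp
    also have "\<dots> = (\<Sum>t<Suc r. (-1) ^ t * x ((i # P) ! t) y * list_minor x (delete_nth t (i # P)) Q)"
      using list_minor_expand_column[of "i # P" "[]" Q x y] len by simp
    also have "\<dots> = x i y * list_minor x P Q -
        (\<Sum>t<r. (-1) ^ t * x (P ! t) y * list_minor x (i # delete_nth t P) Q)"
      by (simp add: sum.lessThan_Suc_shift sum_negf del: sum.lessThan_Suc)
    finally have "x i y = (\<Sum>t<r. (-1) ^ t * x (P ! t) y * list_minor x (i # delete_nth t P) Q) / list_minor x P Q"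
      using pos by (simp add: field_simps)
    also have "\<dots> = (\<Sum>t<r. \<beta> t * x (i + 1 + int t) y)"
      unfolding sum_divide_distrib by (intro sum.cong) (auto simp: \<beta>_def P nth_upto mult_ac)
    finally show "x i y = (\<Sum>t<r. \<beta> t * x (i + 1 + int t) y)" .
  qed
qed

text \<open>
  The mirror image of the previous argument: now independence of the rows provides a column to
  the left of the block.
\<close>

lemma vanishing_block_moves_up:
  assumes tnn: "totally_nonneg x"
    and P: "P = [i..i + int r - 1]" and Q: "Q = [j..j + int r - 1]"
    and pos: "0 < list_minor x P Q" and zero: "list_minor x (P @ [i + int r]) (Q @ [j + int r]) = 0"
    and indep: "\<And>c. (\<And>l. l \<le> j + int r \<Longrightarrow> (\<Sum>t<Suc r. c t * x (i + int t) l) = 0) \<Longrightarrow> c r = 0"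
    and a: "a < i"
  shows "list_minor x (a # P) (Q @ [j + int r]) = 0"
proof -
  let ?b = "i + int r" and ?d = "j + int r"
  have len: "length P = r" "length Q = r" by (simp_all add: P Q)
  have I: "(P @ [?b]) ! t = i + int t" if "t < Suc r" for t
    using that len by (cases "t = r") (auto simp: nth_append P nth_upto)
  have nonneg: "0 \<le> list_minor x I L" if "length I = length L" "sorted_wrt (<) I" "sorted_wrt (<) L" for I L
    by (rule totally_nonnegD[OF tnn that])
  have "\<exists>c<j. list_minor x (P @ [?b]) (c # Q) \<noteq> 0"
  proof (rule ccontr)
    assume none: "\<not> ?thesis"
    define c where "c = (\<lambda>t. (-1) ^ t * list_minor x (delete_nth t (P @ [?b])) Q)"
    have "c r = 0"
    proof (rule indep)
      fix l assume l: "l \<le> ?d"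
      have "list_minor x (P @ [?b]) (l # Q) = 0"
      proof -
        consider "l = ?d" | "l \<in> set Q" | "l < j" using l by (fastforce simp: Q)
        then show ?thesis
        proof cases
          case 1
          then show ?thesis
            using zero list_minor_rotate_column[of "P @ [?b]" Q x l] len by simp
        next
          case 2
          then show ?thesis by (intro list_minor_repeated_column) (use len in auto)
        qed (use none in auto)
      qed
      moreover have "list_minor x (P @ [?b]) (l # Q) = (\<Sum>t<Suc r. c t * x (i + int t) l)"
        using list_minor_expand_column[of "P @ [?b]" "[]" Q x l] len
        by (simp add: c_def I mult_ac del: sum.lessThan_Suc)
      ultimately show "(\<Sum>t<Suc r. c t * x (i + int t) l) = 0" by simp
    qed
    then show False using pos len by (auto simp: c_def delete_nth_append delete_nth_def)
  qed
  then obtain c where c: "c < j" and nz: "list_minor x (P @ [?b]) (c # Q) \<noteq> 0" by blast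
  have "0 \<le> list_minor x (P @ [?b]) (c # Q)"
    by (rule nonneg) (use c len in \<open>auto simp: P Q sorted_wrt_append sorted_upto\<close>)
  with nz have c_pos: "0 < list_minor x (P @ [?b]) (c # Q)" by simp
  have "0 \<le> list_minor x (a # P) (Q @ [?d])"
    by (rule nonneg) (use a len in \<open>auto simp: P Q sorted_wrt_append sorted_upto\<close>)
  moreover have "0 \<le> list_minor x (a # P @ [?b]) (c # Q @ [?d])"
    by (rule nonneg) (use a c len in \<open>auto simp: P Q sorted_wrt_append sorted_upto\<close>)
  then have "list_minor x (P @ [?b]) (c # Q) * list_minor x (a # P) (Q @ [?d]) \<le> 0"
    using desnanot_jacobi[of P Q x a c ?b ?d] zero len
      mult_nonneg_nonneg[OF less_imp_le[OF pos]] by fastforce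
  ultimately show ?thesis
    using c_pos by (simp add: mult_le_0_iff)
qed

text \<open>
  The pairs of index sets whose minors have to be positive in the definition of total positivity
  with shift \<open>k = - K\<close>.
\<close>

definition far_right :: "int \<Rightarrow> int list \<Rightarrow> int list \<Rightarrow> bool" where
  "far_right K I J \<longleftrightarrow> list_all2 (\<lambda>i j. i + K \<le> j) I J \<and> sorted_wrt (<) I \<and> sorted_wrt (<) J"

lemma far_right_length: "far_right K I J \<Longrightarrow> length I = length J"
  by (auto simp: far_right_def dest: list_all2_lengthD)

lemma consecutive_list:
  assumes "sorted_wrt (<) (J :: int list)" "J \<noteq> []"
    and "\<And>A a c B. J = A @ a # c # B \<Longrightarrow> c \<le> a + 1"
  shows "J = [hd J..hd J + int (length J) - 1]"
  using assms
proof (induction J)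
  case (Cons a J)
  show ?case
  proof (cases J)
    case Nil
    then show ?thesis by simp
  next
    case (Cons c J')
    have c: "c = a + 1"
      using Cons.prems(1) Cons.prems(3)[of "[]" a c J'] Cons by simp
    have "J = [hd J..hd J + int (length J) - 1]"
    proof (rule Cons.IH)
      fix A a' c' B assume "J = A @ a' # c' # B"
      then show "c' \<le> a' + 1" using Cons.prems(3)[of "a # A" a' c' B] by simp
    qed (use Cons.prems Cons in auto)
    then have "J = [a + 1..a + 1 + int (length J) - 1]" using Cons c by simp
    then show ?thesis
      using upto_rec1[of a "a + int (length J)"] by simp
  qed
qed simp

text \<open>
  In the three-term relation for \<open>a < b < c\<close> the left side is zero and the right side is a sum of
  nonnegative terms, so both vanish; minimality of the size makes the smaller minor positive.
  Moving a column to the right, or a row up, does not leave the class of \<open>far_right\<close> pairs.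
\<close>

lemma far_right_gap_column:
  assumes tnn: "totally_nonneg x"
    and pos: "\<And>I J. far_right K I J \<Longrightarrow> length I = r \<Longrightarrow> 0 < list_minor x I J"
    and reg: "far_right K I (A @ a # c # B)" and len: "length I = Suc r"
    and zero: "list_minor x I (A @ a # c # B) = 0" and b: "a < b" "b < c"
  shows "far_right K I (A @ b # c # B)" "list_minor x I (A @ b # c # B) = 0"
proof -
  obtain A' a' c' B' where I: "I = A' @ a' # c' # B'" and l: "length A' = length A" "length B' = length B"
    and r2: "list_all2 (\<lambda>i j. i + K \<le> j) A' A" "a' + K \<le> a" "c' + K \<le> c"
      "list_all2 (\<lambda>i j. i + K \<le> j) B' B"
    using reg unfolding far_right_def list_all2_append2 list_all2_Cons2
    by (auto dest: list_all2_lengthD)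
  let ?M = "A' @ a' # B'"
  show reg': "far_right K I (A @ b # c # B)"
    using reg r2 b unfolding I far_right_def
    by (auto simp: sorted_wrt_append intro!: list_all2_appendI) 
  have M: "far_right K ?M (A @ a # B)"
    using reg r2 unfolding I far_right_def by (auto simp: sorted_wrt_append intro!: list_all2_appendI)
  have sorted: "sorted_wrt (<) I" "sorted_wrt (<) ?M" "sorted_wrt (<) (A @ a # b # B)"
     "sorted_wrt (<) (A @ c # B)"
    using reg M b unfolding I far_right_def by (auto simp: sorted_wrt_append)
  have "0 < list_minor x ?M (A @ a # B)"
    by (rule pos[OF M]) (use len I in simp)
  moreover have "0 \<le> list_minor x I (A @ a # b # B) * list_minor x ?M (A @ c # B)"
    by (intro mult_nonneg_nonneg totally_nonnegD[OF tnn]) (use sorted len l I in auto)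
  moreover have "0 \<le> list_minor x I (A @ b # c # B)"
    by (rule totally_nonnegD[OF tnn]) (use reg' far_right_length[OF reg'] in \<open>auto simp: far_right_def\<close>)
  moreover have "list_minor x I (A @ a # c # B) * list_minor x ?M (A @ b # B) =
    list_minor x I (A @ a # b # B) * list_minor x ?M (A @ c # B) +
    list_minor x I (A @ b # c # B) * list_minor x ?M (A @ a # B)"
    by (rule three_term_columns) (use l I in auto)
  ultimately show "list_minor x I (A @ b # c # B) = 0"
    unfolding zero
    by (smt (verit, best) mult_eq_0_iff mult_nonneg_nonneg mult_pos_pos)
qed

lemma far_right_gap_row:
  assumes tnn: "totally_nonneg x"
    and pos: "\<And>I J. far_right K I J \<Longrightarrow> length I = r \<Longrightarrow> 0 < list_minor x I J"
    and reg: "far_right K (A @ a # c # B) J" and len: "length J = Suc r"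
    and zero: "list_minor x (A @ a # c # B) J = 0" and b: "a < b" "b < c"
  shows "far_right K (A @ a # b # B) J" "list_minor x (A @ a # b # B) J = 0"
proof -
  obtain A' a' c' B' where J: "J = A' @ a' # c' # B'" and l: "length A' = length A" "length B' = length B"
    and r2: "list_all2 (\<lambda>i j. i + K \<le> j) A A'" "a + K \<le> a'" "c + K \<le> c'"
      "list_all2 (\<lambda>i j. i + K \<le> j) B B'"
    using reg unfolding far_right_def list_all2_append1 list_all2_Cons1
    by (auto dest: list_all2_lengthD)
  let ?M = "A' @ c' # B'"
  show reg': "far_right K (A @ a # b # B) J"
    using reg r2 b unfolding J far_right_def
    by (auto simp: sorted_wrt_append intro!: list_all2_appendI) 
  have M: "far_right K (A @ c # B) ?M"
    using reg r2 unfolding J far_right_def by (auto simp: sorted_wrt_append intro!: list_all2_appendI)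
  have sorted: "sorted_wrt (<) J" "sorted_wrt (<) ?M" "sorted_wrt (<) (A @ b # c # B)"
     "sorted_wrt (<) (A @ a # B)"
    using reg M b unfolding J far_right_def by (auto simp: sorted_wrt_append)
  have "0 < list_minor x (A @ c # B) ?M"
    by (rule pos[OF M]) (use len l J in simp)
  moreover have "0 \<le> list_minor x (A @ b # c # B) J * list_minor x (A @ a # B) ?M"
    by (intro mult_nonneg_nonneg totally_nonnegD[OF tnn]) (use sorted len l J in auto)
  moreover have "0 \<le> list_minor x (A @ a # b # B) J"
    by (rule totally_nonnegD[OF tnn]) (use reg' far_right_length[OF reg'] in \<open>auto simp: far_right_def\<close>)
  moreover have "list_minor x (A @ a # c # B) J * list_minor x (A @ b # B) ?M =
    list_minor x (A @ a # b # B) J * list_minor x (A @ c # B) ?M +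
    list_minor x (A @ b # c # B) J * list_minor x (A @ a # B) ?M"
    by (rule three_term_rows) (use l J in auto)
  ultimately show "list_minor x (A @ a # b # B) J = 0"
    unfolding zero
    by (smt (verit, best) mult_eq_0_iff mult_nonneg_nonneg mult_pos_pos)
qed

text \<open>
  Moving columns right and rows up terminates, since the last column and the first row stay
  fixed. A vanishing minor that cannot be moved any more has consecutive rows and columns.
\<close>

lemma solid_vanishing_minor:
  assumes tnn: "totally_nonneg x"
    and pos: "\<And>I J. far_right K I J \<Longrightarrow> length I = r \<Longrightarrow> 0 < list_minor x I J"
    and "far_right K I J" "length I = Suc r" "list_minor x I J = 0"
  obtains i j where "i + K \<le> j" "list_minor x [i..i + int r] [j..j + int r] = 0"
proof -
  \<comment> \<open>the total distance of the rows from the first row and of the columns from the last column\<close>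
  define gaps where "gaps = (\<lambda>(I, J). sum_list (map (\<lambda>y. nat (y - hd I)) I) +
    sum_list (map (\<lambda>y. nat (last J - y)) J) :: nat)"
  define Z where "Z = (\<lambda>(I, J). far_right K I J \<and> length I = Suc r \<and> list_minor x I J = 0)"
  have "Z (I, J)" using assms by (simp add: Z_def)
  then obtain p where p: "Z p" "\<And>q. Z q \<Longrightarrow> gaps p \<le> gaps q"
    using arg_min_nat_lemma[of Z "(I, J)" gaps] by blast
  obtain I' J' where IJ: "p = (I', J')" by (cases p)
  have Z: "far_right K I' J'" "length I' = Suc r" "list_minor x I' J' = 0"
    using p IJ by (auto simp: Z_def)
  have s: "sorted_wrt (<) I'" "sorted_wrt (<) J'" "length J' = Suc r" "I' \<noteq> []" "J' \<noteq> []"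
    using Z far_right_length[OF Z(1)] by (auto simp: far_right_def)
  have "c \<le> a + 1" if J: "J' = A @ a # c # B" for A a c B
  proof (rule ccontr)
    assume "\<not> c \<le> a + 1"
    then have b: "a < a + 1" "a + 1 < c" by auto
    have "Z (I', A @ (a + 1) # c # B)"
      using far_right_gap_column[OF tnn pos Z(1)[unfolded J] Z(2) Z(3)[unfolded J] b] Z(2)
      by (simp add: Z_def)
    moreover have "last (c # B) \<ge> c"
      using s(2) J by (auto simp: sorted_wrt_append intro: less_imp_le)
    then have "gaps (I', A @ (a + 1) # c # B) < gaps p"
      using b by (simp add: gaps_def IJ J split del: if_split)
    ultimately show False using p(2) by fastforce
  qed
  from consecutive_list[OF s(2,5) this] have J': "J' = [hd J'..hd J' + int r]" 
    using s by simp
  have "c \<le> a + 1" if I: "I' = A @ a # c # B" for A a c B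
  proof (rule ccontr)
    assume "\<not> c \<le> a + 1"
    then have b: "a < a + 1" "a + 1 < c" by auto
    have "Z (A @ a # (a + 1) # B, J')"
      using far_right_gap_row[OF tnn pos Z(1)[unfolded I] s(3) Z(3)[unfolded I] b] Z(2) I
      by (simp add: Z_def)
    moreover have "hd (A @ [a]) \<le> a"
      using s(1) I by (cases A) (auto simp: sorted_wrt_append)
    then have "gaps (A @ a # (a + 1) # B, J') < gaps p"
      using b by (cases A) (simp_all add: gaps_def IJ I)
    ultimately show False using p(2) by fastforce
  qed
  from consecutive_list[OF s(1,4) this] have I': "I' = [hd I'..hd I' + int r]"
    using Z by simp
  have "hd I' + K \<le> hd J'"
    using Z(1) s(4,5) by (cases I'; cases J') (auto simp: far_right_def)
  then show ?thesis
    using that I' J' Z(3) by metis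
qed

lemma far_right_upto:
  assumes "i + K \<le> j"
  shows "far_right K [i..i + int r - 1] [j..j + int r - 1]"
  using assms by (auto simp: far_right_def sorted_upto list_all2_conv_all_nth nth_upto)

text \<open>
  The vanishing block may be moved up row by row while its columns stay fixed. At each height the
  top row of the block is a combination of the next \<open>r\<close> rows on all columns \<open>\<ge> j\<close>; iterating, every
  row up to \<open>i + r\<close> is a combination of the \<open>r\<close> rows following \<open>i\<close>.
\<close>

lemma vanishing_corner:
  assumes tnn: "totally_nonneg x"
    and pos: "\<And>I J. far_right (K + 1) I J \<Longrightarrow> length I = r \<Longrightarrow> 0 < list_minor x I J"
    and ij: "i + (K + 1) \<le> j"
    and zero: "list_minor x [i..i + int r] [j..j + int r] = 0"
    and col_indep: "\<And>i j (r :: nat) c t. j \<ge> i + K \<Longrightarrow>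
      (\<And>k. k \<ge> i \<Longrightarrow> (\<Sum>t<r. x k (j + int t) * c t) = 0) \<Longrightarrow> t < r \<Longrightarrow> c t = (0 :: real)"
    and row_indep: "\<And>i m (r :: nat) c t. i + int r + K \<le> m \<Longrightarrow>
      (\<And>l. l \<le> m \<Longrightarrow> (\<Sum>t<r. c t * x (i + int t) l) = 0) \<Longrightarrow> t < r \<Longrightarrow> c t = (0 :: real)"
  shows "corner_minors_vanish x r i (j - 1)"
proof -
  have zeros: "list_minor x [i - int q..i - int q + int r] [j..j + int r] = 0" for q :: nat
  proof (induction q)
    case 0
    then show ?case using zero by simp
  next
    case (Suc q)
    let ?i = "i - int q"
    let ?P = "[?i..?i + int r - 1]" and ?Q = "[j..j + int r - 1]"
    have ends: "[?i..?i + int r] = ?P @ [?i + int r]" "[j..j + int r] = ?Q @ [j + int r]"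
      using upto_snoc[of ?i "?i + int r - 1"] upto_snoc[of j "j + int r - 1"] by simp_all
    have "list_minor x ((?i - 1) # ?P) (?Q @ [j + int r]) = 0"
    proof (rule vanishing_block_moves_up[OF tnn])
      show "0 < list_minor x ?P ?Q"
        by (rule pos) (use ij far_right_upto[of ?i "K + 1" j r] in auto)
      show "list_minor x (?P @ [?i + int r]) (?Q @ [j + int r]) = 0"
        using Suc ends by simp
      fix c assume "\<And>l. l \<le> j + int r \<Longrightarrow> (\<Sum>t<Suc r. c t * x (?i + int t) l) = 0"
      then show "c r = 0"
        by (rule row_indep[rotated]) (use ij in auto)
    qed auto
    moreover have "(?i - 1) # ?P = [i - int (Suc q)..i - int (Suc q) + int r]"
      using upto_rec1[of "?i - 1" "?i - 1 + int r"] by (simp add: algebra_simps)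
    ultimately show ?case using ends by simp
  qed
  have rec: "\<exists>\<beta>. \<forall>y\<ge>j. x k y = (\<Sum>t<r. \<beta> t * x (k + 1 + int t) y)" if "k \<le> i" for k
  proof -
    let ?P = "[k + 1..k + int r]" and ?Q = "[j + 1..j + int r]"
    have zero: "list_minor x (k # ?P) (j # ?Q) = 0"
      using zeros[of "nat (i - k)"] that upto_rec1[of k "k + int r"] upto_rec1[of j "j + int r"] by simp
    have minor_pos: "0 < list_minor x ?P ?Q"
      by (rule pos) (use that ij far_right_upto[of "k + 1" "K + 1" "j + 1" r] in \<open>auto simp: algebra_simps\<close>)
    show ?thesis
    proof (rule vanishing_block_row_dependence[OF tnn refl refl minor_pos zero])
      show "c 0 = 0" if "\<And>l. l \<ge> k \<Longrightarrow> (\<Sum>t<Suc r. x l (j + int t) * c t) = 0" for c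
        by (rule col_indep[OF _ that]) (use \<open>k \<le> i\<close> ij in auto)
    qed blast
  qed
  have span: "\<exists>\<gamma>. \<forall>y\<ge>j. x k y = (\<Sum>t<r. \<gamma> t * x (i + 1 + int t) y)" if "k \<le> i + int r" for k
    using that
  proof (induction "nat (i + int r - k)" arbitrary: k rule: less_induct)
    case less
    show ?case
    proof (cases "k \<le> i")
      case False
      define m where "m = nat (k - i - 1)"
      have m: "m < r" "k = i + 1 + int m" using False less.prems by (auto simp: m_def)
      show ?thesis
        by (rule exI[of _ "\<lambda>t. if t = m then 1 else 0"])
          (use m in \<open>auto simp: if_distrib[of "\<lambda>z. z * _"] sum.delta cong: if_cong\<close>)
    next
      case True
      obtain \<beta> where \<beta>: "\<forall>y\<ge>j. x k y = (\<Sum>t<r. \<beta> t * x (k + 1 + int t) y)"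
        using rec[OF True] by blast
      have "\<exists>\<gamma>. \<forall>y\<ge>j. x (k + 1 + int t) y = (\<Sum>s<r. \<gamma> s * x (i + 1 + int s) y)" if "t < r" for t
        by (rule less.hyps) (use that True in auto)
      then obtain \<gamma> where \<gamma>: "\<And>t y. t < r \<Longrightarrow> y \<ge> j \<Longrightarrow>
          x (k + 1 + int t) y = (\<Sum>s<r. \<gamma> t s * x (i + 1 + int s) y)"
        by metis
      show ?thesis
      proof (intro exI allI impI)
        fix y assume y: "y \<ge> j"
        have "x k y = (\<Sum>t<r. \<beta> t * (\<Sum>s<r. \<gamma> t s * x (i + 1 + int s) y))"
          using \<beta> \<gamma> y by simp
        also have "\<dots> = (\<Sum>s<r. (\<Sum>t<r. \<beta> t * \<gamma> t s) * x (i + 1 + int s) y)"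
          unfolding sum_distrib_left sum_distrib_right by (subst sum.swap) (simp add: mult_ac)
        finally show "x k y = (\<Sum>s<r. (\<Sum>t<r. \<beta> t * \<gamma> t s) * x (i + 1 + int s) y)" .
      qed
    qed
  qed
  then obtain \<gamma> where \<gamma>: "\<And>k y. k \<le> i + int r \<Longrightarrow> y \<ge> j \<Longrightarrow>
      x k y = (\<Sum>t<r. \<gamma> k t * x (i + 1 + int t) y)"
    by metis
  show ?thesis
    by (rule corner_minors_vanishI[of "{..<r}" _ _ _ _ "\<lambda>s k. \<gamma> k s" "\<lambda>s y. x (i + 1 + int s) y"])
      (use \<gamma> in auto)
qed

text \<open>
  Choose a shift so large that far columns and far rows are independent in the above sense, and
  then a vanishing minor of least size for this shift: all smaller ones are positive.
\<close>

lemma not_totally_positive_imp_corner_minors_vanish: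
  assumes n: "n \<ge> 1" and X: "X \<in> GL_loop_nonneg n" and not_tp: "\<not> totally_positive n X"
  obtains h r c where "corner_minors_vanish (unfolding_mat n X) h r c"
proof -
  let ?x = "unfolding_mat n X"
  have GL: "X \<in> GL_loop n" and tnn: "totally_nonneg ?x"
    using X by (auto simp: GL_loop_nonneg_iff)
  obtain K where K1: "\<And>i j (r :: nat) c t. j \<ge> i + K \<Longrightarrow>
      (\<And>k. k \<ge> i \<Longrightarrow> (\<Sum>t<r. ?x k (j + int t) * c t) = 0) \<Longrightarrow> t < r \<Longrightarrow> c t = (0 :: real)"
    and K2: "\<And>i m (r :: nat) c t. i + int r + K \<le> m \<Longrightarrow>
      (\<And>l. l \<le> m \<Longrightarrow> (\<Sum>t<r. c t * ?x (i + int t) l) = 0) \<Longrightarrow> t < r \<Longrightarrow> c t = (0 :: real)"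
    using shifted_columns_rows_independent[OF n GL] by blast
  define K' where "K' = K + 1"
  have "\<exists>I J. finite I \<and> finite J \<and> card I = card J \<and>
      (\<forall>t<card I. sorted_list_of_set I ! t \<le> sorted_list_of_set J ! t - K') \<and> \<not> 0 < minor I J ?x"
    using not_tp X unfolding totally_positive_def by (metis uminus_add_conv_diff add.commute)
  then obtain I J where IJ: "finite I" "finite J" "card I = card J"
      "\<forall>t<card I. sorted_list_of_set I ! t \<le> sorted_list_of_set J ! t - K'" "\<not> 0 < minor I J ?x"
    by blast
  define Z where "Z = (\<lambda>m. \<exists>I J. far_right K' I J \<and> length I = m \<and> list_minor ?x I J = 0)"
  have "far_right K' (sorted_list_of_set I) (sorted_list_of_set J)"
    using IJ by (auto simp: far_right_def list_all2_conv_all_nth algebra_simps)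
  moreover from this have "list_minor ?x (sorted_list_of_set I) (sorted_list_of_set J) = 0"
    using IJ(5) totally_nonnegD[OF tnn, of "sorted_list_of_set I" "sorted_list_of_set J"]
    by (auto simp: minor_eq_list_minor far_right_def dest: list_all2_lengthD)
  ultimately have "Z (card I)"
    unfolding Z_def
    by (intro exI[of _ "sorted_list_of_set I"] exI[of _ "sorted_list_of_set J"]) simp
  then have Z: "Z (LEAST m. Z m)" by (rule LeastI)
  have least: "\<not> Z m" if "m < (LEAST m. Z m)" for m
    using that by (rule not_less_Least)
  have "\<not> Z 0" by (auto simp: Z_def far_right_def)
  with Z obtain r where r: "(LEAST m. Z m) = Suc r" by (metis not0_implies_Suc)
  have pos: "0 < list_minor ?x I J" if "far_right K' I J" "length I = r" for I J
  proof -
    have "\<not> Z r" using least r by simp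
    then have "list_minor ?x I J \<noteq> 0" using that by (auto simp: Z_def)
    then show ?thesis
      using totally_nonnegD[OF tnn, of I J] far_right_length[OF that(1)] that(1)
      by (auto simp: far_right_def)
  qed
  from Z r obtain I0 J0 where "far_right K' I0 J0" "length I0 = Suc r" "list_minor ?x I0 J0 = 0"
    by (auto simp: Z_def)
  from solid_vanishing_minor[OF tnn pos this] obtain i j where
    ij: "i + K' \<le> j" and zero: "list_minor ?x [i..i + int r] [j..j + int r] = 0" .
  have "corner_minors_vanish ?x r i (j - 1)"
  proof (rule vanishing_corner[where K = K])
    show "0 < list_minor ?x I J" if "far_right (K + 1) I J" "length I = r" for I J
      using pos that by (simp add: K'_def)
    show "c t = 0" if "j \<ge> i + K" "\<And>k. k \<ge> i \<Longrightarrow> (\<Sum>t<r. ?x k (j + int t) * c t) = 0" "t < r"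
      for i j c t and r :: nat
      using that by (rule K1)
    show "c t = 0" if "i + int r + K \<le> m" "\<And>l. l \<le> m \<Longrightarrow> (\<Sum>t<r. c t * ?x (i + int t) l) = 0" "t < r"
      for i m c t and r :: nat
      using that by (rule K2)
  qed (use tnn ij zero in \<open>simp_all add: K'_def\<close>)
  then show ?thesis by (rule that)
qed

section \<open>Splitting off a curl\<close>

text \<open>
  The properties of unfoldings of totally nonnegative invertible matrices on which the
  factorization rests; invertibility enters as the absence of zero rows and columns.
\<close>

locale tnn_unfolding =
  fixes n :: nat and x :: infmat
  assumes n: "n \<ge> 1"
    and tnn: "totally_nonneg x"
    and periodic: "x (i + int n) (j + int n) = x i j"
    and lower_bound: "\<exists>B. \<forall>i j. j < i - B \<longrightarrow> x i j = 0"
    and nonzero_row: "\<exists>j. x i j \<noteq> 0"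
    and nonzero_column: "\<exists>i. x i j \<noteq> 0"
begin

lemma nonneg: "0 \<le> x i j"
  by (rule totally_nonneg_entry[OF tnn])

lemma pos_iff: "0 < x i j \<longleftrightarrow> x i j \<noteq> 0"
  using nonneg[of i j] by linarith

lemma periodic_multiple: "x (i + q * int n) (j + q * int n) = x i j"
proof (induction q rule: int_induct[where k = 0])
  case (step1 q)
  then show ?case
    using periodic[of "i + q * int n" "j + q * int n"] by (simp add: algebra_simps)
next
  case (step2 q)
  then show ?case
    using periodic[of "i + (q - 1) * int n" "j + (q - 1) * int n"] by (simp add: algebra_simps)
qed simp

definition unbounded :: bool where
  "unbounded \<longleftrightarrow> (\<forall>i L. \<exists>l\<ge>L. x i l \<noteq> 0)"

text \<open>
  If row \<open>k\<close> ends before column \<open>L\<close>, so do all rows above it: an entry of a higher row in column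
  \<open>\<ge> L\<close> would make a \<open>2 \<times> 2\<close> minor negative. Periodicity carries the bound along the diagonal.
\<close>

lemma bounded_imp_band:
  assumes "\<not> unbounded"
  obtains C where "\<And>i j. j > i + C \<Longrightarrow> x i j = 0"
proof -
  obtain k L where kL: "\<And>l. l \<ge> L \<Longrightarrow> x k l = 0"
    using assms unfolding unbounded_def by blast
  have above: "x i l = 0" if "i \<le> k" "l \<ge> L" for i l
  proof (cases "i = k")
    case False
    obtain m where m: "x k m \<noteq> 0" using nonzero_row by blast
    then have "m < l" using kL[of m] that by (meson not_le order_trans)
    then have "x i l * x k m \<le> x i m * x k l"
      using totally_nonneg_minor2[OF tnn, of i k m l] that False by simp
    then have "x i l * x k m \<le> 0" using kL that by simp
    moreover have "0 < x k m" using m pos_iff by simp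
    ultimately show ?thesis using nonneg[of i l] by (simp add: mult_le_0_iff)
  qed (use kL that in auto)
  show ?thesis
  proof (rule that[of "L - k + int n"])
    fix i j assume ij: "j > i + (L - k + int n)"
    define q where "q = - ((k - i) div int n)"
    have "(k - i) div int n * int n \<le> k - i" "k - i < (k - i) div int n * int n + int n"
      using n div_mult_mod_eq[of "k - i" "int n"] pos_mod_bound[of "int n" "k - i"]
        pos_mod_sign[of "int n" "k - i"] by linarith+
    then have "i - q * int n \<le> k" "k < i - q * int n + int n" by (simp_all add: q_def)
    then have "x (i - q * int n) (j - q * int n) = 0"
      using ij by (intro above) linarith+
    then show "x i j = 0"
      using periodic_multiple[of "i - q * int n" q "j - q * int n"] by simp
  qed
qed

end

locale unbounded_tnn_unfolding = tnn_unfolding +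
  assumes unbounded: unbounded
begin

text \<open>
  A zero between two nonzero entries of a row would force, through \<open>2 \<times> 2\<close> minors, zeros in its
  column both above and below, hence a zero column.
\<close>

lemma eventually_positive:
  obtains L where "\<And>l. l \<ge> L \<Longrightarrow> 0 < x i l"
proof -
  obtain l0 where l0: "x i l0 \<noteq> 0" using nonzero_row by blast
  have "x i l \<noteq> 0" if l: "l > l0" for l
  proof
    assume zero: "x i l = 0"
    obtain l' where l': "l' \<ge> l" "x i l' \<noteq> 0" using unbounded unfolding unbounded_def by blast
    then have "l' > l" using zero by (cases "l' = l") auto
    obtain k where k: "x k l \<noteq> 0" using nonzero_column by blast
    then consider "k < i" | "i < k" using zero by (cases k i rule: linorder_cases) auto
    then show False
    proof cases
      case 1
      then have "x k l * x i l0 \<le> 0"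
        using totally_nonneg_minor2[OF tnn, of k i l0 l] l zero by simp
      then show False using l0 k pos_iff[of k l] pos_iff[of i l0] by (simp add: mult_le_0_iff)
    next
      case 2
      then have "x i l' * x k l \<le> 0"
        using totally_nonneg_minor2[OF tnn, of i k l l'] \<open>l' > l\<close> zero by simp
      then show False using l' k pos_iff[of k l] pos_iff[of i l'] by (simp add: mult_le_0_iff)
    qed
  qed
  then show ?thesis
    using that[of "l0 + 1"] pos_iff by simp
qed

lemma eventually_positive_sequentially: "eventually (\<lambda>k. 0 < x i (int k)) sequentially"
proof -
  obtain L where L: "\<And>l. l \<ge> L \<Longrightarrow> 0 < x i l" using eventually_positive[of i] by blast
  show ?thesis
    by (rule eventually_sequentiallyI[of "nat L"]) (use L in auto)
qed

lemma ratio_convergent: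
  assumes "i \<le> k"
  shows "convergent (\<lambda>l. x i (int l) / x k (int l))"
proof (cases "i = k")
  case True
  have "eventually (\<lambda>l. x i (int l) / x k (int l) = 1) sequentially"
    by (rule eventually_mono[OF eventually_positive_sequentially[of i]]) (use True in auto)
  then have "(\<lambda>l. x i (int l) / x k (int l)) \<longlonglongrightarrow> 1"
    by (rule tendsto_eventually)
  then show ?thesis by (auto simp: convergent_def)
next
  case False
  obtain L where L: "\<And>l. l \<ge> L \<Longrightarrow> 0 < x k l" using eventually_positive[of k] by blast
  define f where "f = (\<lambda>l. x i (int (l + nat L)) / x k (int (l + nat L)))"
  have "decseq f"
  proof (rule decseq_SucI)
    fix l
    let ?m = "int (l + nat L)"
    have "x i (?m + 1) * x k ?m \<le> x i ?m * x k (?m + 1)"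
      by (rule totally_nonneg_minor2[OF tnn]) (use assms False in auto)
    moreover have "0 < x k ?m" "0 < x k (?m + 1)" using L by auto
    moreover have "int (Suc l + nat L) = ?m + 1" by simp
    ultimately show "f (Suc l) \<le> f l"
      unfolding f_def by (simp only:) (simp add: divide_simps mult_ac)
  qed
  moreover have "0 \<le> f l" for l by (simp add: f_def nonneg)
  ultimately obtain v where "f \<longlonglongrightarrow> v" using decseq_convergent[of f 0] by blast
  then have "(\<lambda>l. x i (int l) / x k (int l)) \<longlonglongrightarrow> v"
    unfolding f_def by (rule LIMSEQ_offset)
  then show ?thesis by (auto simp: convergent_def)
qed

definition end_ratio :: "int \<Rightarrow> int \<Rightarrow> real" where
  "end_ratio i k = lim (\<lambda>l. x i (int l) / x k (int l))"

lemma end_ratio_limit: "i \<le> k \<Longrightarrow> (\<lambda>l. x i (int l) / x k (int l)) \<longlonglongrightarrow> end_ratio i k"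
  unfolding end_ratio_def using ratio_convergent convergent_LIMSEQ_iff by blast

lemma end_ratio_nonneg: "i \<le> k \<Longrightarrow> 0 \<le> end_ratio i k"
  by (rule LIMSEQ_le_const[OF end_ratio_limit]) (auto simp: nonneg)

lemma end_ratio_self: "end_ratio i i = 1"
proof -
  have "eventually (\<lambda>l. x i (int l) / x i (int l) = 1) sequentially"
    by (rule eventually_mono[OF eventually_positive_sequentially[of i]]) auto
  then have "(\<lambda>l. x i (int l) / x i (int l)) \<longlonglongrightarrow> 1"
    by (rule tendsto_eventually)
  then show ?thesis using LIMSEQ_unique end_ratio_limit[of i i] by blast
qed

lemma end_ratio_mult:
  assumes "i \<le> k" "k \<le> m"
  shows "end_ratio i m = end_ratio i k * end_ratio k m"
proof -
  have "(\<lambda>l. (x i (int l) / x k (int l)) * (x k (int l) / x m (int l))) \<longlonglongrightarrow>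
      end_ratio i k * end_ratio k m"
    by (intro tendsto_mult end_ratio_limit assms)
  then have "(\<lambda>l. x i (int l) / x m (int l)) \<longlonglongrightarrow> end_ratio i k * end_ratio k m"
    by (rule Lim_transform_eventually)
      (rule eventually_mono[OF eventually_positive_sequentially[of k]], auto)
  then show ?thesis using LIMSEQ_unique end_ratio_limit assms by (meson order_trans)
qed

lemma end_ratio_periodic:
  assumes "i \<le> k"
  shows "end_ratio (i + int n) (k + int n) = end_ratio i k"
proof -
  have "(\<lambda>l. x (i + int n) (int (l + n)) / x (k + int n) (int (l + n))) \<longlonglongrightarrow>
      end_ratio (i + int n) (k + int n)"
    using LIMSEQ_ignore_initial_segment[OF end_ratio_limit[of "i + int n" "k + int n"], of n] assms
    by simp
  then have "(\<lambda>l. x i (int l) / x k (int l)) \<longlonglongrightarrow> end_ratio (i + int n) (k + int n)"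
    by (simp add: periodic)
  then show ?thesis using LIMSEQ_unique end_ratio_limit[OF assms] by blast
qed

text \<open>
  The product of the whirl with parameters \<open>- end_ratio i (i + 1)\<close> and \<open>x\<close>.
\<close>

definition peeled :: infmat where
  "peeled i j = x i j - end_ratio i (i + 1) * x (i + 1) j"

text \<open>
  In the rows from \<open>lo\<close> on and the columns up to \<open>l\<close>, column \<open>l\<close> is the last one and can be cleared
  from the top downwards; row \<open>i + 1\<close> is still the original one when it is subtracted from row \<open>i\<close>.
\<close>

lemma peeled_window:
  assumes "\<And>i. lo < i \<Longrightarrow> i \<le> lo + int k \<Longrightarrow> 0 < x i l"
  shows "totally_nonneg (\<lambda>i j. if lo \<le> i \<and> j \<le> l then
    (if i < lo + int k then x i j - x i l / x (i + 1) l * x (i + 1) j else x i j) else 0)"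
  using assms
proof (induction k)
  case 0
  have "totally_nonneg (\<lambda>i j. if i \<in> {lo..} \<and> j \<in> {..l} then x i j else 0)"
    by (rule totally_nonneg_restrict[OF tnn])
  moreover have "(\<lambda>i j. if i \<in> {lo..} \<and> j \<in> {..l} then x i j else 0) =
    (\<lambda>i j. if lo \<le> i \<and> j \<le> l then
    (if i < lo + int 0 then x i j - x i l / x (i + 1) l * x (i + 1) j else x i j) else 0)"
    by (intro ext) auto
  ultimately show ?case by simp
next
  case (Suc k)
  let ?y = "\<lambda>k i j. if lo \<le> i \<and> j \<le> l then
    (if i < lo + int k then x i j - x i l / x (i + 1) l * x (i + 1) j else x i j) else 0"
  let ?i = "lo + int k"
  have "totally_nonneg (subtract_row ?i (?y k ?i l / ?y k (?i + 1) l) (?y k))"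
  proof (rule whitney_reduction)
    show "totally_nonneg (?y k)" using Suc by simp
    show "?y k i l = 0" if "i < ?i" for i
      using Suc.prems[of "i + 1"] that by auto
    show "0 < ?y k (?i + 1) l" using Suc.prems[of "?i + 1"] by simp
  qed auto
  moreover have "subtract_row ?i (?y k ?i l / ?y k (?i + 1) l) (?y k) = ?y (Suc k)"
    by (intro ext) (auto simp: subtract_row_def)
  ultimately show ?case by simp
qed

lemma peeled_tnn: "totally_nonneg peeled"
proof (rule totally_nonneg_limit[where F = sequentially])
  let ?y = "\<lambda>k i j. x i j - x i (int k) / x (i + 1) (int k) * x (i + 1) j"
  show "(\<lambda>k. ?y k i j) \<longlonglongrightarrow> peeled i j" for i j
    unfolding peeled_def by (intro tendsto_intros end_ratio_limit) simp
  fix I J :: "int list"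
  assume IJ: "length I = length J" "sorted_wrt (<) I" "sorted_wrt (<) J"
  obtain lo where lo: "\<And>i. i \<in> set I \<Longrightarrow> lo \<le> i"
    using finite_set[of I] by (metis Min_le)
  define hi where "hi = Max (insert lo (set I)) + 1"
  have max: "k < hi" if "k \<in> insert lo (set I)" for k
    using Max_ge[of "insert lo (set I)" k] that by (simp add: hi_def)
  then have "lo \<le> hi" by (simp add: less_imp_le)
  have hi: "i < hi" if "i \<in> set I" for i
    using max that by simp
  obtain c where c: "\<And>j. j \<in> set J \<Longrightarrow> j \<le> c"
    using finite_set[of J] by (metis Max_ge)
  have "eventually (\<lambda>k. \<forall>i\<in>{lo..hi}. 0 < x i (int k)) sequentially"
    by (intro eventually_ball_finite ballI eventually_positive_sequentially) simp
  moreover have "eventually (\<lambda>k. c \<le> int k) sequentially"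
    by (rule eventually_sequentiallyI[of "nat c"]) auto
  ultimately show "eventually (\<lambda>k. 0 \<le> list_minor (?y k) I J) sequentially"
  proof eventually_elim
    case (elim k)
    let ?z = "\<lambda>i j. if lo \<le> i \<and> j \<le> int k then (if i < lo + int (nat (hi - lo))
      then x i j - x i (int k) / x (i + 1) (int k) * x (i + 1) j else x i j) else 0"
    have "totally_nonneg ?z"
      by (rule peeled_window) (use elim \<open>lo \<le> hi\<close> in auto)
    then have "0 \<le> list_minor ?z I J" by (rule totally_nonnegD[OF _ IJ])
    also have "list_minor ?z I J = list_minor (?y k) I J"
    proof (rule list_minor_cong[OF IJ(1)])
      fix i j assume "i \<in> set I" "j \<in> set J"
      then have "lo \<le> i" "i < hi" "j \<le> int k" using lo hi c elim by force+
      then show "?z i j = ?y k i j" by simp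
    qed
    finally show ?case .
  qed
qed simp

text \<open>
  On the corner every column is a combination of the columns of coefficients \<open>\<beta>\<close>. The normalised
  columns converge to \<open>v\<close>, which is therefore such a combination too, with coefficients \<open>v (\<rho> ! t)\<close>
  that are not all zero because \<open>v r = 1\<close>. Peeling annihilates \<open>v\<close>, and this linear relation among
  the peeled coefficient columns \<open>\<delta>\<close> makes one of the \<open>h + 1\<close> terms superfluous.
\<close>

lemma peeled_corner:
  assumes van: "corner_minors_vanish x (Suc h) r c"
    and not_van: "\<not> corner_minors_vanish x h r c"
  shows "corner_minors_vanish peeled h (r - 1) c"
proof -
  let ?N = "Suc h"
  obtain \<rho> \<sigma> where len: "length \<rho> = ?N" "length \<sigma> = ?N"
    and block: "\<And>i. i \<in> set \<rho> \<Longrightarrow> i \<le> r" "\<And>j. j \<in> set \<sigma> \<Longrightarrow> c < j"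
    and nz: "list_minor x \<rho> \<sigma> \<noteq> 0"
    using not_van unfolding corner_minors_vanish_def by blast
  define \<beta> where "\<beta> = (\<lambda>i t. (-1) ^ t * list_minor x (i # delete_nth t \<rho>) \<sigma> / list_minor x \<rho> \<sigma>)"
  have rep: "x i l = (\<Sum>t<?N. \<beta> i t * x (\<rho> ! t) l)" if "i \<le> r" "c < l" for i l
  proof -
    have "0 = list_minor x (i # \<rho>) (l # \<sigma>)"
      using van that len block unfolding corner_minors_vanish_def by simp
    also have "\<dots> = (\<Sum>t<Suc ?N. (-1) ^ t * x ((i # \<rho>) ! t) l * list_minor x (delete_nth t (i # \<rho>)) \<sigma>)"
      using list_minor_expand_column[of "i # \<rho>" "[]" \<sigma> x l] len by simp
    also have "\<dots> = x i l * list_minor x \<rho> \<sigma> -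
        (\<Sum>t<?N. (-1) ^ t * x (\<rho> ! t) l * list_minor x (i # delete_nth t \<rho>) \<sigma>)"
      by (subst sum.lessThan_Suc_shift) (simp add: sum_negf del: sum.lessThan_Suc)
    finally have "x i l = (\<Sum>t<?N. (-1) ^ t * x (\<rho> ! t) l * list_minor x (i # delete_nth t \<rho>) \<sigma>)
        / list_minor x \<rho> \<sigma>"
      using nz by (simp add: field_simps del: sum.lessThan_Suc)
    also have "\<dots> = (\<Sum>t<?N. \<beta> i t * x (\<rho> ! t) l)"
      unfolding sum_divide_distrib by (intro sum.cong) (auto simp: \<beta>_def)
    finally show ?thesis .
  qed
  define v where "v = (\<lambda>i. end_ratio i r)"
  have \<rho>_le: "\<rho> ! t \<le> r" if "t < ?N" for t
    using block len that by simp
  have v_rep: "v i = (\<Sum>t<?N. \<beta> i t * v (\<rho> ! t))" if i: "i \<le> r" for i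
  proof -
    have "(\<lambda>l. \<Sum>t<?N. \<beta> i t * (x (\<rho> ! t) (int l) / x r (int l))) \<longlonglongrightarrow> (\<Sum>t<?N. \<beta> i t * v (\<rho> ! t))"
      unfolding v_def by (intro tendsto_intros end_ratio_limit \<rho>_le) simp
    moreover have "eventually (\<lambda>l. (\<Sum>t<?N. \<beta> i t * (x (\<rho> ! t) (int l) / x r (int l))) =
        x i (int l) / x r (int l)) sequentially"
    proof (rule eventually_sequentiallyI[of "nat (c + 1)"])
      fix l assume "nat (c + 1) \<le> l"
      then have "c < int l" by simp
      then show "(\<Sum>t<?N. \<beta> i t * (x (\<rho> ! t) (int l) / x r (int l))) = x i (int l) / x r (int l)"
        using rep[OF i] by (simp add: sum_divide_distrib del: sum.lessThan_Suc)
    qed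
    ultimately have "(\<lambda>l. x i (int l) / x r (int l)) \<longlonglongrightarrow> (\<Sum>t<?N. \<beta> i t * v (\<rho> ! t))"
      by (rule Lim_transform_eventually)
    then show ?thesis unfolding v_def using end_ratio_limit[OF i] LIMSEQ_unique by blast
  qed
  have "\<exists>t<?N. v (\<rho> ! t) \<noteq> 0"
  proof (rule ccontr)
    assume "\<not> ?thesis"
    then have "v r = 0" by (subst v_rep) auto
    then show False by (simp add: v_def end_ratio_self)
  qed
  then obtain t0 where t0: "t0 < ?N" "v (\<rho> ! t0) \<noteq> 0" by blast
  let ?S = "{..<?N} - {t0}"
  define \<delta> where "\<delta> = (\<lambda>t i. \<beta> i t - end_ratio i (i + 1) * \<beta> (i + 1) t)"
  define w where "w = (\<lambda>t l. x (\<rho> ! t) l - v (\<rho> ! t) / v (\<rho> ! t0) * x (\<rho> ! t0) l)"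
  show ?thesis
  proof (rule corner_minors_vanishI[of ?S _ _ _ _ \<delta> w])
    fix i l assume il: "i \<le> r - 1" "c < l"
    have "(\<Sum>t<?N. \<delta> t i * v (\<rho> ! t)) = v i - end_ratio i (i + 1) * v (i + 1)"
      using v_rep[of i] v_rep[of "i + 1"] il
      by (simp add: \<delta>_def sum_subtractf sum_distrib_left algebra_simps del: sum.lessThan_Suc)
    also have "\<dots> = 0" using end_ratio_mult[of i "i + 1" r] il by (simp add: v_def)
    finally have kernel: "(\<Sum>t<?N. \<delta> t i * v (\<rho> ! t)) = 0" .
    have "(\<Sum>t\<in>?S. \<delta> t i * w t l) = (\<Sum>t<?N. \<delta> t i * w t l)"
      by (rule sum.mono_neutral_left) (use t0 in \<open>auto simp: w_def\<close>)
    also have "\<dots> = (\<Sum>t<?N. \<delta> t i * x (\<rho> ! t) l) -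
        (\<Sum>t<?N. \<delta> t i * v (\<rho> ! t)) * (x (\<rho> ! t0) l / v (\<rho> ! t0))"
    proof -
      have "\<delta> t i * w t l =
          \<delta> t i * x (\<rho> ! t) l - \<delta> t i * v (\<rho> ! t) * (x (\<rho> ! t0) l / v (\<rho> ! t0))" for t
        by (simp add: w_def right_diff_distrib)
      then show ?thesis by (simp only: sum_subtractf sum_distrib_right)
    qed
    also have "\<dots> = (\<Sum>t<?N. \<delta> t i * x (\<rho> ! t) l)"
      unfolding kernel by simp
    also have "\<dots> = peeled i l"
      using rep[of i l] rep[of "i + 1" l] il
      by (simp add: peeled_def \<delta>_def sum_subtractf sum_distrib_left algebra_simps del: sum.lessThan_Suc)
    finally show "peeled i l = (\<Sum>t\<in>?S. \<delta> t i * w t l)" by simp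
  qed (use t0 in auto)
qed

end

lemma GL_loop_nonneg_tnn_unfolding:
  assumes n: "n \<ge> 1" and X: "X \<in> GL_loop_nonneg n"
  shows "tnn_unfolding n (unfolding_mat n X)"
proof
  let ?x = "unfolding_mat n X"
  have GL: "X \<in> GL_loop n" and "totally_nonneg ?x"
    using X by (auto simp: GL_loop_nonneg_iff)
  then show "totally_nonneg ?x" by simp
  obtain K where K1: "\<And>i j (r :: nat) c t. j \<ge> i + K \<Longrightarrow>
      (\<And>k. k \<ge> i \<Longrightarrow> (\<Sum>t<r. ?x k (j + int t) * c t) = 0) \<Longrightarrow> t < r \<Longrightarrow> c t = (0 :: real)"
    and K2: "\<And>i m (r :: nat) c t. i + int r + K \<le> m \<Longrightarrow>
      (\<And>l. l \<le> m \<Longrightarrow> (\<Sum>t<r. c t * ?x (i + int t) l) = 0) \<Longrightarrow> t < r \<Longrightarrow> c t = (0 :: real)"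
    using shifted_columns_rows_independent[OF n GL] by blast
  show "\<exists>j. ?x i j \<noteq> 0" for i
  proof (rule ccontr)
    assume "\<not> ?thesis"
    then show False
      using K2[where i = i and r = 1 and m = "i + 1 + K" and c = "\<lambda>_. 1" and t = 0] by simp
  qed
  show "\<exists>i. ?x i j \<noteq> 0" for j
  proof (rule ccontr)
    assume "\<not> ?thesis"
    then show False
      using K1[where i = "j - K" and j = j and r = 1 and c = "\<lambda>_. 1" and t = 0] by simp
  qed
  show "\<exists>B. \<forall>i j. j < i - B \<longrightarrow> ?x i j = 0"
    using unfolding_lower_bound[OF n, of X] by metis
qed (use n unfolding_periodic in auto)

lemma cyc_eq:
  assumes n: "n \<ge> 1" and per: "\<And>i. f (i + int n) = f i"
  shows "cyc n (\<lambda>m. f (int m)) i = f i"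
proof -
  have per_int: "f (k + q * int n) = f k" for k q
  proof (induction q rule: int_induct[where k = 0])
    case (step1 q)
    then show ?case using per[of "k + q * int n"] by (simp add: algebra_simps)
  next
    case (step2 q)
    then show ?case using per[of "k + (q - 1) * int n"] by (simp add: algebra_simps)
  qed simp
  have "cyc n (\<lambda>m. f (int m)) i = f ((i - 1) mod int n + 1)"
    using n by (simp add: cyc_def add.commute)
  also have "\<dots> = f ((i - 1) mod int n + 1 + (i - 1) div int n * int n)"
    by (rule per_int[symmetric])
  also have "(i - 1) mod int n + 1 + (i - 1) div int n * int n = i"
    using div_mult_mod_eq[of "i - 1" "int n"] by linarith
  finally show ?thesis .
qed

lemma cyc_uminus: "cyc n (\<lambda>m. - a m) i = - cyc n a i"
  by (simp add: cyc_def)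

lemma unfolding_whirl_mult:
  assumes n: "n \<ge> 1" and X: "X \<in> carrier_mat n n"
  shows "unfolding_mat n (folding_mat n (whirl n a) * X) i j =
    unfolding_mat n X i j + cyc n a i * unfolding_mat n X (i + 1) j"
  by (subst unfolding_mult_two_terms[OF n folding_carrier X, of i "i + 1"])
    (simp_all add: unfolding_generators[OF n] whirl_def)

text \<open>
  The entries of the curl satisfy \<open>N i j = a\<^sub>i N (i + 1) j\<close> for \<open>i < j\<close>, so the product in the opposite
  order is the identity; for square matrices over a field a one-sided inverse is two-sided.
\<close>

lemma curl_whirl_inverse:
  assumes n: "n \<ge> 1"
  shows "folding_mat n (curl n a) * folding_mat n (whirl n (\<lambda>m. - a m)) = 1\<^sub>m n"
proof (rule mat_mult_left_right_inverse[OF folding_carrier folding_carrier])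
  let ?M = "folding_mat n (whirl n (\<lambda>m. - a m))" and ?N = "folding_mat n (curl n a)"
  show "?M * ?N = 1\<^sub>m n"
  proof (rule unfolding_inject[of _ n])
    show "unfolding_mat n (?M * ?N) = unfolding_mat n (1\<^sub>m n)"
    proof (intro ext)
      fix i j :: int
      have "i < j \<Longrightarrow> {i..<j} = insert i {i + 1..<j}" by auto
      then have "curl n a i j - cyc n a i * curl n a (i + 1) j = (if i = j then 1 else 0)"
        by (cases i j rule: linorder_cases) (simp_all add: curl_def)
      then show "unfolding_mat n (?M * ?N) i j = unfolding_mat n (1\<^sub>m n) i j"
        by (simp add: unfolding_whirl_mult[OF n] unfolding_generators[OF n] unfolding_one[OF n] cyc_uminus)
    qed
  qed (auto intro: mult_carrier_mat[of _ _ n])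
qed

lemma peel_curl:
  assumes n: "n \<ge> 1" and X: "X \<in> GL_loop_nonneg n"
    and unbounded: "tnn_unfolding.unbounded (unfolding_mat n X)"
    and van: "corner_minors_vanish (unfolding_mat n X) (Suc h) r c"
    and not_van: "\<not> corner_minors_vanish (unfolding_mat n X) h r c"
  obtains N X' where "N \<in> curls n" "X' \<in> GL_loop_nonneg n" "X = N * X'"
    "corner_minors_vanish (unfolding_mat n X') h (r - 1) c"
proof -
  interpret tnn_unfolding n "unfolding_mat n X"
    by (rule GL_loop_nonneg_tnn_unfolding[OF n X])
  interpret unbounded_tnn_unfolding n "unfolding_mat n X"
    by unfold_locales (rule unbounded)
  define a where "a = (\<lambda>m :: nat. end_ratio (int m) (int m + 1))"
  let ?N = "folding_mat n (curl n a)" and ?M = "folding_mat n (whirl n (\<lambda>m. - a m))"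
  define X' where "X' = ?M * X"
  have Xc: "X \<in> GL_loop n" "X \<in> carrier_mat n n" using X by (auto simp: GL_loop_nonneg_iff GL_loop_def)
  have X'c: "X' \<in> carrier_mat n n"
    unfolding X'_def by (rule mult_carrier_mat[OF folding_carrier Xc(2)])
  have cyc_a: "cyc n a i = end_ratio i (i + 1)" for i
    unfolding a_def
    by (rule cyc_eq[OF n, where f = "\<lambda>i. end_ratio i (i + 1)"])
      (use end_ratio_periodic[of i "i + 1" for i] in \<open>simp add: algebra_simps\<close>)
  have X_eq: "X = ?N * X'"
    using curl_whirl_inverse[OF n, of a] Xc
      assoc_mult_mat[OF folding_carrier folding_carrier Xc(2), of "curl n a" "whirl n (\<lambda>m. - a m)"]
    by (simp add: X'_def)
  have peel: "unfolding_mat n X' = peeled"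
    by (intro ext) (simp add: X'_def unfolding_whirl_mult[OF n Xc(2)] cyc_uminus cyc_a peeled_def)
  have "X' \<in> GL_loop n"
    by (rule GL_loop_right_factor[of ?N]) (use X_eq Xc X'c in auto)
  then have "X' \<in> GL_loop_nonneg n"
    using peeled_tnn by (simp add: GL_loop_nonneg_iff peel)
  moreover have "?N \<in> curls n"
    using end_ratio_nonneg by (auto simp: curls_def a_def)
  ultimately show ?thesis
    using that X_eq peeled_corner[OF van not_van] peel by metis
qed

section \<open>Periodic Whitney elimination\<close>

definition factorizable :: "nat \<Rightarrow> real fls mat \<Rightarrow> bool" where
  "factorizable n X \<longleftrightarrow> (\<exists>Ys. set Ys \<subseteq> generators n \<and> X = mat_product n Ys)"

lemma factorizable_mult: "G \<in> generators n \<Longrightarrow> factorizable n X \<Longrightarrow> factorizable n (G * X)"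
  unfolding factorizable_def
  by (metis insert_subset list.simps(15) mat_product_Cons)

lemma factorizable_generator: "G \<in> generators n \<Longrightarrow> factorizable n G"
  unfolding factorizable_def
  by (rule exI[of _ "[G]"]) (use right_mult_one_mat[OF generators_carrier, of G n] in auto)

lemma unfolding_chevalley_upper_mult:
  assumes n: "n \<ge> 1" and X: "X \<in> carrier_mat n n"
  shows "unfolding_mat n (folding_mat n (chevalley_upper n k a) * X) i j =
    unfolding_mat n X i j + (if [i = k] (mod int n) then a * unfolding_mat n X (i + 1) j else 0)"
  by (subst unfolding_mult_two_terms[OF n folding_carrier X, of i "i + 1"])
    (simp_all add: unfolding_generators[OF n] chevalley_upper_def)

lemma unfolding_chevalley_lower_mult:
  assumes n: "n \<ge> 1" and X: "X \<in> carrier_mat n n"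
  shows "unfolding_mat n (folding_mat n (chevalley_lower n k a) * X) i j =
    unfolding_mat n X i j + (if [i - 1 = k] (mod int n) then a * unfolding_mat n X (i - 1) j else 0)"
  by (subst unfolding_mult_two_terms[OF n folding_carrier X, of i "i - 1"])
    (simp_all add: unfolding_generators[OF n] chevalley_lower_def chevalley_upper_def)

text \<open>
  It suffices to exhibit the unfolding \<open>y\<close> of the quotient: membership in the general linear group
  follows from multiplicativity of the determinant.
\<close>

lemma split_off_left_factor:
  assumes n: "n \<ge> 1" and X: "X \<in> GL_loop_nonneg n" and G: "G \<in> carrier_mat n n"
    and per: "\<And>i j. y (i + int n) (j + int n) = y i j"
    and lower: "\<And>i j. j < i - B \<Longrightarrow> y i j = 0"
    and tnn: "totally_nonneg y"
    and eq: "unfolding_mat n (folding_mat n y) = y \<Longrightarrow>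
      unfolding_mat n (G * folding_mat n y) = unfolding_mat n X"
  shows "folding_mat n y \<in> GL_loop_nonneg n" "unfolding_mat n (folding_mat n y) = y"
    "X = G * folding_mat n y"
proof -
  show y: "unfolding_mat n (folding_mat n y) = y"
    by (rule unfolding_folding[where B = B]) (use n per lower in auto)
  have X': "X \<in> GL_loop n" "X \<in> carrier_mat n n"
    using X by (auto simp: GL_loop_nonneg_iff GL_loop_def)
  show X_eq: "X = G * folding_mat n y"
    by (rule unfolding_inject[of _ n]) (use X' G eq[OF y] mult_carrier_mat[OF G folding_carrier] in auto)
  have "folding_mat n y \<in> GL_loop n"
    by (rule GL_loop_right_factor[of G]) (use X_eq X' G in auto)
  then show "folding_mat n y \<in> GL_loop_nonneg n"
    using tnn y by (simp add: GL_loop_nonneg_iff)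
qed

text \<open>
  Left multiplication by the inverse of a Chevalley generator changes infinitely many rows, but a
  given minor meets only finitely many of them. These rows can be treated one after the other, in
  any order, because for \<open>n \<ge> 2\<close> the row that is subtracted is never itself modified.
\<close>

lemma periodic_whitney_reduction:
  assumes n: "n \<ge> 2" and tnn: "totally_nonneg x"
    and per: "\<And>i j q. x (i + q * int n) (j + q * int n) = x i j"
    and right: "\<And>k j. k \<le> p + 1 \<Longrightarrow> m < j \<Longrightarrow> x k j = 0"
    and above: "\<And>k. k < p \<Longrightarrow> x k m = 0"
    and pivot: "0 < x (p + 1) m"
  shows "totally_nonneg (\<lambda>i j. if [i = p] (mod int n)
    then x i j - x p m / x (p + 1) m * x (i + 1) j else x i j)"
proof -
  let ?c = "x p m / x (p + 1) m"
  let ?y = "\<lambda>Q i j. if \<exists>q\<in>Q. i = p + q * int n then x i j - ?c * x (i + 1) j else x i j"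
  have next_row: "p + q * int n + 1 \<noteq> p + q' * int n" for q q'
  proof
    assume "p + q * int n + 1 = p + q' * int n"
    then have "1 = (q' - q) * int n" by (simp add: algebra_simps)
    then have "int n dvd 1" by (metis dvd_triv_right)
    then show False using n by simp
  qed
  have per0: "x (p + q * int n + i) (m + q * int n + j) = x (p + i) (m + j)" for q i j
    using per[of "p + i" q "m + j"] by (simp add: algebra_simps)
  have finite_case: "totally_nonneg (?y Q)" if "finite Q" for Q
    using that
  proof (induction Q rule: finite_induct)
    case empty
    then show ?case using tnn by simp
  next
    case (insert q Q)
    let ?p = "p + q * int n" and ?m = "m + q * int n"
    have right': "x k j = 0" if "k \<le> ?p + 1" "?m < j" for k j
      using right[of "k - q * int n" "j - q * int n"] per[of "k - q * int n" q "j - q * int n"] that by simp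
    have above': "x k ?m = 0" if "k < ?p" for k
      using above[of "k - q * int n"] per[of "k - q * int n" q m] that by simp
    have row_p: "?y Q ?p j = x ?p j" for j
      using insert.hyps n by auto
    have row_p1: "?y Q (?p + 1) j = x (?p + 1) j" for j
      using next_row by auto
    have below_p: "k + 1 < ?p" if "k = p + q' * int n" "k < ?p" for k q'
      using next_row[of q' q] that by linarith
    have "totally_nonneg (subtract_row ?p (?y Q ?p ?m / ?y Q (?p + 1) ?m) (?y Q))"
    proof (rule whitney_reduction)
      show "?y Q k j = 0" if "k \<le> ?p + 1" "?m < j" for k j
        using that right'[of k j] right'[of "k + 1" j] next_row[of q] by (cases "k = ?p + 1") auto
      show "?y Q k ?m = 0" if "k < ?p" for k
        using that above'[of k] above'[of "k + 1"] below_p[of k] by auto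
      show "0 < ?y Q (?p + 1) ?m"
        unfolding row_p1 using pivot per0[of q 1 0] by simp
    qed (rule insert.IH)
    moreover have "?y Q ?p ?m / ?y Q (?p + 1) ?m = ?c"
      unfolding row_p row_p1 using per0[of q 0 0] per0[of q 1 0] by simp
    moreover have "subtract_row ?p ?c (?y Q) = ?y (insert q Q)"
    proof (intro ext)
      fix k j
      show "subtract_row ?p ?c (?y Q) k j = ?y (insert q Q) k j"
      proof (cases "k = ?p")
        case True
        have "subtract_row ?p ?c (?y Q) k j = ?y Q ?p j - ?c * ?y Q (?p + 1) j"
          unfolding subtract_row_def True by (rule if_P) (rule refl)
        also have "\<dots> = x ?p j - ?c * x (?p + 1) j"
          unfolding row_p row_p1 by (rule refl)
        finally show ?thesis using True by simp
      next
        case False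
        then have "subtract_row ?p ?c (?y Q) k j = ?y Q k j"
          unfolding subtract_row_def by (rule if_not_P)
        then show ?thesis using False by simp
      qed
    qed
    ultimately show ?case by simp
  qed
  show ?thesis
    unfolding totally_nonneg_def
  proof (intro allI impI)
    fix I J :: "int list"
    assume IJ: "length I = length J" "sorted_wrt (<) I" "sorted_wrt (<) J"
    define Q where "Q = (\<lambda>i. (i - p) div int n) ` set I"
    have "0 \<le> list_minor (?y Q) I J"
      by (rule totally_nonnegD[OF finite_case IJ]) (simp add: Q_def)
    also have "list_minor (?y Q) I J = list_minor (\<lambda>i j. if [i = p] (mod int n)
      then x i j - ?c * x (i + 1) j else x i j) I J"
    proof (rule list_minor_cong[OF IJ(1)])
      fix i j assume i: "i \<in> set I"
      have "(\<exists>q\<in>Q. i = p + q * int n) \<longleftrightarrow> [i = p] (mod int n)"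
      proof
        assume "[i = p] (mod int n)"
        then have "int n dvd i - p" by (simp add: cong_iff_dvd_diff)
        then have "i = p + (i - p) div int n * int n" by simp
        then show "\<exists>q\<in>Q. i = p + q * int n" using i by (auto simp: Q_def)
      qed (auto simp: cong_iff_dvd_diff)
      then show "?y Q i j = (if [i = p] (mod int n) then x i j - ?c * x (i + 1) j else x i j)"
        by simp
    qed
    finally show "0 \<le> list_minor (\<lambda>i j. if [i = p] (mod int n)
      then x i j - ?c * x (i + 1) j else x i j) I J" .
  qed
qed

lemma periodic_whitney_reduction_lower:
  assumes n: "n \<ge> 2" and tnn: "totally_nonneg x"
    and per: "\<And>i j q. x (i + q * int n) (j + q * int n) = x i j"
    and left: "\<And>k j. p \<le> k \<Longrightarrow> j < m \<Longrightarrow> x k j = 0"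
    and below: "\<And>k. p + 1 < k \<Longrightarrow> x k m = 0"
    and pivot: "0 < x p m"
  shows "totally_nonneg (\<lambda>i j. if [i - 1 = p] (mod int n)
    then x i j - x (p + 1) m / x p m * x (i - 1) j else x i j)"
proof -
  let ?z = "\<lambda>i j. x (- i) (- j)"
  let ?c = "x (p + 1) m / x p m"
  have "totally_nonneg (\<lambda>i j. if [i = - p - 1] (mod int n)
    then ?z i j - ?z (- p - 1) (- m) / ?z (- p - 1 + 1) (- m) * ?z (i + 1) j else ?z i j)"
  proof (rule periodic_whitney_reduction[OF n totally_nonneg_reverse[OF tnn]])
    show "?z (i + q * int n) (j + q * int n) = ?z i j" for i j q
      using per[of "- i" "- q" "- j"] by (simp add: algebra_simps)
  qed (use left below pivot in auto)
  from totally_nonneg_reverse[OF this]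
  moreover have "- (- p - 1) = p + 1" "- (- p - 1 + 1) = p" "\<And>i :: int. - (- i + 1) = i - 1"
    by simp_all
  ultimately have "totally_nonneg (\<lambda>i j. if [- i = - p - 1] (mod int n)
    then x i j - ?c * x (i - 1) j else x i j)"
    by (simp only: minus_minus)
  moreover have "[- i = - p - 1] (mod int n) \<longleftrightarrow> [i - 1 = p] (mod int n)" for i
  proof -
    have "- i - (- p - 1) = - (i - 1 - p)" by simp
    then show ?thesis unfolding cong_iff_dvd_diff by (simp only: dvd_minus_iff)
  qed
  ultimately show ?thesis by simp
qed

section \<open>The edges of a band\<close>

locale banded_tnn_unfolding = tnn_unfolding +
  assumes upper_bound: "\<exists>C. \<forall>i j. j > i + C \<longrightarrow> x i j = 0"
begin

definition top :: "int \<Rightarrow> int" where "top i = Max {j. x i j \<noteq> 0}"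
definition bot :: "int \<Rightarrow> int" where "bot i = Min {j. x i j \<noteq> 0}"

lemma finite_row: "finite {j. x i j \<noteq> 0}"
proof -
  obtain B C where "\<And>i j. j < i - B \<Longrightarrow> x i j = 0" "\<And>i j. j > i + C \<Longrightarrow> x i j = 0"
    using lower_bound upper_bound by metis
  then have "{j. x i j \<noteq> 0} \<subseteq> {i - B..i + C}" by (force simp: not_less[symmetric])
  then show ?thesis by (rule finite_subset) simp
qed

lemma row_nonempty: "{j. x i j \<noteq> 0} \<noteq> {}"
  using nonzero_row[of i] by auto

lemma top_pos: "0 < x i (top i)" and above_top: "top i < j \<Longrightarrow> x i j = 0"
  using Max_in[OF finite_row row_nonempty, of i] Max_ge[OF finite_row[of i], of j] pos_iff
  by (auto simp: top_def)

lemma bot_pos: "0 < x i (bot i)" and below_bot: "j < bot i \<Longrightarrow> x i j = 0"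
  using Min_in[OF finite_row row_nonempty, of i] Min_le[OF finite_row[of i], of j] pos_iff
  by (auto simp: bot_def)

lemma bot_le_top: "bot i \<le> top i"
  using above_top[of i "bot i"] bot_pos[of i] by force

text \<open>
  If a lower row ended earlier than a higher one, the \<open>2 \<times> 2\<close> minor on the two end columns would be
  negative.
\<close>

lemma top_mono: "i \<le> k \<Longrightarrow> top i \<le> top k"
proof (rule ccontr)
  assume ik: "i \<le> k" and "\<not> top i \<le> top k"
  then have lt: "top k < top i" "i < k" by (cases "i = k"; simp)+
  then have "x i (top i) * x k (top k) \<le> 0"
    using totally_nonneg_minor2[OF tnn, of i k "top k" "top i"] above_top[of k "top i"] by simp
  then show False using top_pos[of i] top_pos[of k] by (simp add: mult_le_0_iff)
qed

lemma bot_mono: "i \<le> k \<Longrightarrow> bot i \<le> bot k"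
proof (rule ccontr)
  assume ik: "i \<le> k" and "\<not> bot i \<le> bot k"
  then have lt: "bot k < bot i" "i < k" by (cases "i = k"; simp)+
  then have "x i (bot i) * x k (bot k) \<le> 0"
    using totally_nonneg_minor2[OF tnn, of i k "bot k" "bot i"] below_bot[of "bot k" i] by simp
  then show False using bot_pos[of i] bot_pos[of k] by (simp add: mult_le_0_iff)
qed

lemma row_shift: "{j. x (i + int n) j \<noteq> 0} = (\<lambda>j. j + int n) ` {j. x i j \<noteq> 0}"
proof -
  have "x (i + int n) j = x i (j - int n)" for j
    using periodic[of i "j - int n"] by simp
  then show ?thesis by (auto intro: image_eqI[of _ _ "j - int n" for j])
qed

lemma top_periodic: "top (i + int n) = top i + int n"
  unfolding top_def row_shift
  by (rule mono_Max_commute[symmetric]) (auto intro: monoI finite_row simp: row_nonempty[simplified])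

lemma bot_periodic: "bot (i + int n) = bot i + int n"
  unfolding bot_def row_shift
  by (rule mono_Min_commute[symmetric]) (auto intro: monoI finite_row simp: row_nonempty[simplified])

text \<open>
  The induction measure for bands. Every factor that is split off leaves a quotient whose entries
  are bounded by those of \<open>x\<close>, so the support can only shrink.
\<close>

definition support_size :: nat where
  "support_size = card (SIGMA i:{1..int n}. {j. x i j \<noteq> 0})"

lemma support_decreases:
  assumes z: "banded_tnn_unfolding n z"
    and le: "\<And>i j. z i j \<le> x i j" and lt: "x p m \<noteq> 0" "z p m = 0"
  shows "banded_tnn_unfolding.support_size n z < support_size"
proof -
  interpret z: banded_tnn_unfolding n z by (rule z)
  have sub: "z i j \<noteq> 0 \<Longrightarrow> x i j \<noteq> 0" for i j
    using le[of i j] z.nonneg[of i j] by linarith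
  define q where "q = (p - 1) div int n"
  have r: "p - q * int n \<in> {1..int n}"
    using n pos_mod_bound[of "int n" "p - 1"] pos_mod_sign[of "int n" "p - 1"]
      div_mult_mod_eq[of "p - 1" "int n"] unfolding q_def atLeastAtMost_iff by linarith
  have "x (p - q * int n) (m - q * int n) \<noteq> 0" "z (p - q * int n) (m - q * int n) = 0"
    using lt periodic_multiple[of "p - q * int n" q "m - q * int n"]
      z.periodic_multiple[of "p - q * int n" q "m - q * int n"] by simp_all
  then have "(SIGMA i:{1..int n}. {j. z i j \<noteq> 0}) \<subset> (SIGMA i:{1..int n}. {j. x i j \<noteq> 0})"
    using r sub by blast
  moreover have "finite (SIGMA i:{1..int n}. {j. x i j \<noteq> 0})"
    using finite_row by auto
  ultimately show ?thesis
    unfolding support_size_def z.support_size_def by (rule psubset_card_mono[rotated])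
qed

end

lemma strictly_increasing_periodic_int:
  fixes f :: "int \<Rightarrow> int"
  assumes n: "n \<ge> 1" and strict: "\<And>i. f i < f (i + 1)" and per: "\<And>i. f (i + int n) = f i + int n"
  shows "f i = i + f 0"
proof -
  have growth: "f i + int m \<le> f (i + int m)" for i m
  proof (induction m)
    case (Suc m)
    then show ?case using strict[of "i + int m"] by (simp add: algebra_simps)
  qed simp
  have step: "f (i + 1) = f i + 1" for i
  proof -
    have "f (i + 1) + int (n - 1) \<le> f (i + 1 + int (n - 1))" by (rule growth)
    also have "i + 1 + int (n - 1) = i + int n" using n by simp
    finally show ?thesis using per[of i] n strict[of i] by simp
  qed
  show ?thesis
  proof (induction i rule: int_induct[where k = 0])
    case (step1 i)
    then show ?case using step[of i] by simp
  next
    case (step2 i)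
    then show ?case using step[of "i - 1"] by simp
  qed simp
qed

text \<open>
  Whitney elimination of row \<open>q\<close> by row \<open>q + 1\<close> needs all higher rows to end earlier. A flat step of a
  periodic edge can be followed backwards until the edge jumps, which it must within one period.
\<close>

lemma jump_exists:
  fixes f :: "int \<Rightarrow> int"
  assumes n: "n \<ge> 1" and mono: "\<And>i. f i \<le> f (i + 1)" and per: "\<And>i. f (i + int n) = f i + int n"
    and flat: "f p = f (p + 1)"
  obtains q where "f (q - 1) < f q" "f q = f (q + 1)"
proof -
  have "\<exists>q. f (q - 1) < f q \<and> f q = f (q + 1)"
  proof (rule ccontr)
    assume none: "\<not> ?thesis"
    have "f (p - int m) = f p \<and> f (p - int m) = f (p - int m + 1)" for m
    proof (induction m)
      case (Suc m)
      then have "f (p - int m - 1) = f (p - int m)"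
        using none mono[of "p - int m - 1"] by (metis diff_add_cancel order_less_le)
      then show ?case using Suc by (simp add: algebra_simps)
    qed (use flat in simp)
    from this[of n] show False using per[of "p - int n"] n by simp
  qed
  then show ?thesis using that by blast
qed

section \<open>Splitting off a whirl\<close>

text \<open>
  A band whose edges are the two different diagonals \<open>j = i + d\<close> and \<open>j = i + c\<close>. A factorization
  \<open>x = M(a) y\<close> with \<open>y\<close> of smaller band width requires \<open>x i (i + c) = a\<^sub>i y (i + 1) (i + c)\<close>, where
  \<open>y i = x i - a\<^sub>i y (i + 1)\<close>: each parameter depends on all rows below. So the recursion is
  started at a row \<open>N + 1\<close>, with the columns beyond \<open>N + c\<close> cut off, and \<open>N\<close> tends to infinity. The
  parameters converge because they increase with \<open>N\<close>; only in the limit are they periodic.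
\<close>

locale strict_band_unfolding = tnn_unfolding +
  fixes c d :: int
  assumes band: "x i j \<noteq> 0 \<Longrightarrow> i + d \<le> j \<and> j \<le> i + c"
    and upper_pos: "0 < x i (i + c)"
    and lower_pos: "0 < x i (i + d)"
    and dc: "d < c"
begin

text \<open>
  The first \<open>k\<close> steps of Whitney elimination, upwards from row \<open>N\<close>; step \<open>k\<close> clears the upper edge of
  row \<open>N - k\<close> by means of the row below it, which has already lost its own edge entry.
\<close>

primrec reduce :: "int \<Rightarrow> nat \<Rightarrow> infmat" where
  "reduce N 0 = (\<lambda>i j. if j \<le> N + c then x i j else 0)"
| "reduce N (Suc k) = subtract_row (N - int k)
    (reduce N k (N - int k) (N - int k + c) / reduce N k (N - int k + 1) (N - int k + c)) (reduce N k)"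

text \<open>
  The pivot cannot vanish: row \<open>N - k\<close> still has its edge entry in the same column while the row
  below keeps its entry on the lower edge, so the \<open>2 \<times> 2\<close> minor on these columns would be negative.
  If \<open>c = d + 1\<close>, the pivot is that entry of the lower edge itself.
\<close>

lemma reduce_invariant:
  "totally_nonneg (reduce N k) \<and> (\<forall>i j. reduce N k i j \<le> x i j) \<and>
    (\<forall>i j. i \<le> N - int k \<longrightarrow> reduce N k i j = x i j) \<and>
    (\<forall>i. i \<le> N + 1 \<longrightarrow> reduce N k i (i + d) = x i (i + d)) \<and>
    (\<forall>i. N - int k < i \<longrightarrow> i \<le> N + 1 \<longrightarrow> reduce N k i (i + c) = 0) \<and>
    0 < reduce N k (N - int k + 1) (N - int k + c)"
  (is "?tnn k \<and> ?le k \<and> ?unchanged k \<and> ?lower k \<and> ?eliminated k \<and> ?pivot k")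
proof -
  have pivot: "?pivot k" if "?tnn k" "?unchanged k" "?lower k" for k
  proof (cases "d + 1 = c")
    case True
    then have "N - int k + c = N - int k + 1 + d" by simp
    moreover have "reduce N k (N - int k + 1) (N - int k + 1 + d) = x (N - int k + 1) (N - int k + 1 + d)"
      using that(3) by simp
    ultimately show ?thesis by (simp only: lower_pos)
  next
    case False
    let ?i = "N - int k" and ?y = "reduce N k"
    have "?y ?i (?i + c) * ?y (?i + 1) (?i + 1 + d) \<le> ?y ?i (?i + 1 + d) * ?y (?i + 1) (?i + c)"
      by (rule totally_nonneg_minor2) (use that dc False in auto)
    moreover have "0 < ?y ?i (?i + c)" "0 < ?y (?i + 1) (?i + 1 + d)"
      using that upper_pos lower_pos by simp_all
    ultimately have "0 < ?y ?i (?i + 1 + d) * ?y (?i + 1) (?i + c)"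
      by (meson mult_pos_pos order_less_le_trans)
    then show ?thesis
      using totally_nonneg_entry[of ?y] that by (metis mult_not_zero order_less_le)
  qed
  have main: "?tnn k \<and> ?le k \<and> ?unchanged k \<and> ?lower k \<and> ?eliminated k"
  proof (induction k)
    case 0
    have "totally_nonneg (\<lambda>i j. if i \<in> UNIV \<and> j \<in> {..N + c} then x i j else 0)"
      by (rule totally_nonneg_restrict[OF tnn])
    then have "?tnn 0" by simp
    moreover have "?le 0" using nonneg by simp
    moreover have "?unchanged 0"
    proof (intro allI impI)
      fix i j assume "i \<le> N - int 0"
      then show "reduce N 0 i j = x i j" using band[of i j] by force
    qed
    moreover have "?lower 0" using dc by simp
    moreover have "?eliminated 0" by simp
    ultimately show ?case by blast
  next
    case (Suc k)
    let ?i = "N - int k" and ?y = "reduce N k"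
    let ?a = "?y ?i (?i + c) / ?y (?i + 1) (?i + c)"
    have y: "?tnn k" "?le k" "?unchanged k" "?lower k" "?eliminated k" and piv: "?pivot k"
      using Suc pivot by blast+
    have y_nonneg: "0 \<le> ?y i j" for i j
      using totally_nonneg_entry y(1) by blast
    have y_zero: "?y i j = 0" if "x i j = 0" for i j
      using y(2) y_nonneg that by (metis order_antisym)
    have a: "0 \<le> ?a" using y_nonneg by simp
    have "?tnn (Suc k)"
      unfolding reduce.simps
    proof (rule whitney_reduction)
      fix k' j assume k': "k' \<le> ?i + 1" "?i + c < j"
      show "?y k' j = 0"
      proof (cases "k' = ?i + 1 \<and> j = ?i + 1 + c")
        case True
        then show ?thesis using y(5) by simp
      next
        case False
        then have "x k' j = 0" using band[of k' j] k' by force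
        then show ?thesis by (rule y_zero)
      qed
    next
      fix k' assume "k' < ?i"
      then have "x k' (?i + c) = 0" using band[of k' "?i + c"] by force
      then show "?y k' (?i + c) = 0" by (rule y_zero)
    qed (use y piv in auto)
    moreover have "?le (Suc k)"
    proof (intro allI)
      fix i j
      have "?y i j - ?a * ?y (i + 1) j \<le> x i j"
        using y(2) mult_nonneg_nonneg[OF a y_nonneg, of "i + 1" j] by (smt (verit, best))
      then show "reduce N (Suc k) i j \<le> x i j"
        using y(2) by (cases "i = ?i") (simp_all add: subtract_row_def)
    qed
    moreover have "?unchanged (Suc k)"
      using y(3) by (simp add: subtract_row_def)
    moreover have "?lower (Suc k)"
    proof (intro allI impI)
      fix i assume "i \<le> N + 1"
      moreover have "?y (i + 1) (i + d) = 0"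
        by (rule y_zero) (use band[of "i + 1" "i + d"] in force)
      ultimately show "reduce N (Suc k) i (i + d) = x i (i + d)"
        using y(4) by (cases "i = ?i") (simp_all add: subtract_row_def)
    qed
    moreover have "?eliminated (Suc k)"
    proof (intro allI impI)
      fix i assume i: "N - int (Suc k) < i" "i \<le> N + 1"
      show "reduce N (Suc k) i (i + c) = 0"
      proof (cases "i = ?i")
        case True
        then show ?thesis using piv by (simp add: subtract_row_def)
      next
        case False
        then show ?thesis using y(5) i by (simp add: subtract_row_def)
      qed
    qed
    ultimately show ?case by blast
  qed
  then show ?thesis using pivot by blast
qed

lemma reduce_tnn: "totally_nonneg (reduce N k)"
  and reduce_le: "reduce N k i j \<le> x i j"
  and reduce_unchanged: "i \<le> N - int k \<Longrightarrow> reduce N k i j = x i j"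
  and reduce_lower: "i \<le> N + 1 \<Longrightarrow> reduce N k i (i + d) = x i (i + d)"
  and reduce_eliminated: "N - int k < i \<Longrightarrow> i \<le> N + 1 \<Longrightarrow> reduce N k i (i + c) = 0"
  and reduce_pivot: "0 < reduce N k (N - int k + 1) (N - int k + c)"
  using reduce_invariant[of N k] by blast+

lemma reduce_stable: "N - int k < i \<Longrightarrow> reduce N (k + m) i j = reduce N k i j"
  by (induction m) (auto simp: subtract_row_def)

text \<open>
  Later steps leave a processed row alone, so this is the final form of row \<open>i\<close>.
\<close>

definition reduced :: "int \<Rightarrow> infmat" where
  "reduced N i = reduce N (nat (N + 1 - i)) i"

lemma reduced_eq_reduce:
  assumes "N - int k < i" "i \<le> N + 1"
  shows "reduced N i j = reduce N k i j"
proof -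
  define k0 where "k0 = nat (N + 1 - i)"
  have "k0 \<le> k" "N - int k0 < i" using assms by (auto simp: k0_def)
  then show ?thesis
    using reduce_stable[of N k0 i "k - k0" j] by (simp add: reduced_def k0_def)
qed

definition multiplier :: "int \<Rightarrow> int \<Rightarrow> real" where
  "multiplier N i = x i (i + c) / reduced N (i + 1) (i + c)"

lemma reduced_rec:
  assumes "i \<le> N"
  shows "reduced N i j = x i j - multiplier N i * reduced N (i + 1) j"
proof -
  define k where "k = nat (N - i)"
  have k: "N - int k = i" using assms by (simp add: k_def)
  have "reduced N i j = reduce N (Suc k) i j"
    by (rule reduced_eq_reduce) (use k assms in auto)
  also have "\<dots> = reduce N k i j - reduce N k i (i + c) / reduce N k (i + 1) (i + c) * reduce N k (i + 1) j"
    by (simp add: k subtract_row_def)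
  also have "reduce N k (i + 1) = reduced N (i + 1)"
    by (intro ext, rule reduced_eq_reduce[symmetric]) (use k assms in auto)
  finally show ?thesis
    using k by (simp add: reduce_unchanged multiplier_def)
qed

lemma reduced_nonneg: "0 \<le> reduced N i j"
  unfolding reduced_def using totally_nonneg_entry[OF reduce_tnn] .

lemma reduced_le: "reduced N i j \<le> x i j"
  unfolding reduced_def by (rule reduce_le)

lemma reduced_lower: "i \<le> N + 1 \<Longrightarrow> reduced N i (i + d) = x i (i + d)"
  unfolding reduced_def by (rule reduce_lower)

lemma reduced_upper: "i \<le> N + 1 \<Longrightarrow> reduced N i (i + c) = 0"
  unfolding reduced_def by (rule reduce_eliminated) auto

lemma reduced_pivot:
  assumes "i \<le> N + 1"
  shows "0 < reduced N i (i + c - 1)"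
proof -
  define k where "k = nat (N + 1 - i)"
  have k: "N - int k = i - 1" using assms by (simp add: k_def)
  have "0 < reduce N k (i - 1 + 1) (i - 1 + c)"
    using reduce_pivot[of N k] unfolding k .
  then show ?thesis by (simp add: reduced_def k_def diff_add_eq)
qed

lemma reduced_minor_nonneg:
  assumes "length I = length J" "sorted_wrt (<) I" "sorted_wrt (<) J" "\<And>i. i \<in> set I \<Longrightarrow> i \<le> N + 1"
  shows "0 \<le> list_minor (reduced N) I J"
proof -
  obtain lo where lo: "\<And>i. i \<in> set I \<Longrightarrow> lo \<le> i"
    using finite_set[of I] by (metis Min_le)
  have "list_minor (reduced N) I J = list_minor (reduce N (nat (N + 1 - lo))) I J"
  proof (rule list_minor_cong[OF assms(1)])
    fix i j assume "i \<in> set I"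
    then have "lo \<le> i" "i \<le> N + 1" using lo assms by auto
    then show "reduced N i j = reduce N (nat (N + 1 - lo)) i j"
      by (intro reduced_eq_reduce) auto
  qed
  then show ?thesis
    using totally_nonnegD[OF reduce_tnn assms(1-3)] by simp
qed

lemma reduce_minor:
  assumes "length J = length [i..N + 1]" "\<And>j. j \<in> set J \<Longrightarrow> j \<le> N + c"
  shows "list_minor (reduce N k) [i..N + 1] J = list_minor x [i..N + 1] J"
proof (induction k)
  case 0
  show ?case by (rule list_minor_cong) (use assms in auto)
next
  case (Suc k)
  have "list_minor (reduce N (Suc k)) [i..N + 1] J = list_minor (reduce N k) [i..N + 1] J"
    unfolding reduce.simps by (rule list_minor_subtract_row) (use assms in auto)
  then show ?case using Suc by simp
qed

definition corner_minor :: "int \<Rightarrow> int \<Rightarrow> real" where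
  "corner_minor N i = list_minor x [i..N + 1] [i + c - 1..N + c]"

text \<open>
  Elimination does not change minors on the consecutive rows \<open>i, \<dots>, N + 1\<close>, and afterwards the first
  row of this one has a single nonzero entry in these columns. So the entries of \<open>reduced\<close> that serve as pivots are quotients
  of minors of \<open>x\<close>, which makes them comparable for different \<open>N\<close>.
\<close>

lemma corner_minor_rec:
  assumes "i \<le> N + 1"
  shows "corner_minor N i = reduced N i (i + c - 1) * corner_minor N (i + 1)"
proof -
  define k where "k = nat (N + 1 - i)"
  have k: "N - int k = i - 1" using assms by (simp add: k_def)
  let ?y = "reduce N k"
  let ?R = "[i + 1..N + 1]" and ?C = "[i + c..N + c]"
  have lists: "[i..N + 1] = i # ?R" "[i + c - 1..N + c] = (i + c - 1) # ?C"
    using assms upto_rec1[of i "N + 1"] upto_rec1[of "i + c - 1" "N + c"] by simp_all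
  have len: "length ?C = length ?R" by simp
  have "corner_minor N i = list_minor ?y (i # ?R) ((i + c - 1) # ?C)"
  proof -
    have "list_minor ?y [i..N + 1] [i + c - 1..N + c] = list_minor x [i..N + 1] [i + c - 1..N + c]"
      by (rule reduce_minor) auto
    then show ?thesis by (simp only: corner_minor_def lists)
  qed
  also have "\<dots> = (\<Sum>t<Suc (length ?C). (-1) ^ t * ?y i (((i + c - 1) # ?C) ! t) *
      list_minor ?y ?R (delete_nth t ((i + c - 1) # ?C)))"
    using list_minor_expand_row[of "(i + c - 1) # ?C" "[]" ?R ?y i] len by simp
  also have "\<dots> = ?y i (i + c - 1) * list_minor ?y ?R ?C"
  proof -
    have zero: "?y i (?C ! t) = 0" if "t < length ?C" for t
    proof -
      have "?C ! t = i + c + int t" using that by (simp add: nth_upto)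
      moreover have "?y i (i + c + int t) = 0"
      proof (cases "t = 0")
        case True
        then show ?thesis using reduce_eliminated[of N k i] k assms by simp
      next
        case False
        then have "x i (i + c + int t) = 0" using band[of i "i + c + int t"] by force
        then show ?thesis
          using reduce_le[of N k i "i + c + int t"] totally_nonneg_entry[OF reduce_tnn, of N k i "i + c + int t"]
          by linarith
      qed
      ultimately show ?thesis by simp
    qed
    have "(\<Sum>t<length ?C. (-1) ^ Suc t * ?y i (?C ! t) *
        list_minor ?y ?R ((i + c - 1) # delete_nth t ?C)) = 0"
      by (rule sum.neutral) (use zero in auto)
    then show ?thesis
      by (subst sum.lessThan_Suc_shift) (simp del: sum.lessThan_Suc)
  qed
  also have "list_minor ?y ?R ?C = corner_minor N (i + 1)"
    unfolding corner_minor_def using reduce_minor[of ?C "i + 1" N k] by simp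
  also have "?y i (i + c - 1) = reduced N i (i + c - 1)"
    by (rule reduced_eq_reduce[symmetric]) (use k assms in auto)
  finally show ?thesis .
qed

lemma corner_minor_pos: "i \<le> N + 2 \<Longrightarrow> 0 < corner_minor N i"
proof (induction "nat (N + 2 - i)" arbitrary: i)
  case 0
  then have "i = N + 2" by simp
  then show ?case by (simp add: corner_minor_def)
next
  case (Suc m)
  then have "i \<le> N + 1" by simp
  moreover have "0 < corner_minor N (i + 1)"
    by (rule Suc.hyps(1)) (use Suc.hyps(2) in auto)
  ultimately show ?case using corner_minor_rec reduced_pivot by simp
qed

text \<open>
  Condensation of the minor that defines \<open>corner_minor (N + 1) i\<close>, after discarding the nonnegative
  product of the two off-diagonal minors.
\<close>

lemma reduced_pivot_decreasing:
  assumes i: "i \<le> N + 1"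
  shows "reduced (N + 1) i (i + c - 1) \<le> reduced N i (i + c - 1)"
proof -
  let ?P = "[i + 1..N + 1]" and ?Q = "[i + c..N + c]"
  have rows: "i # ?P = [i..N + 1]" "?P @ [N + 2] = [i + 1..N + 2]" "i # [i + 1..N + 2] = [i..N + 2]"
    using i upto_rec1[of i "N + 1"] upto_rec1[of i "N + 2"] upto_rec2[of "i + 1" "N + 2"]
    by (simp_all add: add.commute)
  have cols: "(i + c - 1) # ?Q = [i + c - 1..N + c]" "?Q @ [N + 1 + c] = [i + c..N + 1 + c]"
    "(i + c - 1) # [i + c..N + 1 + c] = [i + c - 1..N + 1 + c]"
    using i upto_rec1[of "i + c - 1" "N + c"] upto_rec1[of "i + c - 1" "N + 1 + c"]
      upto_rec2[of "i + c" "N + 1 + c"] by simp_all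
  have "0 \<le> list_minor x (?P @ [N + 2]) ((i + c - 1) # ?Q) * list_minor x (i # ?P) (?Q @ [N + 1 + c])"
    unfolding rows cols
    by (intro mult_nonneg_nonneg totally_nonnegD[OF tnn]) (auto simp: sorted_upto)
  then have "list_minor x ?P ?Q * list_minor x (i # ?P @ [N + 2]) ((i + c - 1) # ?Q @ [N + 1 + c])
      \<le> list_minor x (i # ?P) ((i + c - 1) # ?Q) * list_minor x (?P @ [N + 2]) (?Q @ [N + 1 + c])"
    using desnanot_jacobi[of ?P ?Q x i "i + c - 1" "N + 2" "N + 1 + c"] by simp
  then have "corner_minor N (i + 1) * corner_minor (N + 1) i \<le> corner_minor N i * corner_minor (N + 1) (i + 1)"
    unfolding rows cols by (simp add: corner_minor_def algebra_simps)
  then have "(corner_minor N (i + 1) * corner_minor (N + 1) (i + 1)) * reduced (N + 1) i (i + c - 1) \<le>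
      (corner_minor N (i + 1) * corner_minor (N + 1) (i + 1)) * reduced N i (i + c - 1)"
    using corner_minor_rec[of i N] corner_minor_rec[of i "N + 1"] i by (simp add: mult_ac)
  moreover have "0 < corner_minor N (i + 1) * corner_minor (N + 1) (i + 1)"
    using corner_minor_pos i by simp
  ultimately show ?thesis by (rule mult_left_le_imp_le)
qed

lemma multiplier_nonneg: "0 \<le> multiplier N i"
  unfolding multiplier_def by (simp add: nonneg reduced_nonneg)

lemma multiplier_increasing: "i \<le> N \<Longrightarrow> multiplier N i \<le> multiplier (N + 1) i"
  unfolding multiplier_def
  using reduced_pivot_decreasing[of "i + 1" N] reduced_pivot[of "i + 1" "N + 1"]
  by (intro divide_left_mono) (auto simp: nonneg algebra_simps intro!: mult_pos_pos reduced_pivot[of "i + 1", simplified])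

text \<open>
  The reduced row \<open>i\<close> is nonnegative next to its lower edge, where row \<open>i + 1\<close> keeps its original entry.
\<close>

lemma multiplier_bounded:
  assumes "i \<le> N"
  shows "multiplier N i \<le> x i (i + 1 + d) / x (i + 1) (i + 1 + d)"
proof -
  have "0 \<le> x i (i + 1 + d) - multiplier N i * x (i + 1) (i + 1 + d)"
    using reduced_nonneg[of N i "i + 1 + d"] reduced_rec[OF assms, of "i + 1 + d"]
      reduced_lower[of "i + 1" N] assms by simp
  then show ?thesis using lower_pos[of "i + 1"] by (simp add: field_simps)
qed

definition whirl_parameter :: "int \<Rightarrow> real" where
  "whirl_parameter i = lim (\<lambda>k. multiplier (int k) i)"

lemma multiplier_limit: "(\<lambda>k. multiplier (int k) i) \<longlonglongrightarrow> whirl_parameter i"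
proof -
  define f where "f = (\<lambda>k. multiplier (int (k + nat i)) i)"
  have "incseq f"
  proof (rule incseq_SucI)
    fix k
    show "f k \<le> f (Suc k)"
      using multiplier_increasing[of i "int (k + nat i)"] by (simp add: f_def algebra_simps)
  qed
  moreover have "f k \<le> x i (i + 1 + d) / x (i + 1) (i + 1 + d)" for k
    unfolding f_def by (rule multiplier_bounded) simp
  ultimately obtain v where "f \<longlonglongrightarrow> v" using incseq_convergent[of f] by blast
  then have "(\<lambda>k. multiplier (int k) i) \<longlonglongrightarrow> v"
    unfolding f_def by (rule LIMSEQ_offset)
  then show ?thesis unfolding whirl_parameter_def by (metis limI)
qed

lemma whirl_parameter_nonneg: "0 \<le> whirl_parameter i"
  by (rule LIMSEQ_le_const[OF multiplier_limit]) (auto simp: multiplier_nonneg)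

lemma corner_minor_periodic: "corner_minor (N + int n) (i + int n) = corner_minor N i"
proof -
  have shift_upto: "[a + int n..b + int n] = map (\<lambda>k. k + int n) [a..b]" for a b
    by (rule nth_equalityI) (simp_all add: nth_upto)
  have "[i + int n..N + int n + 1] = map (\<lambda>k. k + int n) [i..N + 1]"
    using shift_upto[of i "N + 1"] by (simp add: algebra_simps)
  moreover have "[i + int n + c - 1..N + int n + c] = map (\<lambda>k. k + int n) [i + c - 1..N + c]"
    using shift_upto[of "i + c - 1" "N + c"] by (simp add: algebra_simps)
  ultimately show ?thesis
    by (simp add: corner_minor_def list_minor_map periodic)
qed

lemma multiplier_periodic:
  assumes "i \<le> N"
  shows "multiplier (N + int n) (i + int n) = multiplier N i"
proof -
  have *: "reduced M k (k + c - 1) = corner_minor M k / corner_minor M (k + 1)" if "k \<le> M + 1" for M k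
    using corner_minor_rec[OF that] corner_minor_pos[of "k + 1" M] that by simp
  have "reduced (N + int n) (i + 1 + int n) (i + 1 + int n + c - 1) = reduced N (i + 1) (i + 1 + c - 1)"
    using *[of "i + 1 + int n" "N + int n"] *[of "i + 1" N] assms
      corner_minor_periodic[of N "i + 1"] corner_minor_periodic[of N "i + 2"]
    by (simp add: algebra_simps)
  then show ?thesis
    using periodic[of i "i + c"] by (simp add: multiplier_def algebra_simps)
qed

lemma whirl_parameter_periodic: "whirl_parameter (i + int n) = whirl_parameter i"
proof -
  have "(\<lambda>k. multiplier (int (k + n)) (i + int n)) \<longlonglongrightarrow> whirl_parameter (i + int n)"
    by (rule LIMSEQ_ignore_initial_segment[OF multiplier_limit])
  moreover have "eventually (\<lambda>k. multiplier (int (k + n)) (i + int n) = multiplier (int k) i) sequentially"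
    by (rule eventually_sequentiallyI[of "nat i"]) (use multiplier_periodic[of i] in auto)
  ultimately have "(\<lambda>k. multiplier (int k) i) \<longlonglongrightarrow> whirl_parameter (i + int n)"
    by (rule Lim_transform_eventually)
  then show ?thesis using LIMSEQ_unique multiplier_limit by blast
qed

text \<open>
  The unfolding of the right factor once a whirl with parameters \<open>whirl_parameter\<close> is split off.
\<close>

definition quotient :: infmat where
  "quotient i j = lim (\<lambda>k. reduced (int k) i j)"

lemma eventually_ge_int: "eventually (\<lambda>k. i \<le> int k) sequentially"
  by (rule eventually_sequentiallyI[of "nat i"]) auto

lemma reduced_convergent: "convergent (\<lambda>k. reduced (int k) i j)"
proof (induction "nat (j - d + 1 - i)" arbitrary: i)
  case 0
  then have "x i j = 0" using band[of i j] by force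
  then have "reduced N i j = 0" for N
    using reduced_nonneg[of N i j] reduced_le[of N i j] by simp
  then show ?case by (simp add: convergent_const)
next
  case (Suc m)
  have "convergent (\<lambda>k. reduced (int k) (i + 1) j)"
    by (rule Suc.hyps(1)) (use Suc.hyps(2) in simp)
  then obtain v where "(\<lambda>k. reduced (int k) (i + 1) j) \<longlonglongrightarrow> v"
    by (auto simp: convergent_def)
  then have "(\<lambda>k. x i j - multiplier (int k) i * reduced (int k) (i + 1) j) \<longlonglongrightarrow>
      x i j - whirl_parameter i * v"
    by (intro tendsto_intros multiplier_limit)
  then have "(\<lambda>k. reduced (int k) i j) \<longlonglongrightarrow> x i j - whirl_parameter i * v"
    by (rule Lim_transform_eventually)
      (rule eventually_mono[OF eventually_ge_int[of i]], simp add: reduced_rec)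
  then show ?case by (auto simp: convergent_def)
qed

lemma reduced_limit: "(\<lambda>k. reduced (int k) i j) \<longlonglongrightarrow> quotient i j"
  unfolding quotient_def using reduced_convergent convergent_LIMSEQ_iff by blast

lemma quotient_rec: "quotient i j = x i j - whirl_parameter i * quotient (i + 1) j"
proof -
  have "(\<lambda>k. x i j - multiplier (int k) i * reduced (int k) (i + 1) j) \<longlonglongrightarrow>
      x i j - whirl_parameter i * quotient (i + 1) j"
    by (intro tendsto_intros multiplier_limit reduced_limit)
  then have "(\<lambda>k. reduced (int k) i j) \<longlonglongrightarrow> x i j - whirl_parameter i * quotient (i + 1) j"
    by (rule Lim_transform_eventually)
      (rule eventually_mono[OF eventually_ge_int[of i]], simp add: reduced_rec)
  then show ?thesis using LIMSEQ_unique reduced_limit by blast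
qed

lemma quotient_nonneg: "0 \<le> quotient i j"
  by (rule LIMSEQ_le_const[OF reduced_limit]) (auto simp: reduced_nonneg)

lemma quotient_le: "quotient i j \<le> x i j"
  by (rule LIMSEQ_le_const2[OF reduced_limit]) (auto simp: reduced_le)

lemma quotient_below: "j < i + d \<Longrightarrow> quotient i j = 0"
  using quotient_nonneg[of i j] quotient_le[of i j] band[of i j] by force

lemma quotient_upper: "quotient i (i + c) = 0"
proof -
  have "(\<lambda>k. reduced (int k) i (i + c)) \<longlonglongrightarrow> 0"
    by (rule tendsto_eventually, rule eventually_mono[OF eventually_ge_int[of i]])
      (simp add: reduced_upper)
  then show ?thesis using LIMSEQ_unique reduced_limit by blast
qed

lemma quotient_periodic: "quotient (i + int n) (j + int n) = quotient i j"
proof (induction "nat (j - d + 1 - i)" arbitrary: i)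
  case 0
  then show ?case by (simp add: quotient_below)
next
  case (Suc m)
  have "quotient (i + 1 + int n) (j + int n) = quotient (i + 1) j"
    by (rule Suc.hyps(1)) (use Suc.hyps(2) in simp)
  then show ?case
    using quotient_rec[of i j] quotient_rec[of "i + int n" "j + int n"]
    by (simp add: periodic whirl_parameter_periodic algebra_simps)
qed

lemma quotient_tnn: "totally_nonneg quotient"
proof (rule totally_nonneg_limit[where F = sequentially, OF reduced_limit])
  fix I J :: "int list"
  assume IJ: "length I = length J" "sorted_wrt (<) I" "sorted_wrt (<) J"
  obtain hi where hi: "\<And>i. i \<in> set I \<Longrightarrow> i \<le> hi"
    using finite_set[of I] by (metis Max_ge)
  show "eventually (\<lambda>k. 0 \<le> list_minor (reduced (int k)) I J) sequentially"
    by (rule eventually_mono[OF eventually_ge_int[of hi]])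
      (intro reduced_minor_nonneg IJ, use hi in force)
qed simp

end

section \<open>Factorization\<close>

lemma shift_inverse_matrix:
  assumes n: "n \<ge> 1"
  defines "R \<equiv> folding_mat n (\<lambda>i j. if j = i - 1 then 1 else 0)"
  shows "unfolding_mat n R = (\<lambda>i j. if j = i - 1 then 1 else 0)" "R \<in> shifts n"
proof -
  show R: "unfolding_mat n R = (\<lambda>i j. if j = i - 1 then 1 else 0)"
    unfolding R_def by (rule unfolding_folding[OF n, where B = 2]) auto
  have Rc: "R \<in> carrier_mat n n" by (simp add: R_def)
  have SR: "folding_mat n shift * R = 1\<^sub>m n"
  proof (rule unfolding_inject[of _ n])
    show "unfolding_mat n (folding_mat n shift * R) = unfolding_mat n (1\<^sub>m n)"
    proof (intro ext)
      fix i j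
      have "unfolding_mat n (folding_mat n shift * R) i j = unfolding_mat n R (i + 1) j"
        by (subst unfolding_mult_two_terms[OF n folding_carrier Rc, of i "i + 1"])
          (simp_all add: unfolding_generators[OF n] shift_def)
      then show "unfolding_mat n (folding_mat n shift * R) i j = unfolding_mat n (1\<^sub>m n) i j"
        by (simp add: R unfolding_one[OF n])
    qed
  qed (use mult_carrier_mat[OF folding_carrier Rc] in auto)
  then show "R \<in> shifts n"
    using Rc mat_mult_left_right_inverse[OF folding_carrier Rc SR]
      carrier_matD[OF Rc] carrier_matD[OF folding_carrier[of n shift]]
    by (simp add: shifts_def inverts_mat_def)
qed

lemma chevalley_generator:
  assumes "n \<ge> 2" "0 \<le> a"
  shows "folding_mat n (chevalley_upper n k a) \<in> generators n"
    and "folding_mat n (chevalley_lower n k a) \<in> generators n"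
  using assms by (auto simp: generators_def chevalleys_def)

lemma whirl_generator: "(\<And>i. 0 \<le> a i) \<Longrightarrow> folding_mat n (whirl n a) \<in> generators n"
  by (auto simp: generators_def whirls_def)

lemma torus_factorizable:
  assumes n: "n \<ge> 1" and X: "X \<in> carrier_mat n n"
    and diag: "\<And>i j. unfolding_mat n X i j \<noteq> 0 \<Longrightarrow> j = i" and pos: "\<And>i. 0 < unfolding_mat n X i i"
  shows "factorizable n X"
proof -
  let ?d = "\<lambda>i :: nat. unfolding_mat n X (int i + 1) (int i + 1)"
  have "X = mat_diag n (\<lambda>i. fls_const (?d i))"
  proof (rule unfolding_inject[OF X])
    show "unfolding_mat n X = unfolding_mat n (mat_diag n (\<lambda>i. fls_const (?d i)))"
    proof (intro ext)
      fix i j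
      have "unfolding_mat n X i i = unfolding_mat n X ((i - 1) mod int n + 1) ((i - 1) mod int n + 1)"
        by (simp add: unfolding_mat_def)
      then have "unfolding_mat n X i i = ?d (nat ((i - 1) mod int n))"
        using n by simp
      then show "unfolding_mat n X i j = unfolding_mat n (mat_diag n (\<lambda>i. fls_const (?d i))) i j"
        unfolding unfolding_mat_diag[OF n] using diag[of i j] by auto
    qed
  qed simp
  then have "X \<in> torus_pos n" using pos by (auto simp: torus_pos_def)
  then show ?thesis by (intro factorizable_generator) (simp add: generators_def)
qed

text \<open>
  Induction on the distance of the only nonzero diagonal from the main diagonal, splitting off one
  shift at a time.
\<close>

lemma monomial_factorizable:
  assumes n: "n \<ge> 1" and "X \<in> GL_loop_nonneg n"
    and "\<And>i j. unfolding_mat n X i j \<noteq> 0 \<Longrightarrow> j = i + d" and "\<And>i. 0 < unfolding_mat n X i (i + d)"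
  shows "factorizable n X"
  using assms(2-)
proof (induction "nat \<bar>d\<bar>" arbitrary: X d)
  case 0
  then show ?case
    by (intro torus_factorizable[OF n]) (auto simp: GL_loop_nonneg_iff GL_loop_def)
next
  case (Suc m)
  let ?x = "unfolding_mat n X"
  define s :: int where "s = sgn d"
  have s: "s = 1 \<or> s = - 1" "m = nat \<bar>d - s\<bar>"
    using Suc.hyps(2) by (auto simp: s_def sgn_if)
  have s0: "s \<noteq> 0" using s(1) by auto
  define y where "y = (\<lambda>i j. ?x (i - s) j)"
  have y_shift: "y (i + s) j = ?x i j" for i j by (simp add: y_def)
  \<comment> \<open>the shift matrix or its inverse, according to the sign of \<open>d\<close>\<close>
  define G where "G = folding_mat n (if s = 1 then shift else (\<lambda>i j. if j = i - 1 then 1 else 0))"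
  have G: "unfolding_mat n G = (\<lambda>i j. if j = i + s then 1 else 0)" "G \<in> generators n"
    using s(1) shift_inverse_matrix[OF n] unfolding_generators(3)[OF n]
    by (auto simp: G_def generators_def shifts_def shift_def fun_eq_iff)
  have Gc: "G \<in> carrier_mat n n" by (simp add: G_def)
  have tnn: "totally_nonneg ?x" using Suc.prems by (simp add: GL_loop_nonneg_iff)
  have "totally_nonneg y"
    unfolding totally_nonneg_def
  proof (intro allI impI)
    fix I J :: "int list"
    assume IJ: "length I = length J" "sorted_wrt (<) I" "sorted_wrt (<) J"
    have "list_minor y I J = list_minor ?x (map (\<lambda>i. i - s) I) (map (\<lambda>j. j) J)"
      unfolding list_minor_map y_def ..
    also have "\<dots> \<ge> 0"
      by (rule totally_nonnegD[OF tnn]) (use IJ in \<open>auto simp: sorted_wrt_map\<close>)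
    finally show "0 \<le> list_minor y I J" .
  qed
  obtain B where B: "\<And>i j. j < i - B \<Longrightarrow> ?x i j = 0"
    using unfolding_lower_bound[OF n, of X] by blast
  have per: "y (i + int n) (j + int n) = y i j" for i j
    using unfolding_periodic[OF n, of X "i - s" j] by (simp add: y_def algebra_simps)
  have lower: "y i j = 0" if "j < i - (B + 1)" for i j
    using B[of j "i - s"] s(1) that by (auto simp: y_def)
  have eq: "unfolding_mat n (G * folding_mat n y) = ?x" if y: "unfolding_mat n (folding_mat n y) = y"
  proof (intro ext)
    fix i j
    show "unfolding_mat n (G * folding_mat n y) i j = ?x i j"
      by (subst unfolding_mult_two_terms[OF n Gc folding_carrier, of i "i + s"])
        (use s0 in \<open>simp_all add: G y y_shift\<close>)
  qed
  have y: "folding_mat n y \<in> GL_loop_nonneg n" "unfolding_mat n (folding_mat n y) = y"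
    "X = G * folding_mat n y"
    by (rule split_off_left_factor[where y = y and B = "B + 1", OF n Suc.prems(1) Gc];
      use per lower \<open>totally_nonneg y\<close> eq in blast)+
  have entry: "unfolding_mat n (folding_mat n y) i j = ?x (i - s) j" for i j
    unfolding y(2) by (simp add: y_def)
  have "factorizable n (folding_mat n y)"
  proof (rule Suc.hyps(1)[OF s(2)])
    show "j = i + (d - s)" if "unfolding_mat n (folding_mat n y) i j \<noteq> 0" for i j
      using Suc.prems(2)[of "i - s" j] that unfolding entry by simp
    show "0 < unfolding_mat n (folding_mat n y) i (i + (d - s))" for i
      unfolding entry using Suc.prems(3)[of "i - s"] by (simp add: algebra_simps)
  qed (rule y(1))
  then have "factorizable n (G * folding_mat n y)"
    by (rule factorizable_mult[OF G(2)])
  then show ?case by (simp only: y(3)[symmetric])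
qed

text \<open>
  If two neighbouring rows end, or begin, in the same column, a Chevalley generator splits off;
  otherwise both edges advance by exactly one column per row, and a whirl splits off unless the
  band is a single diagonal. In each case some edge entry disappears from the support.
\<close>

lemma banded_factorizable:
  assumes n: "n \<ge> 1" and "X \<in> GL_loop_nonneg n" and "banded_tnn_unfolding n (unfolding_mat n X)"
  shows "factorizable n X"
  using assms(2-)
proof (induction "banded_tnn_unfolding.support_size n (unfolding_mat n X)" arbitrary: X rule: less_induct)
  case less
  let ?x = "unfolding_mat n X"
  interpret banded_tnn_unfolding n ?x by (rule less.prems)
  have X: "X \<in> GL_loop_nonneg n" by (rule less.prems)
  obtain B where B: "\<And>i j. j < i - B \<Longrightarrow> ?x i j = 0"
    using lower_bound by blast
  have reduce: "factorizable n X"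
    if G: "G \<in> generators n"
      and per: "\<And>i j. y (i + int n) (j + int n) = y i j"
      and lower: "\<And>i j. j < i - (B + 1) \<Longrightarrow> y i j = 0"
      and tnn: "totally_nonneg y"
      and eq: "unfolding_mat n (folding_mat n y) = y \<Longrightarrow> unfolding_mat n (G * folding_mat n y) = ?x"
      and le: "\<And>i j. y i j \<le> ?x i j"
      and lt: "?x p m \<noteq> 0" "y p m = 0"
    for G y p m
  proof -
    have Y: "folding_mat n y \<in> GL_loop_nonneg n" "unfolding_mat n (folding_mat n y) = y"
      "X = G * folding_mat n y"
      by (rule split_off_left_factor[where y = y and B = "B + 1", OF n X generators_carrier[OF G]];
        use per lower tnn eq in blast)+
    interpret Y: tnn_unfolding n y
      using GL_loop_nonneg_tnn_unfolding[OF n Y(1)] by (simp only: Y(2))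
    obtain C where C: "\<And>i j. j > i + C \<Longrightarrow> ?x i j = 0" using upper_bound by blast
    have "y i j = 0" if "j > i + C" for i j
      using le[of i j] C[OF that] Y.nonneg[of i j] by simp
    then have band: "banded_tnn_unfolding n y"
      by unfold_locales blast
    have "factorizable n (folding_mat n y)"
      by (rule less.hyps) (use support_decreases[OF band le lt] band Y in auto)
    then show ?thesis using factorizable_mult[OF G] Y(3) by simp
  qed
  consider (top) p where "top p = top (p + 1)" | (bot) p where "bot p = bot (p + 1)"
    | (strict) "\<And>i. top i < top (i + 1)" "\<And>i. bot i < bot (i + 1)"
    using top_mono[of i "i + 1" for i] bot_mono[of i "i + 1" for i]
    by (metis order_less_le zle_add1_eq_le less_add_one order_less_imp_le)
  then show ?case
  proof cases
    case top
    have n2: "n \<ge> 2"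
      using top top_periodic[of p] n by (cases "n = 1") auto
    obtain q where q: "top (q - 1) < top q" "top q = top (q + 1)"
      using jump_exists[of n top p] n top top_mono top_periodic by force
    define m where "m = top q"
    define a where "a = ?x q m / ?x (q + 1) m"
    have piv: "0 < ?x (q + 1) m" "0 < ?x q m"
      using top_pos[of q] top_pos[of "q + 1"] q by (simp_all add: m_def)
    have next_row: "\<not> [i + 1 = q] (mod int n)" if "[i = q] (mod int n)" for i
    proof
      assume "[i + 1 = q] (mod int n)"
      then have "int n dvd i + 1 - q" "int n dvd i - q"
        using that by (simp_all only: cong_iff_dvd_diff)
      then have "int n dvd (i + 1 - q) - (i - q)" by (rule dvd_diff)
      then show False using n2 by simp
    qed
    let ?y = "\<lambda>i j. if [i = q] (mod int n) then ?x i j - a * ?x (i + 1) j else ?x i j"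
    show ?thesis
    proof (rule reduce[of "folding_mat n (chevalley_upper n q a)" ?y q m])
      show "folding_mat n (chevalley_upper n q a) \<in> generators n"
        by (rule chevalley_generator[OF n2]) (use piv in \<open>simp add: a_def\<close>)
      show "totally_nonneg ?y"
        unfolding a_def
      proof (rule periodic_whitney_reduction[OF n2 tnn periodic_multiple])
        show "?x k j = 0" if "k \<le> q + 1" "m < j" for k j
          using top_mono[OF that(1)] that(2) q by (intro above_top) (simp add: m_def)
        show "?x k m = 0" if "k < q" for k
          using top_mono[of k "q - 1"] that q by (intro above_top) (simp add: m_def)
      qed (rule piv)
      show "?y (i + int n) (j + int n) = ?y i j" for i j
        using periodic[of i j] periodic[of "i + 1" j] by (simp add: cong_def algebra_simps)
      show "?y i j = 0" if "j < i - (B + 1)" for i j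
        using B[of j i] B[of j "i + 1"] that by simp
      show "?y i j \<le> ?x i j" for i j
        using nonneg[of "i + 1" j] piv by (simp add: a_def)
      show "unfolding_mat n (folding_mat n (chevalley_upper n q a) * folding_mat n ?y) = ?x"
        if y: "unfolding_mat n (folding_mat n ?y) = ?y"
        by (intro ext) (simp add: unfolding_chevalley_upper_mult[OF n folding_carrier] y next_row)
      show "?y q m = 0" using piv by (simp add: a_def)
    qed (use piv in auto)
  next
    case bot
    have n2: "n \<ge> 2"
      using bot bot_periodic[of p] n by (cases "n = 1") auto
    have "\<exists>q. bot q = bot (q + 1) \<and> bot (q + 1) < bot (q + 2)"
    proof -
      let ?g = "\<lambda>i. - bot (- i)"
      have mono: "?g i \<le> ?g (i + 1)" for i
        using bot_mono[of "- (i + 1)" "- i"] by simp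
      have per: "?g (i + int n) = ?g i + int n" for i
        using bot_periodic[of "- (i + int n)"] by simp
      have flat: "?g (- p - 1) = ?g (- p - 1 + 1)"
        using bot by (simp add: add.commute)
      obtain r where r: "?g (r - 1) < ?g r" "?g r = ?g (r + 1)"
        using jump_exists[of n ?g, OF n mono per flat] .
      have "- (r + 1) + 1 = - r" "- (r + 1) + 2 = - (r - 1)" by simp_all
      then have "bot (- (r + 1)) = bot (- (r + 1) + 1)" "bot (- (r + 1) + 1) < bot (- (r + 1) + 2)"
        using r by (simp_all only: neg_less_iff_less neg_equal_iff_equal)
      then show ?thesis by blast
    qed
    then obtain q where q: "bot q = bot (q + 1)" "bot (q + 1) < bot (q + 2)" by blast
    define m where "m = bot q"
    define a where "a = ?x (q + 1) m / ?x q m"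
    have piv: "0 < ?x (q + 1) m" "0 < ?x q m"
      using bot_pos[of q] bot_pos[of "q + 1"] q by (simp_all add: m_def)
    have prev_row: "\<not> [i - 1 - 1 = q] (mod int n)" if "[i - 1 = q] (mod int n)" for i
    proof
      assume "[i - 1 - 1 = q] (mod int n)"
      then have "int n dvd i - 1 - 1 - q" "int n dvd i - 1 - q"
        using that by (simp_all only: cong_iff_dvd_diff)
      then have "int n dvd (i - 1 - q) - (i - 1 - 1 - q)" by (metis dvd_diff)
      then show False using n2 by simp
    qed
    let ?y = "\<lambda>i j. if [i - 1 = q] (mod int n) then ?x i j - a * ?x (i - 1) j else ?x i j"
    show ?thesis
    proof (rule reduce[of "folding_mat n (chevalley_lower n q a)" ?y "q + 1" m])
      show "folding_mat n (chevalley_lower n q a) \<in> generators n"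
        by (rule chevalley_generator[OF n2]) (use piv in \<open>simp add: a_def\<close>)
      show "totally_nonneg ?y"
        unfolding a_def
      proof (rule periodic_whitney_reduction_lower[OF n2 tnn periodic_multiple])
        show "?x k j = 0" if "q \<le> k" "j < m" for k j
          using bot_mono[OF that(1)] that(2) q by (intro below_bot) (simp add: m_def)
        show "?x k m = 0" if "q + 1 < k" for k
          using bot_mono[of "q + 2" k] that q by (intro below_bot) (simp add: m_def)
      qed (rule piv)
      show "?y (i + int n) (j + int n) = ?y i j" for i j
      proof -
        have "i + int n - 1 = i - 1 + int n" by simp
        then show ?thesis
          by (simp only: periodic cong_def mod_add_self2)
      qed
      show "?y i j = 0" if "j < i - (B + 1)" for i j
        using B[of j i] B[of j "i - 1"] that by simp
      show "?y i j \<le> ?x i j" for i j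
        using nonneg[of "i - 1" j] piv by (simp add: a_def)
      show "unfolding_mat n (folding_mat n (chevalley_lower n q a) * folding_mat n ?y) = ?x"
        if y: "unfolding_mat n (folding_mat n ?y) = ?y"
        by (intro ext) (simp add: unfolding_chevalley_lower_mult[OF n folding_carrier] y prev_row[simplified])
      show "?y (q + 1) m = 0" using piv by (simp add: a_def)
    qed (use piv in auto)
  next
    case strict
    define c d where "c = top 0" and "d = bot 0"
    have top: "top i = i + c" for i
      unfolding c_def by (rule strictly_increasing_periodic_int[OF n strict(1) top_periodic])
    have bot: "bot i = i + d" for i
      unfolding d_def by (rule strictly_increasing_periodic_int[OF n strict(2) bot_periodic])
    have band: "i + d \<le> j \<and> j \<le> i + c" if "?x i j \<noteq> 0" for i j
      using above_top[of i j] below_bot[of j i] that top bot by force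
    have upper: "0 < ?x i (i + c)" and lower: "0 < ?x i (i + d)" for i
      using top_pos[of i] bot_pos[of i] by (simp_all only: top bot)
    show ?thesis
    proof (cases "c = d")
      case True
      show ?thesis
      proof (rule monomial_factorizable[OF n X])
        show "j = i + d" if "?x i j \<noteq> 0" for i j
          using band[OF that] True by simp
      qed (rule lower)
    next
      case False
      have "d < c" using False bot_le_top[of 0] top[of 0] bot[of 0] by simp
      interpret strict_band_unfolding n ?x c d
        by unfold_locales (use band upper lower \<open>d < c\<close> in auto)
      define a where "a = (\<lambda>m :: nat. whirl_parameter (int m))"
      have cyc_a: "cyc n a i = whirl_parameter i" for i
        unfolding a_def by (rule cyc_eq[where f = whirl_parameter, OF n whirl_parameter_periodic])
      show ?thesis
      proof (rule reduce[of "folding_mat n (whirl n a)" quotient 0 c])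
        show "folding_mat n (whirl n a) \<in> generators n"
          by (rule whirl_generator) (simp add: a_def whirl_parameter_nonneg)
        show "quotient i j = 0" if "j < i - (B + 1)" for i j
          using quotient_nonneg[of i j] quotient_le[of i j] B[of j i] that by simp
        show "unfolding_mat n (folding_mat n (whirl n a) * folding_mat n quotient) = ?x"
          if y: "unfolding_mat n (folding_mat n quotient) = quotient"
        proof (intro ext)
          fix i j
          show "unfolding_mat n (folding_mat n (whirl n a) * folding_mat n quotient) i j = ?x i j"
            using quotient_rec[of i j] by (simp add: unfolding_whirl_mult[OF n folding_carrier] y cyc_a)
        qed
        show "quotient 0 c = 0" using quotient_upper[of 0] by simp
        show "?x 0 c \<noteq> 0" using upper_pos[of 0] by simp
      qed (rule quotient_periodic quotient_tnn quotient_le)+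
    qed
  qed
qed

text \<open>
  Induction on the corner rank: a curl is split off as long as the matrix is not a band.
\<close>

lemma corner_minors_vanish_imp_factorizable:
  assumes n: "n \<ge> 1" and "X \<in> GL_loop_nonneg n" and "corner_minors_vanish (unfolding_mat n X) h r c"
  shows "factorizable n X"
  using assms(2-)
proof (induction h arbitrary: X r)
  case (0 X r)
  interpret tnn_unfolding n "unfolding_mat n X"
    by (rule GL_loop_nonneg_tnn_unfolding[OF n 0(1)])
  have "unfolding_mat n X r l = 0" if "l > c" for l
    using 0(2)[unfolded corner_minors_vanish_def, rule_format, of "[r]" "[l]"] that
    by (simp add: list_minor_1)
  then have "\<not> unbounded"
    unfolding unbounded_def by (metis less_add_one order_less_le_trans)
  then obtain C where "\<And>i j. j > i + C \<Longrightarrow> unfolding_mat n X i j = 0"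
    using bounded_imp_band by blast
  then have "banded_tnn_unfolding n (unfolding_mat n X)" by unfold_locales blast
  then show ?case by (rule banded_factorizable[OF n 0(1)])
next
  case (Suc h X r)
  interpret tnn_unfolding n "unfolding_mat n X"
    by (rule GL_loop_nonneg_tnn_unfolding[OF n Suc.prems(1)])
  show ?case
  proof (cases unbounded)
    case False
    then obtain C where "\<And>i j. j > i + C \<Longrightarrow> unfolding_mat n X i j = 0"
      using bounded_imp_band by blast
    then have "banded_tnn_unfolding n (unfolding_mat n X)" by unfold_locales blast
    then show ?thesis by (rule banded_factorizable[OF n Suc.prems(1)])
  next
    case unbounded: True
    show ?thesis
    proof (cases "corner_minors_vanish (unfolding_mat n X) h r c")
      case True
      then show ?thesis by (rule Suc.IH[OF Suc.prems(1)])
    next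
      case False
      obtain N X' where "N \<in> curls n" "X' \<in> GL_loop_nonneg n" "X = N * X'"
        "corner_minors_vanish (unfolding_mat n X') h (r - 1) c"
        using peel_curl[OF n Suc.prems(1) unbounded Suc.prems(2) False] .
      then show ?thesis
        using Suc.IH factorizable_mult[of N n X'] by (auto simp: generators_def)
    qed
  qed
qed

theorem theorem5p14:
  fixes n :: nat and X :: "real fls mat"
  assumes "n \<ge> 1"
    and "X \<in> GL_loop_nonneg n"
  shows "\<not> totally_positive n X \<longleftrightarrow>
    (\<exists>Ys. set Ys \<subseteq> generators n \<and> X = mat_product n Ys)"
proof
  assume "\<not> totally_positive n X"
  then obtain h r c where "corner_minors_vanish (unfolding_mat n X) h r c"
    using not_totally_positive_imp_corner_minors_vanish[OF assms] by blast
  then have "factorizable n X"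
    by (rule corner_minors_vanish_imp_factorizable[OF assms])
  then show "\<exists>Ys. set Ys \<subseteq> generators n \<and> X = mat_product n Ys"
    unfolding factorizable_def .
next
  assume "\<exists>Ys. set Ys \<subseteq> generators n \<and> X = mat_product n Ys"
  then show "\<not> totally_positive n X"
    using product_not_totally_positive[OF assms(1)] by blast
qed

end
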